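(* Let $n\geqslant 3$ and let $L_1^{n+1}$ be a locally symmetric Lorentz space of dimension $n+1$ for which there are constants $c_1,c_2$ such that its sectional curvature $K$ satisfies $K(u,v)=-\frac{c_1}{n}$ for any spacelike vector $u$ and any timelike vector $v$, and $K(u,v)\geqslant c_2$ for any spacelike vectors $u$ and $v$. Assume $c=2c_2+\frac{c_1}{n}>0$. Let $M^n$ be a spacelike hypersurface in $L_1^{n+1}$ with normalized scalar curvature $R$, mean curvature $H$ and squared length $S$ of the second fundamental form, and define $P$ by $n(n-1)P=n^2H^2-S$. Suppose that there are $a,b\in\mathbb{R}$ such that $P+aH=b$ on $M^n$ and $(n-1)a^2+4nb\geqslant 0$. Let $\square$ be the operator acting on $C^2$-functions $f$ on $M^n$ by $$\square(f)=\sum_{i,j}(nH\delta_{ij}-h_{ij})f_{ij}.$$ Then $$\square(nH)\geqslant-\frac12\triangle\bigl(n(n-1)R\bigr)+|\phi|^2L_{|H|}(|\phi|),$$ where $|\phi|^2=S-nH^2$ and $L_{|H|}(|\phi|)=|\phi|^2-\frac{n(n-2)}{\sqrt{n(n-1)}}|H||\phi|+nc-nH^2$.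
   Context: A Lorentz space $L_1^{n+1}$ is an $(n+1)$-dimensional connected semi-Riemannian manifold of index $1$; it is locally symmetric if its curvature tensor is parallel. The sectional curvature of the nondegenerate plane spanned by $u,v$ is denoted $K(u,v)$. A hypersurface $M^n$ is spacelike if the induced metric is positive definite (a Riemannian metric). With $\{e_1,\dots,e_n\}$ a local orthonormal tangent frame of $M^n$ and $e_{n+1}$ a unit timelike normal, $h_{ij}$ are the components of the second fundamental form, $H=\frac1n\sum_j h_{jj}$ is the mean curvature, and $S=\sum_{i,j}h_{ij}^2$. The normalized scalar curvature $R$ is the scalar curvature of $M^n$ divided by $n(n-1)$; by the Gauss equation $n(n-1)R=\sum_{i,j}\bar R_{ijji}-n^2H^2+S$, where $\bar R_{ijji}$ is the sectional curvature of $L_1^{n+1}$ on the plane of $e_i,e_j$ ($i\neq j$; zero if $i=j$). For a function $f$ on $M^n$, $f_{ij}$ are the components of its Hessian with respect to the induced metric and $\triangle f=\sum_i f_{ii}$. The quantity $|\phi|\geqslant 0$ is the norm of the traceless tensor $\phi_{ij}=h_{ij}-H\delta_{ij}$. *)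

theory Defs
  imports "HOL-Analysis.Analysis"
begin

section \<open>Smooth functions and smooth manifolds\<close>

definition pd :: "'k::finite \<Rightarrow> (real^'k \<Rightarrow> 'b::real_normed_vector) \<Rightarrow> real^'k \<Rightarrow> 'b" where
  "pd i f y = frechet_derivative f (at y) (axis i 1)"

primrec Ck_on :: "nat \<Rightarrow> (real^'k::finite) set \<Rightarrow> (real^'k \<Rightarrow> 'b::real_normed_vector) \<Rightarrow> bool" where
  "Ck_on 0 V f \<longleftrightarrow> continuous_on V f"
| "Ck_on (Suc r) V f \<longleftrightarrow> (\<forall>y\<in>V. f differentiable (at y)) \<and> (\<forall>i. Ck_on r V (pd i f))"

text \<open>The set \<open>V\<close> is always open below.\<close>
definition smooth_on :: "(real^'k::finite) set \<Rightarrow> (real^'k \<Rightarrow> 'b::real_normed_vector) \<Rightarrow> bool" where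
  "smooth_on V f \<longleftrightarrow> (\<forall>r. Ck_on r V f)"

type_synonym ('p, 'k) chart = "'p set \<times> ('p \<Rightarrow> real^'k)"

definition chart_inv :: "('p, 'k) chart \<Rightarrow> real^'k \<Rightarrow> 'p" where
  "chart_inv c = inv_into (fst c) (snd c)"

definition transition :: "('p, 'k) chart \<Rightarrow> ('p, 'k) chart \<Rightarrow> real^'k \<Rightarrow> real^'k" where
  "transition c d = snd d \<circ> chart_inv c"

text \<open>The dimension is the cardinality of the index type \<open>'k\<close>. The atlas need not be maximal.\<close>
definition smooth_manifold :: "'p topology \<Rightarrow> ('p, 'k::finite) chart set \<Rightarrow> bool" where
  "smooth_manifold T A \<longleftrightarrow>
     Hausdorff_space T \<and> second_countable T \<and> topspace T = \<Union> (fst ` A) \<and>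
     (\<forall>c\<in>A. openin T (fst c) \<and> open (snd c ` fst c) \<and>
        homeomorphic_map (subtopology T (fst c)) (top_of_set (snd c ` fst c)) (snd c)) \<and>
     (\<forall>c\<in>A. \<forall>d\<in>A. smooth_on (snd c ` (fst c \<inter> fst d)) (transition c d))"

section \<open>Scalar products on \<open>\<real>\<^sup>k\<close> given by a Gram matrix\<close>

definition ip :: "real^'k^'k \<Rightarrow> real^'k::finite \<Rightarrow> real^'k \<Rightarrow> real" where
  "ip G u v = u \<bullet> (G *v v)"

definition form_index :: "real^'k^'k::finite \<Rightarrow> nat" where
  "form_index G = Max {dim W | W. subspace W \<and> (\<forall>w\<in>W. w \<noteq> 0 \<longrightarrow> ip G w w < 0)}"

definition spacelike :: "real^'k^'k \<Rightarrow> real^'k::finite \<Rightarrow> bool" where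
  "spacelike G u \<longleftrightarrow> ip G u u > 0"

definition timelike :: "real^'k^'k \<Rightarrow> real^'k::finite \<Rightarrow> bool" where
  "timelike G u \<longleftrightarrow> ip G u u < 0"

definition positive_definite :: "real^'k^'k::finite \<Rightarrow> bool" where
  "positive_definite G \<longleftrightarrow> (\<forall>u. u \<noteq> 0 \<longrightarrow> ip G u u > 0)"

definition plane_disc :: "real^'k^'k \<Rightarrow> real^'k::finite \<Rightarrow> real^'k \<Rightarrow> real" where
  "plane_disc G u v = ip G u u * ip G v v - (ip G u v)\<^sup>2"

text \<open>\<open>plane_disc G u v \<noteq> 0\<close> says that \<open>u\<close>, \<open>v\<close> are linearly independent and span a
  plane on which \<open>G\<close> is nondegenerate.\<close>
definition nondegenerate_plane :: "real^'k^'k \<Rightarrow> real^'k::finite \<Rightarrow> real^'k \<Rightarrow> bool" where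
  "nondegenerate_plane G u v \<longleftrightarrow> plane_disc G u v \<noteq> 0"

definition orthonormal_frame :: "real^'k^'k \<Rightarrow> ('k \<Rightarrow> real^'k::finite) \<Rightarrow> bool" where
  "orthonormal_frame G e \<longleftrightarrow> (\<forall>i j. ip G (e i) (e j) = (if i = j then 1 else 0))"

text \<open>A choice of orthonormal frame for positive definite \<open>G\<close>; the quantities computed
  with it below are the usual invariants, which do not depend on the choice.\<close>
definition on_frame :: "real^'k^'k \<Rightarrow> 'k \<Rightarrow> real^'k::finite" where
  "on_frame G = (SOME e. orthonormal_frame G e)"

section \<open>Semi-Riemannian geometry in local coordinates\<close>

text \<open>Here \<open>G\<close> is a metric \<open>(g\<^sub>i\<^sub>j)\<close> as a function of the coordinates \<open>y\<close>.\<close>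

text \<open>\<open>christoffel G k i j\<close> is \<open>\<Gamma>\<^sup>k\<^sub>i\<^sub>j\<close>.\<close>
definition christoffel :: "(real^'k \<Rightarrow> real^'k^'k) \<Rightarrow> 'k \<Rightarrow> 'k \<Rightarrow> 'k::finite \<Rightarrow> real^'k \<Rightarrow> real" where
  "christoffel G k i j y = (\<Sum>l\<in>UNIV. matrix_inv (G y) $ k $ l *
      (pd i (\<lambda>z. G z $ j $ l) y + pd j (\<lambda>z. G z $ i $ l) y - pd l (\<lambda>z. G z $ i $ j) y)) / 2"

text \<open>\<open>R(\<partial>\<^sub>i, \<partial>\<^sub>j)\<partial>\<^sub>k = \<Sum>\<^sub>l curv G l k i j \<partial>\<^sub>l\<close>, with
  \<open>R(X,Y)Z = \<nabla>\<^sub>X\<nabla>\<^sub>YZ - \<nabla>\<^sub>Y\<nabla>\<^sub>XZ - \<nabla>\<^sub>[\<^sub>X\<^sub>,\<^sub>Y\<^sub>]Z\<close>.\<close>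
definition curv :: "(real^'k \<Rightarrow> real^'k^'k) \<Rightarrow> 'k \<Rightarrow> 'k \<Rightarrow> 'k \<Rightarrow> 'k::finite \<Rightarrow> real^'k \<Rightarrow> real" where
  "curv G l k i j y =
     pd i (christoffel G l j k) y - pd j (christoffel G l i k) y
     + (\<Sum>m\<in>UNIV. christoffel G l i m y * christoffel G m j k y
                - christoffel G l j m y * christoffel G m i k y)"

text \<open>The \<open>\<partial>\<^sub>m\<close>-covariant derivative of the curvature tensor.\<close>
definition nabla_curv ::
  "(real^'k \<Rightarrow> real^'k^'k) \<Rightarrow> 'k \<Rightarrow> 'k \<Rightarrow> 'k \<Rightarrow> 'k \<Rightarrow> 'k::finite \<Rightarrow> real^'k \<Rightarrow> real" where
  "nabla_curv G m l k i j y =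
     pd m (curv G l k i j) y
     + (\<Sum>s\<in>UNIV. christoffel G l m s y * curv G s k i j y
                - christoffel G s m k y * curv G l s i j y
                - christoffel G s m i y * curv G l k s j y
                - christoffel G s m j y * curv G l k i s y)"

definition curv_op ::
  "(real^'k \<Rightarrow> real^'k^'k) \<Rightarrow> real^'k \<Rightarrow> real^'k \<Rightarrow> real^'k \<Rightarrow> real^'k \<Rightarrow> real^'k::finite" where
  "curv_op G y u v w =
     (\<chi> l. \<Sum>i\<in>UNIV. \<Sum>j\<in>UNIV. \<Sum>k\<in>UNIV. curv G l k i j y * u $ i * v $ j * w $ k)"

definition sectional_curvature ::
  "(real^'k \<Rightarrow> real^'k^'k) \<Rightarrow> real^'k \<Rightarrow> real^'k \<Rightarrow> real^'k::finite \<Rightarrow> real" where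
  "sectional_curvature G y u v = ip (G y) (curv_op G y u v v) u / plane_disc (G y) u v"

text \<open>The following are only used for positive definite \<open>G\<close>.\<close>

definition scalar_curvature :: "(real^'k \<Rightarrow> real^'k^'k) \<Rightarrow> real^'k::finite \<Rightarrow> real" where
  "scalar_curvature G y =
     (let e = on_frame (G y) in
      \<Sum>i\<in>UNIV. \<Sum>j\<in>UNIV. ip (G y) (curv_op G y (e i) (e j) (e j)) (e i))"

definition normalized_scalar_curvature :: "(real^'k \<Rightarrow> real^'k^'k) \<Rightarrow> real^'k::finite \<Rightarrow> real" where
  "normalized_scalar_curvature G y =
     scalar_curvature G y / (real CARD('k) * (real CARD('k) - 1))"

definition hessian ::
  "(real^'k \<Rightarrow> real^'k^'k) \<Rightarrow> (real^'k \<Rightarrow> real) \<Rightarrow> real^'k \<Rightarrow> real^'k^'k::finite" where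
  "hessian G f y = (\<chi> i j. pd i (pd j f) y - (\<Sum>k\<in>UNIV. christoffel G k i j y * pd k f y))"

text \<open>Components of a symmetric 2-tensor in the orthonormal frame.\<close>
definition frame_comp :: "real^'k^'k \<Rightarrow> real^'k^'k \<Rightarrow> 'k \<Rightarrow> 'k::finite \<Rightarrow> real" where
  "frame_comp G B i j = ip B (on_frame G i) (on_frame G j)"

definition laplacian ::
  "(real^'k \<Rightarrow> real^'k^'k) \<Rightarrow> (real^'k \<Rightarrow> real) \<Rightarrow> real^'k::finite \<Rightarrow> real" where
  "laplacian G f y = (\<Sum>i\<in>UNIV. frame_comp (G y) (hessian G f y) i i)"

text \<open>Below \<open>h\<close> is the second fundamental form as a function of the coordinates.\<close>

definition mean_curvature ::
  "(real^'k \<Rightarrow> real^'k^'k) \<Rightarrow> (real^'k \<Rightarrow> real^'k^'k) \<Rightarrow> real^'k::finite \<Rightarrow> real" where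
  "mean_curvature G h y = (\<Sum>j\<in>UNIV. frame_comp (G y) (h y) j j) / real CARD('k)"

definition sff_squared_length ::
  "(real^'k \<Rightarrow> real^'k^'k) \<Rightarrow> (real^'k \<Rightarrow> real^'k^'k) \<Rightarrow> real^'k::finite \<Rightarrow> real" where
  "sff_squared_length G h y = (\<Sum>i\<in>UNIV. \<Sum>j\<in>UNIV. (frame_comp (G y) (h y) i j)\<^sup>2)"

definition traceless_norm ::
  "(real^'k \<Rightarrow> real^'k^'k) \<Rightarrow> (real^'k \<Rightarrow> real^'k^'k) \<Rightarrow> real^'k::finite \<Rightarrow> real" where
  "traceless_norm G h y = sqrt (\<Sum>i\<in>UNIV. \<Sum>j\<in>UNIV.
     (frame_comp (G y) (h y) i j - mean_curvature G h y * (if i = j then 1 else 0))\<^sup>2)"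

definition box_op ::
  "(real^'k \<Rightarrow> real^'k^'k) \<Rightarrow> (real^'k \<Rightarrow> real^'k^'k) \<Rightarrow> (real^'k \<Rightarrow> real) \<Rightarrow> real^'k::finite \<Rightarrow> real"
where
  "box_op G h f y = (\<Sum>i\<in>UNIV. \<Sum>j\<in>UNIV.
     (real CARD('k) * mean_curvature G h y * (if i = j then 1 else 0) - frame_comp (G y) (h y) i j)
     * frame_comp (G y) (hessian G f y) i j)"

section \<open>Lorentz spaces\<close>

text \<open>A tensor field is given by its components in each chart \<open>c\<close>, as functions on \<open>fst c\<close>;
  they are smooth in the chart and obey the transformation law on overlaps.\<close>

definition semi_riemannian_metric ::
  "('p, 'k::finite) chart set \<Rightarrow> (('p, 'k) chart \<Rightarrow> 'p \<Rightarrow> real^'k^'k) \<Rightarrow> nat \<Rightarrow> bool" where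
  "semi_riemannian_metric A g \<nu> \<longleftrightarrow>
     (\<forall>c\<in>A. smooth_on (snd c ` fst c) (g c \<circ> chart_inv c)) \<and>
     (\<forall>c\<in>A. \<forall>p\<in>fst c. transpose (g c p) = g c p \<and> invertible (g c p) \<and> form_index (g c p) = \<nu>) \<and>
     (\<forall>c\<in>A. \<forall>d\<in>A. \<forall>p\<in>fst c \<inter> fst d.
        g c p = (let J = jacobian (transition c d) (at (snd c p)) in transpose J ** g d p ** J))"

definition lorentz_space ::
  "'p topology \<Rightarrow> ('p, 'k::finite) chart set \<Rightarrow> (('p, 'k) chart \<Rightarrow> 'p \<Rightarrow> real^'k^'k) \<Rightarrow> bool" where
  "lorentz_space T A g \<longleftrightarrow>
     smooth_manifold T A \<and> connected_space T \<and> semi_riemannian_metric A g 1"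

definition locally_symmetric ::
  "('p, 'k::finite) chart set \<Rightarrow> (('p, 'k) chart \<Rightarrow> 'p \<Rightarrow> real^'k^'k) \<Rightarrow> bool" where
  "locally_symmetric A g \<longleftrightarrow>
     (\<forall>c\<in>A. \<forall>p\<in>fst c. \<forall>m l k i j. nabla_curv (g c \<circ> chart_inv c) m l k i j (snd c p) = 0)"

section \<open>Spacelike hypersurfaces\<close>

text \<open>For \<open>x\<close> a map from a manifold to \<open>L\<close>, and charts \<open>c\<close> of the source and \<open>d\<close> of \<open>L\<close>:
  the coordinate domain \<open>loc_dom\<close> and coordinate expression \<open>loc_map\<close> of \<open>x\<close>.\<close>

definition loc_dom :: "('p \<Rightarrow> 'q) \<Rightarrow> ('p, 'n) chart \<Rightarrow> ('q, 'm) chart \<Rightarrow> (real^'n) set" where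
  "loc_dom x c d = snd c ` {p \<in> fst c. x p \<in> fst d}"

definition loc_map :: "('p \<Rightarrow> 'q) \<Rightarrow> ('p, 'n) chart \<Rightarrow> ('q, 'm) chart \<Rightarrow> real^'n \<Rightarrow> real^'m" where
  "loc_map x c d = snd d \<circ> x \<circ> chart_inv c"

definition induced_metric ::
  "(('q, 'm::finite) chart \<Rightarrow> 'q \<Rightarrow> real^'m^'m) \<Rightarrow> ('p \<Rightarrow> 'q) \<Rightarrow> ('p, 'n::finite) chart \<Rightarrow>
   ('q, 'm) chart \<Rightarrow> real^'n \<Rightarrow> real^'n^'n" where
  "induced_metric g x c d y =
     (\<chi> i j. ip (g d (x (chart_inv c y))) (pd i (loc_map x c d) y) (pd j (loc_map x c d) y))"

text \<open>An immersed hypersurface; embedded ones are included.\<close>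
definition spacelike_hypersurface ::
  "'q topology \<Rightarrow> ('q, 'm::finite) chart set \<Rightarrow> (('q, 'm) chart \<Rightarrow> 'q \<Rightarrow> real^'m^'m) \<Rightarrow>
   'p topology \<Rightarrow> ('p, 'n::finite) chart set \<Rightarrow> ('p \<Rightarrow> 'q) \<Rightarrow> bool" where
  "spacelike_hypersurface TL AL g TM AM x \<longleftrightarrow>
     smooth_manifold TM AM \<and> CARD('m) = CARD('n) + 1 \<and> continuous_map TM TL x \<and>
     (\<forall>c\<in>AM. \<forall>d\<in>AL. smooth_on (loc_dom x c d) (loc_map x c d) \<and>
        (\<forall>y\<in>loc_dom x c d. inj (frechet_derivative (loc_map x c d) (at y)) \<and>
           positive_definite (induced_metric g x c d y)))"

text \<open>\<open>N d p\<close> are the components, in the chart \<open>d\<close> of \<open>L\<close> around \<open>x p\<close>, of a tangent vector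
  of \<open>L\<close> at \<open>x p\<close>. The field is global on \<open>M\<close>, as it has to be for the mean curvature to be a
  function on \<open>M\<close>.\<close>
definition unit_timelike_normal ::
  "('q, 'm::finite) chart set \<Rightarrow> (('q, 'm) chart \<Rightarrow> 'q \<Rightarrow> real^'m^'m) \<Rightarrow>
   ('p, 'n::finite) chart set \<Rightarrow> ('p \<Rightarrow> 'q) \<Rightarrow> (('q, 'm) chart \<Rightarrow> 'p \<Rightarrow> real^'m) \<Rightarrow> bool" where
  "unit_timelike_normal AL g AM x N \<longleftrightarrow>
     (\<forall>c\<in>AM. \<forall>d\<in>AL. smooth_on (loc_dom x c d) (N d \<circ> chart_inv c) \<and>
        (\<forall>p\<in>fst c. x p \<in> fst d \<longrightarrow>
           ip (g d (x p)) (N d p) (N d p) = - 1 \<and>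
           (\<forall>i. ip (g d (x p)) (N d p) (pd i (loc_map x c d) (snd c p)) = 0))) \<and>
     (\<forall>c\<in>AM. \<forall>d\<in>AL. \<forall>d'\<in>AL. \<forall>p\<in>fst c. x p \<in> fst d \<inter> fst d' \<longrightarrow>
        N d' p = jacobian (transition d d') (at (snd d (x p))) *v N d p)"

text \<open>\<open>D\<^sub>\<partial>\<^sub>i \<partial>\<^sub>j x\<close> for the Levi-Civita connection \<open>D\<close> of \<open>L\<close>.\<close>
definition ambient_deriv ::
  "(('q, 'm::finite) chart \<Rightarrow> 'q \<Rightarrow> real^'m^'m) \<Rightarrow> ('p \<Rightarrow> 'q) \<Rightarrow> ('p, 'n::finite) chart \<Rightarrow>
   ('q, 'm) chart \<Rightarrow> 'n \<Rightarrow> 'n \<Rightarrow> real^'n \<Rightarrow> real^'m" where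
  "ambient_deriv g x c d i j y = (let X = loc_map x c d in
     pd i (pd j X) y +
     (\<chi> k. \<Sum>r\<in>UNIV. \<Sum>s\<in>UNIV.
        christoffel (g d \<circ> chart_inv d) k r s (X y) * pd i X y $ r * pd j X y $ s))"

text \<open>The sign is such that the normal part of \<open>D\<^sub>u v\<close> is \<open>h(u,v) N\<close>, recalling
  \<open>\<langle>N,N\<rangle> = -1\<close>.\<close>
definition second_fundamental_form ::
  "(('q, 'm::finite) chart \<Rightarrow> 'q \<Rightarrow> real^'m^'m) \<Rightarrow> ('p \<Rightarrow> 'q) \<Rightarrow> (('q, 'm) chart \<Rightarrow> 'p \<Rightarrow> real^'m) \<Rightarrow>
   ('p, 'n::finite) chart \<Rightarrow> ('q, 'm) chart \<Rightarrow> real^'n \<Rightarrow> real^'n^'n" where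
  "second_fundamental_form g x N c d y = (let p = chart_inv c y in
     (\<chi> i j. - ip (g d (x p)) (ambient_deriv g x c d i j y) (N d p)))"

definition L_poly :: "real \<Rightarrow> real \<Rightarrow> real \<Rightarrow> real \<Rightarrow> real" where
  "L_poly n c H t =
     t\<^sup>2 - n * (n - 2) / sqrt (n * (n - 1)) * H * t + n * c - n * H\<^sup>2"

end

theory Submission
  imports Defs
begin

text \<open>
  The sectional curvature hypothesis on timelike planes is a polynomial identity holding on an open
  set of pairs of vectors, hence everywhere: along \<open>M\<close> the ambient space has constant curvature
  \<open>\<kappa> = - c1 / n\<close>, and \<open>c2 \<le> \<kappa>\<close> gives \<open>c\<^sub>0 \<le> \<kappa>\<close>. Thus the shape operator \<open>A\<close> is a Codazzi tensor and the
  Gauss equation expresses \<open>n (n - 1) R\<close> as a constant minus \<open>(trace A)\<^sup>2 - trace (A\<^sup>2)\<close>. Simons' identity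
  turns the claim into \<open>\<bar>\<nabla>A\<bar>\<^sup>2 \<ge> \<bar>\<nabla> trace A\<bar>\<^sup>2\<close>, which follows by differentiating \<open>P + a H = b\<close>, and
  Okumura's bound for the trace of the cube of the traceless part of \<open>A\<close>.

  All of this is done in one pair of charts. Endomorphism fields are matrix valued functions, on which
  \<open>\<partial>\<^sub>i + [\<Gamma>\<^sub>i, \<cdot>]\<close> is the covariant derivative; as the trace kills commutators, no derivative of the
  metric enters the computation of Laplacians of traces.
\<close>

text \<open>The invariants in the statement are sums over \<open>on_frame\<close>, which is picked
  by choice at each point separately; nothing is known about the smoothness of this choice, so a
  frame cannot be differentiated. All derivatives are therefore taken in coordinates, of traces of
  polynomials in the mixed tensor \<open>A\<close>, and the frame is used at one fixed point only,
  to bring finished tensor identities into orthonormal form.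

  In the difference of box(nH) and -1/2 Laplacian(n(n-1)R) the terms nH tr(\<nabla>_i \<nabla>_i A)
  cancel. What remains is |\<nabla>A|^2 - |\<nabla> tr A|^2 plus the sum of tr(A \<nabla>_i
  \<nabla>_i A) minus the sum of a_ij tr(\<nabla>_i \<nabla>_j A). Simons' identity makes the last
  two sums algebraic in A; in terms of the traceless part \<phi> they equal |\<phi>|^4 - nH
  tr(\<phi>^3) + n \<kappa> |\<phi>|^2 - nH^2 |\<phi>|^2. Okumura's constant (n-2)/sqrt(n(n-1)) is
  the source of the linear term of \<open>L_poly\<close>. Tangent planes of M are spacelike planes
  of curvature \<kappa>, whence c2 \<le> \<kappa>, and c1/n = -\<kappa> turns 2 c2 + c1/n into 2 c2
  - \<kappa>.\<close>

section \<open>Calculus of partial derivatives\<close>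

text \<open>No differentiability is assumed: \<open>frechet_derivative\<close> is a choice among the
  derivatives at the point, and functions that agree near it have the same derivatives.\<close>

lemma pd_cong:
  assumes "open V" "y \<in> V" "\<And>z. z \<in> V \<Longrightarrow> f z = f' z"
  shows "pd i f y = pd i f' y"
proof -
  have "(f has_derivative D) (at y) \<longleftrightarrow> (f' has_derivative D) (at y)" for D
    using has_derivative_transform_within_open[OF _ assms(1,2)] assms(3) by metis
  then show ?thesis by (simp add: pd_def frechet_derivative_def)
qed

lemma pd_has_derivative:
  "(f has_derivative D) (at y) \<Longrightarrow> pd i f y = D (axis i 1)"
  by (simp add: pd_def frechet_derivative_at[symmetric])

lemma frechet_derivative_has_derivative:
  "f differentiable (at y) \<Longrightarrow> (f has_derivative frechet_derivative f (at y)) (at y)"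
  using frechet_derivative_works by blast

lemma pd_bilinear:
  assumes "bounded_bilinear B" "f differentiable (at y)" "f' differentiable (at y)"
  shows "pd i (\<lambda>z. B (f z) (f' z)) y = B (pd i f y) (f' y) + B (f y) (pd i f' y)"
  using pd_has_derivative[OF bounded_bilinear.FDERIV[OF assms(1)
      frechet_derivative_has_derivative[OF assms(2)] frechet_derivative_has_derivative[OF assms(3)]], of i]
  by (simp add: pd_def add.commute)

lemma differentiable_bilinear:
  assumes "bounded_bilinear B" "f differentiable (at y)" "f' differentiable (at y)"
  shows "(\<lambda>z. B (f z) (f' z)) differentiable (at y)"
  using bounded_bilinear.FDERIV[OF assms(1)
      frechet_derivative_has_derivative[OF assms(2)] frechet_derivative_has_derivative[OF assms(3)]]
  by (auto simp: differentiable_def)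

lemma
  assumes "bounded_linear L" "f differentiable (at y)"
  shows pd_linear: "pd i (\<lambda>z. L (f z)) y = L (pd i f y)"
    and differentiable_linear: "(\<lambda>z. L (f z)) differentiable (at y)"
proof -
  note * = bounded_linear.has_derivative[OF assms(1) frechet_derivative_has_derivative[OF assms(2)]]
  show "pd i (\<lambda>z. L (f z)) y = L (pd i f y)"
    using pd_has_derivative[OF *, of i] by (simp add: pd_def)
  show "(\<lambda>z. L (f z)) differentiable (at y)" using * by (auto simp: differentiable_def)
qed

lemma pd_add:
  assumes "f differentiable (at y)" "f' differentiable (at y)"
  shows "pd i (\<lambda>z. f z + f' z) y = pd i f y + pd i f' y"
  using pd_has_derivative[OF has_derivative_add[OF frechet_derivative_has_derivative[OF assms(1)]
      frechet_derivative_has_derivative[OF assms(2)]], of i] by (simp add: pd_def)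

lemma pd_diff:
  assumes "f differentiable (at y)" "f' differentiable (at y)"
  shows "pd i (\<lambda>z. f z - f' z) y = pd i f y - pd i f' y"
  using pd_has_derivative[OF has_derivative_diff[OF frechet_derivative_has_derivative[OF assms(1)]
      frechet_derivative_has_derivative[OF assms(2)]], of i] by (simp add: pd_def)

lemma pd_sum:
  assumes "\<And>s. s \<in> I \<Longrightarrow> f s differentiable (at y)"
  shows "pd i (\<lambda>z. \<Sum>s\<in>I. f s z) y = (\<Sum>s\<in>I. pd i (f s) y)"
proof -
  have "((\<lambda>z. \<Sum>s\<in>I. f s z) has_derivative (\<lambda>h. \<Sum>s\<in>I. frechet_derivative (f s) (at y) h)) (at y)"
    by (intro has_derivative_sum frechet_derivative_has_derivative assms)
  from pd_has_derivative[OF this, of i] show ?thesis by (simp add: pd_def)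
qed

lemma pd_const [simp]: "pd i (\<lambda>z. c) = (\<lambda>y. 0)"
  by (simp add: pd_def fun_eq_iff)

lemma pd_compose:
  fixes X :: "real^'k::finite \<Rightarrow> real^'l::finite"
  assumes "f differentiable (at (X y))" "X differentiable (at y)"
  shows "pd i (\<lambda>z. f (X z)) y = (\<Sum>a\<in>UNIV. (pd i X y $ a) *\<^sub>R pd a f (X y))"
proof -
  let ?Df = "frechet_derivative f (at (X y))" and ?DX = "frechet_derivative X (at y)"
  have lin: "linear ?Df" by (rule linear_frechet_derivative[OF assms(1)])
  have "((f \<circ> X) has_derivative (?Df \<circ> ?DX)) (at y)"
    by (rule diff_chain_at; rule frechet_derivative_has_derivative) (use assms in auto)
  then have "pd i (\<lambda>z. f (X z)) y = ?Df (pd i X y)"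
    using pd_has_derivative[of "f \<circ> X" _ y i] by (simp add: pd_def o_def)
  also have "pd i X y = (\<Sum>a\<in>UNIV. (pd i X y $ a) *\<^sub>R axis a 1)"
    by (simp add: vec_eq_iff axis_def if_distrib cong: if_cong)
  also have "?Df \<dots> = (\<Sum>a\<in>UNIV. (pd i X y $ a) *\<^sub>R pd a f (X y))"
    by (simp only: linear_sum[OF lin] linear_cmul[OF lin] pd_def)
  finally show ?thesis .
qed

section \<open>Closure properties of finite differentiability\<close>

lemma Ck_on_cong:
  assumes "open V" "\<And>z. z \<in> V \<Longrightarrow> f z = f' z" "Ck_on r V f"
  shows "Ck_on r V f'"
  using assms(2,3)
proof (induction r arbitrary: f f')
  case 0
  then show ?case using continuous_on_cong[of V V f f'] by simp
next
  case (Suc r)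
  have "f' differentiable (at y)" if "y \<in> V" for y
  proof -
    from Suc.prems(2) that have "(f has_derivative frechet_derivative f (at y)) (at y)"
      by (simp add: frechet_derivative_has_derivative)
    from has_derivative_transform_within_open[OF this assms(1) that Suc.prems(1)]
    show ?thesis by (auto simp: differentiable_def)
  qed
  moreover have "Ck_on r V (pd i f')" for i
  proof (rule Suc.IH[of "pd i f"])
    show "pd i f z = pd i f' z" if "z \<in> V" for z
      by (rule pd_cong[OF assms(1) that Suc.prems(1)])
  qed (use Suc.prems in simp)
  ultimately show ?case by simp
qed

lemma Ck_on_continuous: "Ck_on r V f \<Longrightarrow> continuous_on V f"
proof (cases r)
  case (Suc r')
  assume "Ck_on r V f"
  then have "\<forall>y\<in>V. f differentiable (at y)" using Suc by simp
  then show ?thesis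
    by (auto intro: continuous_at_imp_continuous_on differentiable_imp_continuous_within)
qed simp

text \<open>Leibniz and chain rules put an undifferentiated factor beside a differentiated one, so
  their inductions have to lower the order of the former. The base case is that differentiability
  implies continuity.\<close>

lemma Ck_on_SucD: "Ck_on (Suc r) V f \<Longrightarrow> Ck_on r V f"
proof (induction r arbitrary: f)
  case 0
  then show ?case using Ck_on_continuous by fastforce
next
  case (Suc r)
  have "\<forall>y\<in>V. f differentiable (at y)" and *: "\<And>i. Ck_on (Suc r) V (pd i f)"
    using Suc.prems by simp_all
  with Suc.IH[OF *] show ?case by simp
qed

lemma Ck_on_const: "Ck_on r V (\<lambda>z. c)"
  by (induction r arbitrary: c) simp_all

lemma Ck_on_add:
  assumes "open V"
  shows "Ck_on r V f \<Longrightarrow> Ck_on r V f' \<Longrightarrow> Ck_on r V (\<lambda>z. f z + f' z)"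
proof (induction r arbitrary: f f')
  case (Suc r)
  have "Ck_on r V (pd i (\<lambda>z. f z + f' z))" for i
    by (rule Ck_on_cong[OF assms, of "\<lambda>z. pd i f z + pd i f' z"])
      (use Suc in \<open>auto simp: pd_add\<close>)
  with Suc.prems show ?case by (auto intro: differentiable_add)
qed (auto intro: continuous_on_add)

text \<open>One Leibniz rule serves all products below: real, scalar, inner, matrix-matrix and
  matrix-vector.\<close>

lemma Ck_on_bilinear:
  assumes "open V" "bounded_bilinear B"
  shows "Ck_on r V f \<Longrightarrow> Ck_on r V f' \<Longrightarrow> Ck_on r V (\<lambda>z. B (f z) (f' z))"
proof (induction r arbitrary: f f')
  case 0
  then show ?case using bounded_bilinear.continuous_on[OF assms(2)] by auto
next
  case (Suc r)
  have "Ck_on r V (pd i (\<lambda>z. B (f z) (f' z)))" for i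
  proof (rule Ck_on_cong[OF assms(1)])
    show "Ck_on r V (\<lambda>z. B (pd i f z) (f' z) + B (f z) (pd i f' z))"
      using Suc.prems
      by (intro Ck_on_add[OF assms(1)] Suc.IH Ck_on_SucD[of r V f'] Ck_on_SucD[of r V f]) auto
  qed (use Suc.prems in \<open>simp add: pd_bilinear[OF assms(2)]\<close>)
  with Suc.prems show ?case by (auto intro: differentiable_bilinear[OF assms(2)])
qed

lemma Ck_on_linear:
  assumes "open V" "bounded_linear L"
  shows "Ck_on r V f \<Longrightarrow> Ck_on r V (\<lambda>z. L (f z))"
proof (induction r arbitrary: f)
  case 0
  then show ?case using bounded_linear.continuous_on[OF assms(2)] by auto
next
  case (Suc r)
  have "Ck_on r V (pd i (\<lambda>z. L (f z)))" for i
    by (rule Ck_on_cong[OF assms(1), of "\<lambda>z. L (pd i f z)"])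
      (use Suc in \<open>auto simp: pd_linear[OF assms(2)]\<close>)
  with Suc.prems show ?case by (auto intro: differentiable_linear[OF assms(2)])
qed

lemma Ck_on_sum:
  assumes "open V" "\<And>s. s \<in> I \<Longrightarrow> Ck_on r V (f s)"
  shows "Ck_on r V (\<lambda>z. \<Sum>s\<in>I. f s z)"
  using assms(2)
proof (induction I rule: infinite_finite_induct)
  case (insert s I)
  then have "Ck_on r V (\<lambda>z. f s z + (\<Sum>s\<in>I. f s z))"
    by (intro Ck_on_add[OF assms(1)]) auto
  with insert.hyps show ?case by simp
qed (auto simp: Ck_on_const)

lemma Ck_on_compose:
  fixes X :: "real^'k::finite \<Rightarrow> real^'l::finite"
  assumes "open V" "X ` V \<subseteq> W"
  shows "Ck_on r W f \<Longrightarrow> Ck_on r V X \<Longrightarrow> Ck_on r V (\<lambda>z. f (X z))"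
proof (induction r arbitrary: f)
  case 0
  then show ?case using assms(2) by (auto intro: continuous_on_compose2)
next
  case (Suc r)
  have d: "f differentiable (at (X y))" "X differentiable (at y)" if "y \<in> V" for y
    using Suc.prems that assms(2) by auto
  have "Ck_on r V (pd i (\<lambda>z. f (X z)))" for i
  proof (rule Ck_on_cong[OF assms(1)])
    show "Ck_on r V (\<lambda>z. \<Sum>a\<in>UNIV. (pd i X z $ a) *\<^sub>R pd a f (X z))"
      using Suc.prems Ck_on_SucD[OF Suc.prems(2)]
      by (intro Ck_on_sum[OF assms(1)] Ck_on_bilinear[OF assms(1) bounded_bilinear_scaleR]
          Ck_on_linear[OF assms(1) bounded_linear_vec_nth] Suc.IH) auto
  qed (use d in \<open>simp add: pd_compose\<close>)
  moreover have "(\<lambda>z. f (X z)) differentiable (at y)" if "y \<in> V" for y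
    using differentiable_chain_at[OF d(2,1)] that by (simp add: o_def)
  ultimately show ?case by simp
qed

text \<open>The derivative of 1/f is a product of copies of 1/f and a partial derivative of f, so
  the induction closes under products.\<close>

lemma Ck_on_inverse:
  fixes f :: "real^'k::finite \<Rightarrow> real"
  assumes "open V" "\<And>z. z \<in> V \<Longrightarrow> f z \<noteq> 0"
  shows "Ck_on r V f \<Longrightarrow> Ck_on r V (\<lambda>z. inverse (f z))"
proof (induction r)
  case 0
  then show ?case using assms(2) by (auto intro: continuous_on_inverse)
next
  case (Suc r)
  have der: "((\<lambda>z. inverse (f z)) has_derivative
      (\<lambda>h. - (inverse (f y) * frechet_derivative f (at y) h * inverse (f y)))) (at y)"
    if "y \<in> V" for y
    using Suc.prems that assms(2)
    by (intro Deriv.has_derivative_inverse frechet_derivative_has_derivative) auto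
  have "Ck_on r V (pd i (\<lambda>z. inverse (f z)))" for i
  proof (rule Ck_on_cong[OF assms(1)])
    show "Ck_on r V (\<lambda>z. (inverse (f z) * pd i f z) * (- 1 * inverse (f z)))"
      using Suc.prems Suc.IH Ck_on_SucD[OF Suc.prems]
      by (intro Ck_on_bilinear[OF assms(1) bounded_bilinear_mult] Ck_on_const) auto
  next
    fix z assume "z \<in> V"
    show "(inverse (f z) * pd i f z) * (- 1 * inverse (f z)) = pd i (\<lambda>z. inverse (f z)) z"
      using pd_has_derivative[OF der[OF \<open>z \<in> V\<close>], of i] by (simp add: pd_def)
  qed
  with der show ?case by (auto simp: differentiable_def)
qed

section \<open>Closure properties of smoothness\<close>

lemma smooth_on_cong:
  assumes "open V" "\<And>z. z \<in> V \<Longrightarrow> f z = f' z" "smooth_on V f"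
  shows "smooth_on V f'"
  unfolding smooth_on_def
proof
  fix r
  have "Ck_on r V f" using assms(3) by (simp add: smooth_on_def)
  with assms(2) show "Ck_on r V f'" by (rule Ck_on_cong[OF assms(1)])
qed

lemma smooth_on_pd: "smooth_on V f \<Longrightarrow> smooth_on V (pd i f)"
  unfolding smooth_on_def by (metis Ck_on.simps(2))

lemma smooth_on_differentiable: "smooth_on V f \<Longrightarrow> y \<in> V \<Longrightarrow> f differentiable (at y)"
  unfolding smooth_on_def by (metis Ck_on.simps(2))

lemma smooth_on_continuous: "smooth_on V f \<Longrightarrow> continuous_on V f"
  unfolding smooth_on_def by (metis Ck_on.simps(1))

lemma smooth_on_const: "smooth_on V (\<lambda>z. c)"
  by (simp add: smooth_on_def Ck_on_const)

context
  fixes V :: "(real^'k::finite) set"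
  assumes V: "open V"
begin

lemma smooth_on_add: "smooth_on V f \<Longrightarrow> smooth_on V f' \<Longrightarrow> smooth_on V (\<lambda>z. f z + f' z)"
  by (simp add: smooth_on_def Ck_on_add[OF V])

lemma smooth_on_bilinear:
  "bounded_bilinear B \<Longrightarrow> smooth_on V f \<Longrightarrow> smooth_on V f' \<Longrightarrow> smooth_on V (\<lambda>z. B (f z) (f' z))"
  by (simp add: smooth_on_def Ck_on_bilinear[OF V])

lemma smooth_on_linear:
  "bounded_linear L \<Longrightarrow> smooth_on V f \<Longrightarrow> smooth_on V (\<lambda>z. L (f z))"
  by (simp add: smooth_on_def Ck_on_linear[OF V])

lemma smooth_on_diff: "smooth_on V f \<Longrightarrow> smooth_on V f' \<Longrightarrow> smooth_on V (\<lambda>z. f z - f' z)"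
  using smooth_on_add[OF _ smooth_on_linear[OF bounded_linear_minus[OF bounded_linear_ident]], of f f']
  by simp

lemma smooth_on_sum:
  "(\<And>s. s \<in> I \<Longrightarrow> smooth_on V (f s)) \<Longrightarrow> smooth_on V (\<lambda>z. \<Sum>s\<in>I. f s z)"
  by (simp add: smooth_on_def Ck_on_sum[OF V])

lemma smooth_on_mult:
  fixes f f' :: "real^'k \<Rightarrow> real"
  shows "smooth_on V f \<Longrightarrow> smooth_on V f' \<Longrightarrow> smooth_on V (\<lambda>z. f z * f' z)"
  by (rule smooth_on_bilinear[OF bounded_bilinear_mult])

lemma smooth_on_prod:
  fixes f :: "'s \<Rightarrow> real^'k \<Rightarrow> real"
  shows "(\<And>s. s \<in> I \<Longrightarrow> smooth_on V (f s)) \<Longrightarrow> smooth_on V (\<lambda>z. \<Prod>s\<in>I. f s z)"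
  by (induction I rule: infinite_finite_induct) (simp_all add: smooth_on_const smooth_on_mult)

lemma smooth_on_inverse:
  fixes f :: "real^'k \<Rightarrow> real"
  shows "smooth_on V f \<Longrightarrow> (\<And>z. z \<in> V \<Longrightarrow> f z \<noteq> 0) \<Longrightarrow> smooth_on V (\<lambda>z. inverse (f z))"
  by (simp add: smooth_on_def Ck_on_inverse[OF V])

lemma smooth_on_compose:
  fixes X :: "real^'k \<Rightarrow> real^'l::finite"
  shows "smooth_on W f \<Longrightarrow> smooth_on V X \<Longrightarrow> X ` V \<subseteq> W \<Longrightarrow> smooth_on V (\<lambda>z. f (X z))"
  by (simp add: smooth_on_def Ck_on_compose[OF V])

lemma smooth_on_nth: "smooth_on V f \<Longrightarrow> smooth_on V (\<lambda>z. f z $ a)"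
  by (rule smooth_on_linear[OF bounded_linear_vec_nth])

lemma smooth_on_vec:
  fixes f :: "'a::finite \<Rightarrow> real^'k \<Rightarrow> 'b::euclidean_space"
  assumes "\<And>a. smooth_on V (f a)"
  shows "smooth_on V (\<lambda>z. \<chi> a. f a z)"
proof -
  have "bounded_linear (axis a :: 'b \<Rightarrow> 'b^'a)" for a
    by (intro linear_conv_bounded_linear[THEN iffD1] linearI) (auto simp: vec_eq_iff axis_def)
  then have "smooth_on V (\<lambda>z. \<Sum>a\<in>UNIV. axis a (f a z))"
    by (intro smooth_on_sum smooth_on_linear[of "axis _"]) (use assms in auto)
  moreover have "(\<chi> a. f a z) = (\<Sum>a\<in>UNIV. axis a (f a z))" for z
    by (simp add: vec_eq_iff axis_def if_distrib cong: if_cong)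
  ultimately show ?thesis by simp
qed

lemma smooth_on_det:
  fixes M :: "real^'k \<Rightarrow> real^'a^'a::finite"
  assumes "\<And>a b. smooth_on V (\<lambda>z. M z $ a $ b)"
  shows "smooth_on V (\<lambda>z. det (M z))"
  unfolding det_def by (intro smooth_on_sum smooth_on_mult smooth_on_const smooth_on_prod assms)

end

section \<open>Smoothness of the inverse of a matrix field\<close>

lemma matrix_inv_right:
  assumes "invertible M"
  shows "M ** matrix_inv M = mat 1"
  using someI_ex[of "\<lambda>A'. M ** A' = mat 1 \<and> A' ** M = mat 1"] assms
  by (auto simp: invertible_def matrix_inv_def)

text \<open>Cramer's rule makes each entry of the inverse a polynomial in the entries times the
  inverse of a determinant, which is visibly smooth. The Christoffel symbols need this for the
  inverse metric.\<close>

lemma matrix_inv_cramer: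
  fixes M :: "real^'a^'a::finite"
  assumes "invertible M"
  shows "matrix_inv M $ k $ l =
    det (\<chi> i j. if j = k then axis l 1 $ i else M $ i $ j) * inverse (det M)"
proof -
  have d: "det M \<noteq> 0" using assms invertible_det_nz by blast
  have "M *v (matrix_inv M *v axis l 1) = axis l 1"
    using assms by (simp add: matrix_vector_mul_assoc matrix_inv_right)
  then have "matrix_inv M *v axis l 1 =
      (\<chi> k. det (\<chi> i j. if j = k then axis l 1 $ i else M $ i $ j) / det M)"
    using cramer[OF d] by blast
  then show ?thesis
    by (simp add: vec_eq_iff matrix_vector_mult_basis column_def divide_inverse)
qed

lemma smooth_on_matrix_inv:
  fixes M :: "real^'k::finite \<Rightarrow> real^'a^'a::finite"
  assumes V: "open V" and "smooth_on V M" "\<And>z. z \<in> V \<Longrightarrow> invertible (M z)"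
  shows "smooth_on V (\<lambda>z. matrix_inv (M z))"
proof -
  note e = smooth_on_nth[OF V smooth_on_nth[OF V assms(2)]]
  have "smooth_on V (\<lambda>z. \<chi> k l. det (\<chi> i j. if j = k then axis l 1 $ i else M z $ i $ j) * inverse (det (M z)))"
  proof (intro smooth_on_vec[OF V] smooth_on_mult[OF V] smooth_on_inverse[OF V] smooth_on_det[OF V])
    fix k l a b
    show "smooth_on V (\<lambda>z. (\<chi> i j. if j = k then axis l 1 $ i else M z $ i $ j) $ a $ b)"
      by (cases "b = k") (simp_all add: smooth_on_const e)
  qed (use e assms invertible_det_nz in auto)
  then show ?thesis
    by (rule smooth_on_cong[OF V, rotated]) (simp add: vec_eq_iff matrix_inv_cramer assms(3))
qed

section \<open>Symmetry of second partial derivatives\<close>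

lemma second_difference_mean_value:
  fixes f :: "real^'k::finite \<Rightarrow> real"
  assumes f: "smooth_on V f" and ball: "ball y \<epsilon> \<subseteq> V" and t: "0 < t" "2 * t < \<epsilon>"
  shows "\<exists>p. dist p y \<le> 2 * t \<and> f (y + t *\<^sub>R axis i 1 + t *\<^sub>R axis j 1) - f (y + t *\<^sub>R axis i 1)
      - f (y + t *\<^sub>R axis j 1) + f y = t * t * pd j (pd i f) p"
proof -
  let ?P = "\<lambda>s r. y + s *\<^sub>R axis i 1 + r *\<^sub>R axis j 1 :: real^'k"
  have near: "dist (?P s r) y \<le> 2 * t" if "0 \<le> s" "s \<le> t" "0 \<le> r" "r \<le> t" for s r
  proof -
    have "dist (?P s r) y = norm (s *\<^sub>R axis i 1 + r *\<^sub>R axis j (1::real))"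
      by (simp add: dist_norm algebra_simps)
    also have "\<dots> \<le> \<bar>s\<bar> + \<bar>r\<bar>"
      using norm_triangle_ineq[of "s *\<^sub>R axis i (1::real)" "r *\<^sub>R axis j 1"] by simp
    finally show ?thesis using that by simp
  qed
  have inV: "?P s r \<in> V" if "0 \<le> s" "s \<le> t" "0 \<le> r" "r \<le> t" for s r
    using near[OF that] t ball by (auto simp: subset_iff dist_commute)
  have line: "((\<lambda>s. F (q + s *\<^sub>R axis k 1)) has_field_derivative pd k F (q + s *\<^sub>R axis k 1)) (at s)"
    if "smooth_on V F" "q + s *\<^sub>R axis k 1 \<in> V" for F :: "real^'k \<Rightarrow> real" and q k s
  proof -
    let ?p = "q + s *\<^sub>R axis k 1"
    have F: "(F has_derivative frechet_derivative F (at ?p)) (at ?p)"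
      using smooth_on_differentiable[OF that] by (rule frechet_derivative_has_derivative)
    have "((\<lambda>s. q + s *\<^sub>R axis k 1) has_derivative (\<lambda>h. h *\<^sub>R axis k 1)) (at s)"
      by (auto intro!: derivative_eq_intros)
    from diff_chain_at[OF this F]
    have "((\<lambda>s. F (q + s *\<^sub>R axis k 1)) has_derivative
        (\<lambda>h. frechet_derivative F (at ?p) (h *\<^sub>R axis k 1))) (at s)" by (simp add: o_def)
    moreover have "frechet_derivative F (at ?p) (h *\<^sub>R axis k 1) = pd k F ?p * h" for h
      using linear_cmul[OF linear_frechet_derivative[OF smooth_on_differentiable[OF that]]]
      by (simp add: pd_def)
    ultimately show ?thesis by (simp add: has_field_derivative_def)
  qed
  \<comment> \<open>The mean value theorem is applied to the difference of \<open>f\<close> along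
    two parallel segments in direction \<open>i\<close>; a second application, in direction
    \<open>j\<close>, treats the resulting difference of \<open>pd i f\<close>.\<close>
  have d1: "((\<lambda>s. f (?P s t) - f (?P s 0)) has_field_derivative
      pd i f (?P s t) - pd i f (?P s 0)) (at s)" if "0 \<le> s" "s \<le> t" for s
    using line[OF f, of "y + t *\<^sub>R axis j 1" s i] line[OF f, of y s i]
      inV[OF that, of t] inV[OF that, of 0] t
    by (intro DERIV_diff) (auto simp: algebra_simps)
  obtain s where s: "0 < s" "s < t" and es: "(f (?P t t) - f (?P t 0)) - (f (?P 0 t) - f (?P 0 0)) =
      (t - 0) * (pd i f (?P s t) - pd i f (?P s 0))"
    using MVT2[OF t(1) d1] by blast
  have d2: "((\<lambda>r. pd i f (?P s r)) has_field_derivative pd j (pd i f) (?P s r)) (at r)"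
    if "0 \<le> r" "r \<le> t" for r
    using line[OF smooth_on_pd[OF f]] inV[of s r] s that by simp
  obtain r where r: "0 < r" "r < t"
    and er: "pd i f (?P s t) - pd i f (?P s 0) = (t - 0) * pd j (pd i f) (?P s r)"
    using MVT2[OF t(1) d2] by blast
  show ?thesis
    using near[of s r] s r es er by (intro exI[of _ "?P s r"]) (simp add: algebra_simps)
qed

text \<open>The second difference of \<open>f\<close> over a small square is symmetric in
  \<open>i\<close> and \<open>j\<close>. So some value of \<open>pd j (pd i f)\<close> near
  \<open>y\<close> equals some value of \<open>pd i (pd j f)\<close> near \<open>y\<close>, and
  continuity of both forces equality at \<open>y\<close>.\<close>

lemma pd_commute_real:
  fixes f :: "real^'k::finite \<Rightarrow> real"
  assumes V: "open V" and f: "smooth_on V f" and y: "y \<in> V"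
  shows "pd i (pd j f) y = pd j (pd i f) y"
proof (rule ccontr)
  assume neq: "pd i (pd j f) y \<noteq> pd j (pd i f) y"
  define \<eta> where "\<eta> = dist (pd i (pd j f) y) (pd j (pd i f) y) / 2"
  have \<eta>: "\<eta> > 0" using neq by (simp add: \<eta>_def)
  have c: "isCont (pd k (pd l f)) y" for k l
    using smooth_on_continuous[OF smooth_on_pd[OF smooth_on_pd[OF f]]] V y
    by (simp add: continuous_on_eq_continuous_at)
  obtain e1 where e1: "e1 > 0" "\<And>p. dist p y < e1 \<Longrightarrow> dist (pd i (pd j f) p) (pd i (pd j f) y) < \<eta>"
    using c[of i j] \<eta> unfolding continuous_at_eps_delta by metis
  obtain e2 where e2: "e2 > 0" "\<And>p. dist p y < e2 \<Longrightarrow> dist (pd j (pd i f) p) (pd j (pd i f) y) < \<eta>"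
    using c[of j i] \<eta> unfolding continuous_at_eps_delta by metis
  obtain e3 where e3: "e3 > 0" "ball y e3 \<subseteq> V" using V y open_contains_ball by blast
  \<comment> \<open>The intermediate points lie within 2 t of \<open>y\<close>, so a third of the
    smallest radius is small enough.\<close>
  define t where "t = min e1 (min e2 e3) / 3"
  have t: "0 < t" "2 * t < e1" "2 * t < e2" "2 * t < e3" using e1 e2 e3 by (auto simp: t_def)
  obtain p where p: "dist p y \<le> 2 * t" and ep: "f (y + t *\<^sub>R axis i 1 + t *\<^sub>R axis j 1)
      - f (y + t *\<^sub>R axis i 1) - f (y + t *\<^sub>R axis j 1) + f y = t * t * pd j (pd i f) p"
    using second_difference_mean_value[OF f e3(2) t(1,4)] by blast
  obtain q where q: "dist q y \<le> 2 * t" and eq: "f (y + t *\<^sub>R axis j 1 + t *\<^sub>R axis i 1)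
      - f (y + t *\<^sub>R axis j 1) - f (y + t *\<^sub>R axis i 1) + f y = t * t * pd i (pd j f) q"
    using second_difference_mean_value[OF f e3(2) t(1,4)] by blast
  have "t * t * pd j (pd i f) p = t * t * pd i (pd j f) q"
    using ep eq by (simp add: algebra_simps)
  then have "pd j (pd i f) p = pd i (pd j f) q" using t(1) by simp
  moreover have "dist (pd j (pd i f) p) (pd j (pd i f) y) < \<eta>" by (rule e2(2)) (use p t in linarith)
  moreover have "dist (pd i (pd j f) q) (pd i (pd j f) y) < \<eta>" by (rule e1(2)) (use q t in linarith)
  ultimately have "dist (pd i (pd j f) y) (pd j (pd i f) y) < \<eta> + \<eta>"
    by (metis dist_commute dist_triangle_less_add)
  then show False by (simp add: \<eta>_def)
qed

lemma pd_commute: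
  fixes f :: "real^'k::finite \<Rightarrow> 'b::euclidean_space"
  assumes V: "open V" and f: "smooth_on V f" and y: "y \<in> V"
  shows "pd i (pd j f) y = pd j (pd i f) y"
proof (rule euclidean_eqI)
  fix b :: 'b
  note L = bounded_linear_inner_left[of b]
  have *: "pd k (pd l (\<lambda>z. f z \<bullet> b)) y = pd k (pd l f) y \<bullet> b" for k l
  proof -
    have "pd k (pd l (\<lambda>z. f z \<bullet> b)) y = pd k (\<lambda>z. pd l f z \<bullet> b) y"
      by (rule pd_cong[OF V y]) (rule pd_linear[OF L smooth_on_differentiable[OF f]])
    also have "\<dots> = pd k (pd l f) y \<bullet> b"
      by (rule pd_linear[OF L smooth_on_differentiable[OF smooth_on_pd[OF f] y]])
    finally show ?thesis .
  qed
  show "pd i (pd j f) y \<bullet> b = pd j (pd i f) y \<bullet> b"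
    using pd_commute_real[OF V smooth_on_linear[OF V L f] y, of i j] by (simp add: *)
qed


section \<open>Algebra of matrix products, traces, transposes and scalar products\<close>

lemma bounded_bilinear_matrix_mult:
  "bounded_bilinear ((**) :: real^'b::finite^'a::finite \<Rightarrow> real^'c::finite^'b \<Rightarrow> real^'c^'a)"
  unfolding bilinear_conv_bounded_bilinear[symmetric] bilinear_def
  by (auto intro!: linearI simp: vec_eq_iff matrix_matrix_mult_def sum.distrib algebra_simps sum_distrib_left)

lemma bounded_bilinear_matrix_vector_mult:
  "bounded_bilinear ((*v) :: real^'b::finite^'a::finite \<Rightarrow> real^'b \<Rightarrow> real^'a)"
  unfolding bilinear_conv_bounded_bilinear[symmetric] bilinear_def
  by (auto intro!: linearI simp: vec_eq_iff matrix_vector_mult_def sum.distrib algebra_simps sum_distrib_left)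

lemma bounded_bilinear_ip: "bounded_bilinear (ip G)"
  unfolding bilinear_conv_bounded_bilinear[symmetric] bilinear_def ip_def
  by (auto intro!: linearI simp: algebra_simps inner_simps)

interpretation mm: bounded_bilinear
  "(**) :: real^'b::finite^'a::finite \<Rightarrow> real^'c::finite^'b \<Rightarrow> real^'c^'a"
  by (rule bounded_bilinear_matrix_mult)

interpretation mv: bounded_bilinear "(*v) :: real^'b::finite^'a::finite \<Rightarrow> real^'b \<Rightarrow> real^'a"
  by (rule bounded_bilinear_matrix_vector_mult)

interpretation ip: bounded_bilinear "ip G" for G :: "real^'a^'a::finite"
  by (rule bounded_bilinear_ip)

lemma bounded_linear_trace: "bounded_linear (trace :: real^'a^'a::finite \<Rightarrow> real)"
  by (intro linear_conv_bounded_linear[THEN iffD1] linearI)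
    (auto simp: trace_def sum.distrib sum_distrib_left)

lemma bounded_linear_transpose:
  "bounded_linear (transpose :: real^'b::finite^'a::finite \<Rightarrow> real^'a^'b)"
  by (intro linear_conv_bounded_linear[THEN iffD1] linearI) (auto simp: transpose_def vec_eq_iff)

lemma transpose_nth: "transpose M $ i $ j = M $ j $ i"
  by (simp add: transpose_def)

lemma transpose_add: "transpose (A + B) = transpose A + transpose (B :: real^'b::finite^'a::finite)"
  and transpose_diff: "transpose (A - B) = transpose A - transpose (B :: real^'b::finite^'a::finite)"
  by (simp_all add: transpose_def vec_eq_iff)

lemma transpose_sum_scaleR:
  "transpose (\<Sum>k\<in>I. c k *\<^sub>R M k) = (\<Sum>k\<in>I. c k *\<^sub>R transpose (M k :: real^'b::finite^'a::finite))"
  by (simp add: vec_eq_iff transpose_def)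

lemma trace_scaleR: "trace (c *\<^sub>R M) = c * trace (M :: real^'a^'a::finite)"
  by (simp add: trace_def sum_distrib_left)

lemma trace_sum_scaleR:
  "trace (\<Sum>k\<in>I. c k *\<^sub>R M k) = (\<Sum>k\<in>I. c k * trace (M k :: real^'a^'a::finite))"
  unfolding trace_def by (simp add: sum_distrib_left) (rule sum.swap)

lemma ip_commute: "transpose G = G \<Longrightarrow> ip G u v = ip G v u"
  unfolding ip_def by (metis dot_lmul_matrix inner_commute transpose_matrix_vector)

lemma ip_matrix_left: "ip G (M *v u) v = ip (transpose M ** G) u v"
  unfolding ip_def
  by (metis dot_lmul_matrix matrix_vector_mul_assoc transpose_matrix_vector transpose_transpose)

lemma ip_matrix_right: "ip G u (M *v v) = ip (G ** M) u v"
  unfolding ip_def by (simp add: matrix_vector_mul_assoc)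

lemma ip_add_form: "ip (G + G') u v = ip G u v + ip G' u v"
  by (simp add: ip_def matrix_vector_mult_add_rdistrib inner_simps)

lemma ip_axis: "ip G (axis i 1) (axis j 1) = G $ i $ j"
  by (simp add: ip_def matrix_vector_mult_basis inner_axis' column_def)

lemma positive_definite_invertible:
  fixes M :: "real^'n^'n::finite"
  assumes "positive_definite M"
  shows "invertible M"
proof -
  have "x = 0" if "M *v x = 0" for x
    using assms that by (auto simp: positive_definite_def ip_def)
  then show ?thesis by (metis invertible_left_inverse matrix_left_invertible_ker)
qed

lemma ip_sum_components: "ip G u v = (\<Sum>i\<in>UNIV. \<Sum>j\<in>UNIV. u $ i * G $ i $ j * v $ j)"
  by (simp add: ip_def inner_vec_def matrix_vector_mult_def sum_distrib_left mult.assoc)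

section \<open>The Levi-Civita connection and curvature as matrices\<close>

text \<open>The upper index is the row, so that \<open>conn G i y *v Q\<close> is the Christoffel
  term of a covariant derivative in direction \<open>i\<close>.\<close>

definition conn :: "(real^'k \<Rightarrow> real^'k^'k) \<Rightarrow> 'k \<Rightarrow> real^'k \<Rightarrow> real^'k^'k::finite" where
  "conn G i y = (\<chi> k j. christoffel G k i j y)"

definition curv_matrix :: "(real^'k \<Rightarrow> real^'k^'k) \<Rightarrow> 'k \<Rightarrow> 'k \<Rightarrow> real^'k \<Rightarrow> real^'k^'k::finite" where
  "curv_matrix G i j y = (\<chi> l k. curv G l k i j y)"

lemma curv_op_matrix:
  "curv_op G y u v w = (\<Sum>i\<in>UNIV. \<Sum>j\<in>UNIV. (u $ i * v $ j) *\<^sub>R (curv_matrix G i j y *v w))"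
  by (simp add: vec_eq_iff curv_op_def curv_matrix_def matrix_vector_mult_def sum_distrib_left
      mult_ac)

text \<open>The signature is left open: the locale serves the Lorentz metric of the ambient space as
  well as the induced Riemannian metric.\<close>

locale metric_field =
  fixes V :: "(real^'k::finite) set" and G :: "real^'k \<Rightarrow> real^'k^'k"
  assumes V: "open V" and smooth_G: "smooth_on V G"
    and G_sym: "y \<in> V \<Longrightarrow> transpose (G y) = G y"
    and G_inv: "y \<in> V \<Longrightarrow> invertible (G y)"
begin

lemma pd_entry:
  fixes M :: "real^'k \<Rightarrow> real^'a::finite^'b::finite"
  assumes "smooth_on V M" "y \<in> V"
  shows "pd i (\<lambda>z. M z $ a $ b) y = pd i M y $ a $ b"
proof -
  have "bounded_linear (\<lambda>Q :: real^'a^'b. Q $ a $ b)"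
    using bounded_linear_compose[of "\<lambda>v. v $ b" "\<lambda>Q :: real^'a^'b. Q $ a"] bounded_linear_vec_nth
    by blast
  from pd_linear[OF this smooth_on_differentiable[OF assms]] show ?thesis .
qed

lemma smooth_entry:
  fixes M :: "real^'k \<Rightarrow> real^'a::finite^'b::finite"
  assumes "smooth_on V M"
  shows "smooth_on V (\<lambda>z. M z $ a $ b)"
  by (rule smooth_on_nth[OF V smooth_on_nth[OF V assms]])

lemma G_entry_sym: "y \<in> V \<Longrightarrow> G y $ i $ j = G y $ j $ i"
  using transpose_nth[of "G y" j i] by (simp add: G_sym)

lemma pd_G_sym:
  assumes "y \<in> V"
  shows "pd l G y $ i $ j = pd l G y $ j $ i"
proof -
  have "pd l (\<lambda>z. G z $ i $ j) y = pd l (\<lambda>z. G z $ j $ i) y"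
    by (rule pd_cong[OF V assms G_entry_sym])
  then show ?thesis by (simp add: pd_entry[OF smooth_G assms])
qed

lemma smooth_conn: "smooth_on V (conn G i)"
proof -
  have "smooth_on V (\<lambda>y. \<chi> k j. (\<Sum>l\<in>UNIV. matrix_inv (G y) $ k $ l *
      (pd i (\<lambda>z. G z $ j $ l) y + pd j (\<lambda>z. G z $ i $ l) y - pd l (\<lambda>z. G z $ i $ j) y)) * (1/2))"
    by (intro smooth_on_vec[OF V] smooth_on_mult[OF V] smooth_on_const smooth_on_sum[OF V]
        smooth_entry smooth_on_matrix_inv[OF V] smooth_on_add[OF V] smooth_on_diff[OF V]
        smooth_on_pd smooth_G G_inv)
  then show ?thesis by (simp add: conn_def[abs_def] christoffel_def)
qed

lemma conn_sym: "y \<in> V \<Longrightarrow> conn G i y $ k $ j = conn G j y $ k $ i"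
  by (simp add: conn_def christoffel_def pd_entry[OF smooth_G] pd_G_sym[of y _ i j] algebra_simps)

text \<open>Lowering the index cancels \<open>matrix_inv\<close> and leaves the Christoffel symbols
  of the first kind.\<close>

lemma conn_lower:
  assumes "y \<in> V"
  shows "(G y ** conn G i y) $ l $ j = (pd i G y $ j $ l + pd j G y $ i $ l - pd l G y $ i $ j) / 2"
proof -
  define w :: "real^'k" where "w = (\<chi> l. pd i G y $ j $ l + pd j G y $ i $ l - pd l G y $ i $ j)"
  have k: "conn G i y $ k $ j = (matrix_inv (G y) *v w) $ k / 2" for k
    by (simp add: conn_def christoffel_def pd_entry[OF smooth_G assms] matrix_vector_mult_def w_def)
  have "(G y ** conn G i y) $ l $ j = (G y *v (matrix_inv (G y) *v w)) $ l / 2"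
    by (simp del: divide_eq_eq_numeral1 eq_divide_eq_numeral1 add: k matrix_matrix_mult_def matrix_vector_mult_def[of "G y"] flip: sum_divide_distrib)
  also have "G y *v (matrix_inv (G y) *v w) = w"
    by (simp add: matrix_vector_mul_assoc matrix_inv_right[OF G_inv[OF assms]])
  finally show ?thesis by (simp add: w_def)
qed

text \<open>This is \<nabla>G = 0. In the sum of a Christoffel symbol of the first kind and its
  transpose, the derivatives in the two directions other than \<open>i\<close> cancel.\<close>

lemma metric_compat:
  assumes y: "y \<in> V"
  shows "pd i G y = transpose (conn G i y) ** G y + G y ** conn G i y"
proof -
  have "transpose (conn G i y) ** G y = transpose (G y ** conn G i y)"
    by (simp add: matrix_transpose_mul G_sym[OF y])
  then have t: "(transpose (conn G i y) ** G y) $ j $ l = (G y ** conn G i y) $ l $ j" for j l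
    by (simp add: transpose_def)
  have "(transpose (conn G i y) ** G y + G y ** conn G i y) $ j $ l = pd i G y $ j $ l" for j l
    using pd_G_sym[OF y, of i j l] pd_G_sym[OF y, of j i l] pd_G_sym[OF y, of l i j]
    by (simp add: t conn_lower[OF y] field_simps del: transpose_matrix_vector)
  then show ?thesis by (simp add: vec_eq_iff)
qed

lemma curv_matrix_eq:
  assumes y: "y \<in> V"
  shows "curv_matrix G i j y = pd i (conn G j) y - pd j (conn G i) y
    + conn G i y ** conn G j y - conn G j y ** conn G i y"
proof -
  have "pd i (christoffel G l j k) y = pd i (conn G j) y $ l $ k" for i j k l
    using pd_entry[OF smooth_conn y, of i j l k] by (simp add: conn_def)
  then show ?thesis
    by (simp add: vec_eq_iff curv_matrix_def curv_def matrix_matrix_mult_def sum_subtractf)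
      (simp add: conn_def)
qed

lemma curv_matrix_antisym: "y \<in> V \<Longrightarrow> curv_matrix G j i y = - curv_matrix G i j y"
  by (simp add: curv_matrix_eq)

lemma conn_sym_pd:
  assumes "y \<in> V"
  shows "pd l (conn G i) y $ k $ j = pd l (conn G j) y $ k $ i"
proof -
  have "pd l (\<lambda>z. conn G i z $ k $ j) y = pd l (\<lambda>z. conn G j z $ k $ i) y"
    by (rule pd_cong[OF V assms conn_sym])
  then show ?thesis by (simp add: pd_entry[OF smooth_conn assms])
qed

text \<open>Torsion-freeness lets the lower indices of \<Gamma> and of its derivatives be exchanged;
  after that the derivative terms and the product terms of the cyclic sum cancel in pairs.\<close>

lemma curv_bianchi:
  assumes y: "y \<in> V"
  shows "curv_matrix G i j y $ l $ k + curv_matrix G j k y $ l $ i + curv_matrix G k i y $ l $ j = 0"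
proof -
  have "(conn G a y ** conn G b y) $ l $ c = (conn G a y ** conn G c y) $ l $ b" for a b c
    using conn_sym[OF y, of b _ c] by (simp add: matrix_matrix_mult_def)
  from this[of i j k] this[of j k i] this[of k i j] show ?thesis
    using conn_sym_pd[OF y, of i j l k] conn_sym_pd[OF y, of j k l i] conn_sym_pd[OF y, of k i l j]
    by (simp add: curv_matrix_eq[OF y])
qed

text \<open>Expanding the second derivatives of \<open>G\<close> twice by
  \<open>metric_compat\<close> and antisymmetrising produces this expression up to sign; it vanishes
  because partial derivatives commute.\<close>

lemma curv_skew:
  assumes y: "y \<in> V"
  shows "transpose (curv_matrix G i j y) ** G y + G y ** curv_matrix G i j y = 0"
proof -
  note dG = smooth_on_differentiable[OF smooth_G y]
    and dC = smooth_on_differentiable[OF smooth_conn y]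
    and mult = bounded_bilinear_matrix_mult
  note dT = differentiable_linear[OF bounded_linear_transpose dC]
  have second: "pd a (pd b G) y =
      transpose (pd a (conn G b) y) ** G y + transpose (conn G b y) ** (transpose (conn G a y) ** G y + G y ** conn G a y)
      + ((transpose (conn G a y) ** G y + G y ** conn G a y) ** conn G b y + G y ** pd a (conn G b) y)"
    for a b
  proof -
    have "pd a (pd b G) y = pd a (\<lambda>z. transpose (conn G b z) ** G z + G z ** conn G b z) y"
      by (rule pd_cong[OF V y metric_compat])
    then show ?thesis
      by (simp add: pd_add differentiable_bilinear[OF mult] pd_bilinear[OF mult] dG dC dT
          pd_linear[OF bounded_linear_transpose dC] metric_compat[OF y])
  qed
  have "pd i (pd j G) y - pd j (pd i G) y = 0"
    using pd_commute[OF V smooth_G y] by simp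
  then show ?thesis
    unfolding second curv_matrix_eq[OF y]
    by (simp add: mm.add_left mm.add_right mm.diff_left mm.diff_right transpose_add transpose_diff
        matrix_transpose_mul matrix_mul_assoc algebra_simps)
qed

end

section \<open>Constant curvature from timelike planes\<close>

text \<open>An algebraic curvature tensor is determined by its sectional curvatures. Polarising
  \<open>zero\<close> makes \<open>T\<close> skew under all transpositions of its arguments, which
  is incompatible with the Bianchi identity unless \<open>T\<close> vanishes.\<close>

lemma curvature_like_eq_0:
  fixes T :: "'a::real_vector \<Rightarrow> 'a \<Rightarrow> 'a \<Rightarrow> 'a \<Rightarrow> real"
  assumes add2: "\<And>u v v' w z. T u (v + v') w z = T u v w z + T u v' w z"
    and add3: "\<And>u v w w' z. T u v (w + w') z = T u v w z + T u v w' z"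
    and skew12: "\<And>u v w z. T v u w z = - T u v w z"
    and skew34: "\<And>u v w z. T u v z w = - T u v w z"
    and bianchi: "\<And>u v w z. T u v w z + T v w u z + T w u v z = 0"
    and zero: "\<And>u v. T u v v u = 0"
  shows "T u v w z = 0"
proof -
  \<comment> \<open>Pair symmetry is a combination of four Bianchi identities (the octahedron
    argument).\<close>
  have pair: "T w z u v = T u v w z" for u v w z
    using bianchi[of u v w z] bianchi[of v w z u] bianchi[of w z u v] bianchi[of z u v w]
      skew34[of v w u z] skew34[of w z u v] skew12[of v z w u] skew12[of u z w v] skew34[of u z v w]
      skew12[of w u z v] skew34[of w u v z] skew12[of u z v w] skew34[of u v w z] skew34[of v z w u]
    by linarith
  have add1: "T (u + u') v w z = T u v w z + T u' v w z" for u u' v w z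
    using add2[of v u u' w z] skew12[of v "u + u'" w z] skew12[of v u w z] skew12[of v u' w z] by linarith
  have add4: "T u v w (z + z') = T u v w z + T u v w z'" for u v w z z'
    using add3[of u v z z' w] skew34[of u v w "z + z'"] skew34[of u v w z] skew34[of u v w z'] by linarith
  have outer: "T u v w u = 0" for u v w
    using zero[of u "v + w"] zero[of u v] zero[of u w] pair[of w u u v] skew12[of w u v u] skew34[of w u u v]
      add2[of u v w "v + w" u] add3[of u v v w u] add3[of u w v w u]
    by linarith
  have skew14: "T z v w u = - T u v w z" for u v w z
    using outer[of "u + z" v w] outer[of u v w] outer[of z v w]
      add1[of u z v w "u + z"] add4[of u v w u z] add4[of z v w u z]
    by linarith
  have skew13: "T w v u z = - T u v w z" for u v w z
    using skew34[of w v u z] skew14[of w v z u] skew34[of u v z w] by linarith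
  have skew23: "T u w v z = - T u v w z" for u v w z
    using skew12[of w u v z] skew13[of w u v z] skew12[of v u w z] by linarith
  \<comment> \<open>Cyclic permutations of the first three slots are even, so they leave
    \<open>T\<close> unchanged and the Bianchi identity reads 3 T = 0.\<close>
  show ?thesis
    using bianchi[of u v w z] skew13[of v w u z] skew23[of u w v z] skew13[of w u v z] skew12[of v u w z]
    by linarith
qed

text \<open>In its uses the small \<open>s\<close> keep a vector inside an open cone where a
  quadratic form is known to vanish, and \<open>c\<close> is the value of that form in an arbitrary
  direction. The samples 0 and \<epsilon>/2, -\<epsilon>/2 isolate \<open>c\<close>.\<close>

lemma quadratic_eq_0:
  fixes a b c \<epsilon> :: real
  assumes "\<epsilon> > 0" "\<And>s. \<bar>s\<bar> < \<epsilon> \<Longrightarrow> a + s * b + s * s * c = 0"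
  shows "c = 0"
proof -
  let ?s = "\<epsilon> / 2"
  have "a = 0" using assms(2)[of 0] assms(1) by simp
  moreover have "a + ?s * b + ?s * ?s * c = 0" by (rule assms(2)) (use assms(1) in simp)
  moreover have "a + (- ?s) * b + (- ?s) * (- ?s) * c = 0" by (rule assms(2)) (use assms(1) in simp)
  ultimately have "?s * ?s * c = 0"
    by (simp only: mult_minus_left mult_minus_right minus_minus)
  then show ?thesis using assms(1) by simp
qed

text \<open>The factor \<sigma> is taken as 1 or -1 below, to cover spacelike and timelike vectors
  at once.\<close>

lemma ip_sign_open:
  assumes "transpose G = G" "\<sigma> * ip G u u > 0"
  obtains \<epsilon> :: real where "\<epsilon> > 0" "\<And>s. \<bar>s\<bar> < \<epsilon> \<Longrightarrow> \<sigma> * ip G (u + s *\<^sub>R w) (u + s *\<^sub>R w) > 0"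
proof -
  define p where "p s = \<sigma> * (ip G u u + 2 * s * ip G u w + s * s * ip G w w)" for s
  have "isCont p 0" unfolding p_def by (intro continuous_intros)
  moreover have "p 0 > 0" using assms by (simp add: p_def)
  ultimately obtain \<epsilon> where \<epsilon>: "\<epsilon> > 0" "\<And>s. dist s 0 < \<epsilon> \<Longrightarrow> dist (p s) (p 0) < p 0"
    unfolding continuous_at_eps_delta by metis
  have "p s > 0" if "\<bar>s\<bar> < \<epsilon>" for s
    using \<epsilon>(2)[of s] that by (simp add: dist_real_def)
  moreover have "p s = \<sigma> * ip G (u + s *\<^sub>R w) (u + s *\<^sub>R w)" for s
    using ip_commute[OF assms(1), of u w]
    by (simp add: p_def ip.add_left ip.add_right ip.scaleR_left ip.scaleR_right algebra_simps)
  ultimately show ?thesis using that \<epsilon>(1) by metis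
qed

context metric_field
begin

text \<open>\<open>T\<close> is the curvature tensor minus the model tensor of constant curvature
  \<kappa>. The hypothesis kills \<open>T u v v u\<close> for spacelike \<open>u\<close> and
  timelike \<open>v\<close>; as this is quadratic in each of \<open>u\<close> and \<open>v\<close>,
  the two causal restrictions can be removed one after the other, and
  \<open>curvature_like_eq_0\<close> applies.\<close>

lemma constant_curvature:
  assumes y: "y \<in> V" and u0: "spacelike (G y) u0" and v0: "timelike (G y) v0"
    and sec: "\<And>u v. spacelike (G y) u \<Longrightarrow> timelike (G y) v \<Longrightarrow> sectional_curvature G y u v = \<kappa>"
  shows "curv_op G y u v w = \<kappa> *\<^sub>R (ip (G y) v w *\<^sub>R u - ip (G y) u w *\<^sub>R v)"
proof -
  let ?g = "ip (G y)"
  define R where "R = curv_op G y"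
  define T where "T u v w z = ?g (R u v w) z - \<kappa> * (?g v w * ?g u z - ?g u w * ?g v z)" for u v w z
  note com = ip_commute[OF G_sym[OF y]]
  have R_add2: "R u (v + v') w = R u v w + R u v' w" for u v v' w
    by (simp add: R_def curv_op_matrix algebra_simps sum.distrib)
  have R_add3: "R u v (w + w') = R u v w + R u v w'" for u v w w'
    by (simp add: R_def curv_op_matrix mv.add_right algebra_simps sum.distrib)
  have R_scale2: "R u (s *\<^sub>R v) w = s *\<^sub>R R u v w" for u v w s
    by (simp add: R_def curv_op_matrix scaleR_sum_right mult_ac)
  have R_scale3: "R u v (s *\<^sub>R w) = s *\<^sub>R R u v w" for u v w s
    by (simp add: R_def curv_op_matrix scaleR_sum_right mv.scaleR_right mult_ac)
  have R_skew: "R v u w = - R u v w" for u v w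
  proof -
    have "R v u w = (\<Sum>j\<in>UNIV. \<Sum>i\<in>UNIV. (v $ i * u $ j) *\<^sub>R (curv_matrix G i j y *v w))"
      unfolding R_def curv_op_matrix by (rule sum.swap)
    also have "\<dots> = (\<Sum>j\<in>UNIV. \<Sum>i\<in>UNIV. - ((u $ j * v $ i) *\<^sub>R (curv_matrix G j i y *v w)))"
      by (intro sum.cong refl, subst curv_matrix_antisym[OF y]) (simp add: mv.minus_left mult.commute)
    finally show ?thesis by (simp add: R_def curv_op_matrix sum_negf)
  qed
  have skew34: "T u v z w = - T u v w z" for u v w z
  proof -
    have "?g (curv_matrix G i j y *v z) w + ?g (curv_matrix G i j y *v w) z = 0" for i j
    proof -
      have "?g (curv_matrix G i j y *v z) w + ?g (curv_matrix G i j y *v w) z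
          = ip (transpose (curv_matrix G i j y) ** G y + G y ** curv_matrix G i j y) z w"
        unfolding ip_add_form com[of "curv_matrix G i j y *v w" z] ip_matrix_right
        by (simp only: ip_matrix_left)
      then show ?thesis by (simp add: curv_skew[OF y] ip_def)
    qed
    then have "?g (curv_matrix G i j y *v z) w = - ?g (curv_matrix G i j y *v w) z" for i j
      by (simp add: add_eq_0_iff)
    then have "?g (R u v z) w = - ?g (R u v w) z"
      by (simp add: R_def curv_op_matrix ip.sum_left ip.scaleR_left sum_negf)
    then show ?thesis by (simp add: T_def algebra_simps)
  qed
  have bianchi: "R u v w + R v w u + R w u v = 0" for u v w
  proof -
    have e: "R u v w $ l = (\<Sum>i\<in>UNIV. \<Sum>j\<in>UNIV. \<Sum>k\<in>UNIV. u $ i * v $ j * w $ k * curv_matrix G i j y $ l $ k)"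
      for u v w l
      by (simp add: R_def curv_op_def curv_matrix_def mult_ac)
    have e1: "R v w u $ l = (\<Sum>i\<in>UNIV. \<Sum>j\<in>UNIV. \<Sum>k\<in>UNIV. u $ i * v $ j * w $ k * curv_matrix G j k y $ l $ i)" for l
    proof -
      have "R v w u $ l = (\<Sum>j\<in>UNIV. \<Sum>k\<in>UNIV. \<Sum>i\<in>UNIV. u $ i * v $ j * w $ k * curv_matrix G j k y $ l $ i)"
        unfolding e by (simp add: mult_ac)
      also have "\<dots> = (\<Sum>j\<in>UNIV. \<Sum>i\<in>UNIV. \<Sum>k\<in>UNIV. u $ i * v $ j * w $ k * curv_matrix G j k y $ l $ i)"
        by (rule sum.cong[OF refl], rule sum.swap)
      also have "\<dots> = (\<Sum>i\<in>UNIV. \<Sum>j\<in>UNIV. \<Sum>k\<in>UNIV. u $ i * v $ j * w $ k * curv_matrix G j k y $ l $ i)"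
        by (rule sum.swap)
      finally show ?thesis .
    qed
    have e2: "R w u v $ l = (\<Sum>i\<in>UNIV. \<Sum>j\<in>UNIV. \<Sum>k\<in>UNIV. u $ i * v $ j * w $ k * curv_matrix G k i y $ l $ j)" for l
    proof -
      have "R w u v $ l = (\<Sum>i\<in>UNIV. \<Sum>k\<in>UNIV. \<Sum>j\<in>UNIV. u $ i * v $ j * w $ k * curv_matrix G k i y $ l $ j)"
        unfolding e by (subst sum.swap) (simp add: mult_ac)
      also have "\<dots> = (\<Sum>i\<in>UNIV. \<Sum>j\<in>UNIV. \<Sum>k\<in>UNIV. u $ i * v $ j * w $ k * curv_matrix G k i y $ l $ j)"
        by (intro sum.cong refl sum.swap)
      finally show ?thesis .
    qed
    have "R u v w $ l + R v w u $ l + R w u v $ l = 0" for l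
      unfolding e[of u v w] e1 e2 sum.distrib[symmetric] distrib_left[symmetric] curv_bianchi[OF y]
      by simp
    then show ?thesis by (simp add: vec_eq_iff)
  qed
  have T_skew: "T v u w z = - T u v w z" for u v w z
    by (simp add: T_def R_skew[of u v] ip.minus_left algebra_simps)
  have T_add2: "T u (v + v') w z = T u v w z + T u v' w z" for u v v' w z
    by (simp add: T_def R_add2 ip.add_left ip.add_right algebra_simps)
  have T_add3: "T u v (w + w') z = T u v w z + T u v w' z" for u v w w' z
    by (simp add: T_def R_add3 ip.add_left ip.add_right algebra_simps)
  have T_scale2: "T u (s *\<^sub>R v) w z = s * T u v w z" for u v w z s
    by (simp add: T_def R_scale2 ip.scaleR_left ip.scaleR_right algebra_simps)
  have T_scale3: "T u v (s *\<^sub>R w) z = s * T u v w z" for u v w z s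
    by (simp add: T_def R_scale3 ip.scaleR_left ip.scaleR_right algebra_simps)
  have T_bianchi: "T u v w z + T v w u z + T w u v z = 0" for u v w z
  proof -
    have "?g (R u v w) z + ?g (R v w u) z + ?g (R w u v) z = ?g (R u v w + R v w u + R w u v) z"
      by (simp add: ip.add_left)
    then have *: "?g (R u v w) z + ?g (R v w u) z + ?g (R w u v) z = 0" by (simp add: bianchi ip.zero_left)
    show ?thesis using * com[of u v] com[of v w] com[of u w] unfolding T_def by (simp add: algebra_simps)
  qed
  have T_expand: "T u (v + s *\<^sub>R w) (v + s *\<^sub>R w) u =
      T u v v u + s * (T u v w u + T u w v u) + s * s * T u w w u" for u v w s
    by (simp add: T_add2 T_add3 T_scale2 T_scale3 algebra_simps)
  have T_swap: "T u v v u = T v u u v" for u v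
    using T_skew[of u v v u] skew34[of v u u v] by simp
  \<comment> \<open>A plane spanned by a spacelike and a timelike vector has negative discriminant,
    so the denominator of the sectional curvature can be cleared.\<close>
  have Z1: "T u v v u = 0" if "spacelike (G y) u" "timelike (G y) v" for u v
  proof -
    have "?g u u > 0" "?g v v < 0" using that by (simp_all add: spacelike_def timelike_def)
    then have "?g u u * ?g v v < 0" by (rule mult_pos_neg)
    moreover have "(?g u v)\<^sup>2 \<ge> 0" by simp
    ultimately have d: "plane_disc (G y) u v \<noteq> 0" unfolding plane_disc_def by linarith
    have "?g (R u v v) u = \<kappa> * plane_disc (G y) u v"
      using sec[OF that] d by (simp add: sectional_curvature_def R_def field_simps)
    then show ?thesis
      using com[of u v] by (simp add: T_def plane_disc_def power2_eq_square algebra_simps)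
  qed
  \<comment> \<open>The line v0 + s w stays timelike for small s, and the coefficient of s^2 along
    it is \<open>T u w w u\<close>.\<close>
  have Z2: "T u w w u = 0" if u: "spacelike (G y) u" for u w
  proof -
    have "(- 1) * ?g v0 v0 > 0" using v0 by (simp add: timelike_def)
    from ip_sign_open[OF G_sym[OF y] this] obtain \<epsilon> :: real where \<epsilon>: "\<epsilon> > 0"
      "\<And>s. \<bar>s\<bar> < \<epsilon> \<Longrightarrow> (- 1) * ip (G y) (v0 + s *\<^sub>R w) (v0 + s *\<^sub>R w) > 0" by blast
    show ?thesis
      by (rule quadratic_eq_0[OF \<epsilon>(1), of "T u v0 v0 u" "T u v0 w u + T u w v0 u"])
        (use Z1[OF u] \<epsilon>(2) in \<open>simp add: T_expand[symmetric] timelike_def\<close>)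
  qed
  \<comment> \<open>The same argument along the spacelike vectors u0 + s u, after exchanging the two
    arguments by \<open>T_swap\<close>.\<close>
  have Z3: "T u v v u = 0" for u v
  proof -
    have "1 * ?g u0 u0 > 0" using u0 by (simp add: spacelike_def)
    from ip_sign_open[OF G_sym[OF y] this] obtain \<epsilon> :: real where \<epsilon>: "\<epsilon> > 0"
      "\<And>s. \<bar>s\<bar> < \<epsilon> \<Longrightarrow> 1 * ip (G y) (u0 + s *\<^sub>R u) (u0 + s *\<^sub>R u) > 0" by blast
    have "T v (u0 + s *\<^sub>R u) (u0 + s *\<^sub>R u) v = 0" if "\<bar>s\<bar> < \<epsilon>" for s
      unfolding T_swap[of v "u0 + s *\<^sub>R u"]
      by (rule Z2) (use \<epsilon>(2)[OF that] in \<open>simp add: spacelike_def\<close>)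
    then have "T v u u v = 0"
      unfolding T_expand by (rule quadratic_eq_0[OF \<epsilon>(1)])
    then show ?thesis unfolding T_swap[of u v] .
  qed
  have "T u v w z = 0" for z
    by (rule curvature_like_eq_0[of T]) (fact T_add2 T_add3 T_skew skew34 T_bianchi Z3)+
  then have z: "?g (R u v w - \<kappa> *\<^sub>R (?g v w *\<^sub>R u - ?g u w *\<^sub>R v)) z = 0" for z
    by (simp add: T_def ip.diff_left ip.scaleR_left)
  \<comment> \<open>The Euclidean square of \<open>?Z\<close> is one of the scalar products just
    shown to vanish; invertibility of \<open>G y\<close> then removes the factor
    \<open>G y\<close>.\<close>
  have "G y *v (R u v w - \<kappa> *\<^sub>R (?g v w *\<^sub>R u - ?g u w *\<^sub>R v)) = 0" (is "?Z = 0")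
  proof -
    have "?Z \<bullet> ?Z = ?g ?Z (R u v w - \<kappa> *\<^sub>R (?g v w *\<^sub>R u - ?g u w *\<^sub>R v))" by (simp only: ip_def)
    also have "\<dots> = 0" unfolding com[of ?Z] by (rule z)
    finally show ?thesis by simp
  qed
  then have "G y *v (R u v w - \<kappa> *\<^sub>R (?g v w *\<^sub>R u - ?g u w *\<^sub>R v)) = G y *v 0"
    by (simp only: mv.zero_right)
  from injD[OF inj_matrix_vector_mult[OF G_inv[OF y]] this]
  show ?thesis by (simp only: R_def eq_iff_diff_eq_0[symmetric])
qed

end


section \<open>Covariant derivatives along a map\<close>

text \<open>The connection matrix of the ambient tangent bundle pulled back along
  \<open>X\<close>.\<close>

definition pull_conn ::
  "(real^'m \<Rightarrow> real^'m^'m) \<Rightarrow> (real^'n::finite \<Rightarrow> real^'m::finite) \<Rightarrow> 'n \<Rightarrow> real^'n \<Rightarrow> real^'m^'m" where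
  "pull_conn g X i y = (\<Sum>r\<in>UNIV. pd i X y $ r *\<^sub>R conn g r (X y))"

text \<open>The Levi-Civita derivative in direction \<open>\<partial>\<^sub>i\<close> of a vector field \<open>Z\<close> along the map \<open>X\<close>.\<close>
definition cov ::
  "(real^'m \<Rightarrow> real^'m^'m) \<Rightarrow> (real^'n::finite \<Rightarrow> real^'m::finite) \<Rightarrow> 'n \<Rightarrow> (real^'n \<Rightarrow> real^'m) \<Rightarrow>
    real^'n \<Rightarrow> real^'m" where
  "cov g X i Z y = pd i Z y + pull_conn g X i y *v Z y"

locale metric_along = ambient: metric_field W g
  for W :: "(real^'m::finite) set" and g :: "real^'m \<Rightarrow> real^'m^'m" +
  fixes V :: "(real^'n::finite) set" and X :: "real^'n \<Rightarrow> real^'m"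
  assumes V: "open V" and smooth_X: "smooth_on V X" and X_in: "y \<in> V \<Longrightarrow> X y \<in> W"
begin

lemma X_image: "X ` V \<subseteq> W"
  using X_in by auto

lemma smooth_pull_conn: "smooth_on V (pull_conn g X i)"
  unfolding pull_conn_def[abs_def]
  by (intro smooth_on_sum[OF V] smooth_on_bilinear[OF V bounded_bilinear_scaleR]
      smooth_on_nth[OF V] smooth_on_pd smooth_X smooth_on_compose[OF V ambient.smooth_conn] X_image)

lemma smooth_cov: "smooth_on V Z \<Longrightarrow> smooth_on V (cov g X i Z)"
  unfolding cov_def[abs_def]
  by (intro smooth_on_add[OF V] smooth_on_bilinear[OF V bounded_bilinear_matrix_vector_mult]
      smooth_on_pd smooth_pull_conn)

lemma smooth_gX: "smooth_on V (\<lambda>y. g (X y))"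
  by (rule smooth_on_compose[OF V ambient.smooth_G smooth_X X_image])

lemma cov_cong: "y \<in> V \<Longrightarrow> (\<And>z. z \<in> V \<Longrightarrow> Z z = Z' z) \<Longrightarrow> cov g X i Z y = cov g X i Z' y"
  unfolding cov_def by (subst pd_cong[OF V]) auto

lemma cov_add:
  "smooth_on V Z \<Longrightarrow> smooth_on V Z' \<Longrightarrow> y \<in> V \<Longrightarrow>
    cov g X i (\<lambda>z. Z z + Z' z) y = cov g X i Z y + cov g X i Z' y"
  by (simp add: cov_def pd_add smooth_on_differentiable mv.add_right)

lemma cov_sum:
  "(\<And>k. k \<in> I \<Longrightarrow> smooth_on V (Z k)) \<Longrightarrow> y \<in> V \<Longrightarrow>
    cov g X i (\<lambda>z. \<Sum>k\<in>I. Z k z) y = (\<Sum>k\<in>I. cov g X i (Z k) y)"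
  using pd_sum[of I Z y i, OF smooth_on_differentiable[of V]]
  by (simp add: cov_def mv.sum_right sum.distrib)

lemma cov_scaleR:
  "smooth_on V f \<Longrightarrow> smooth_on V Z \<Longrightarrow> y \<in> V \<Longrightarrow>
    cov g X i (\<lambda>z. f z *\<^sub>R Z z) y = pd i f y *\<^sub>R Z y + f y *\<^sub>R cov g X i Z y"
  by (simp add: cov_def pd_bilinear[OF bounded_bilinear_scaleR] smooth_on_differentiable
      mv.scaleR_right scaleR_add_right)

lemma pull_metric_compat:
  assumes y: "y \<in> V"
  shows "pd i (\<lambda>z. g (X z)) y =
    transpose (pull_conn g X i y) ** g (X y) + g (X y) ** pull_conn g X i y"
proof -
  have "pd i (\<lambda>z. g (X z)) y = (\<Sum>r\<in>UNIV. (pd i X y $ r) *\<^sub>R pd r g (X y))"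
    using y X_in ambient.smooth_G smooth_X by (intro pd_compose smooth_on_differentiable) auto
  then show ?thesis
    by (simp add: ambient.metric_compat[OF X_in[OF y]] pull_conn_def transpose_sum_scaleR mm.sum_left mm.sum_right
        mm.scaleR_left mm.scaleR_right scaleR_add_right sum.distrib)
qed

lemma pd_ip:
  assumes Z: "smooth_on V Z" and Z': "smooth_on V Z'" and y: "y \<in> V"
  shows "pd i (\<lambda>z. ip (g (X z)) (Z z) (Z' z)) y =
    ip (g (X y)) (cov g X i Z y) (Z' y) + ip (g (X y)) (Z y) (cov g X i Z' y)"
proof -
  note d = smooth_on_differentiable[OF _ y]
  note mv = bounded_bilinear_matrix_vector_mult
  have "pd i (\<lambda>z. ip (g (X z)) (Z z) (Z' z)) y = pd i Z y \<bullet> (g (X y) *v Z' y) +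
      Z y \<bullet> (pd i (\<lambda>z. g (X z)) y *v Z' y + g (X y) *v pd i Z' y)"
    unfolding ip_def
    using d[OF Z] d[OF Z'] d[OF smooth_gX] differentiable_bilinear[OF mv d[OF smooth_gX] d[OF Z']]
    by (simp add: pd_bilinear[OF bounded_bilinear_inner] pd_bilinear[OF mv])
  also have "\<dots> = ip (g (X y)) (pd i Z y) (Z' y) + ip (pd i (\<lambda>z. g (X z)) y) (Z y) (Z' y)
      + ip (g (X y)) (Z y) (pd i Z' y)"
    by (simp add: ip_def inner_add_right)
  finally show ?thesis
    by (simp add: cov_def pull_metric_compat[OF y] ip_add_form ip.add_left ip.add_right
        ip_matrix_left ip_matrix_right)
qed

text \<open>Torsion-freeness along a map: partial derivatives of \<open>X\<close> commute and the
  lower indices of \<Gamma> can be exchanged. The symmetry of the second fundamental form rests on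
  it.\<close>

lemma cov_pd_commute:
  assumes y: "y \<in> V"
  shows "cov g X i (pd j X) y = cov g X j (pd i X) y"
proof -
  have e: "(pull_conn g X i y *v v) $ k =
      (\<Sum>s\<in>UNIV. \<Sum>r\<in>UNIV. conn g r (X y) $ k $ s * pd i X y $ r * v $ s)" for i v k
    by (simp add: pull_conn_def matrix_vector_mult_def sum_distrib_left sum_distrib_right mult_ac)
  have "pull_conn g X i y *v pd j X y = pull_conn g X j y *v pd i X y"
  proof (subst vec_eq_iff, intro allI)
    fix k
    show "(pull_conn g X i y *v pd j X y) $ k = (pull_conn g X j y *v pd i X y) $ k"
      unfolding e
      by (subst sum.swap, intro sum.cong refl,
          subst ambient.conn_sym[OF X_in[OF y]], simp add: mult_ac)
  qed
  then show ?thesis by (simp add: cov_def pd_commute[OF V smooth_X y, of i j])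
qed

text \<open>The curvature of a pulled back connection is the pulled back curvature: the terms
  containing second derivatives of \<open>X\<close> are symmetric in \<open>i\<close> and
  \<open>j\<close> and cancel.\<close>

lemma pull_curvature:
  assumes y: "y \<in> V"
  shows "pd i (pull_conn g X j) y - pd j (pull_conn g X i) y
      + pull_conn g X i y ** pull_conn g X j y - pull_conn g X j y ** pull_conn g X i y
    = (\<Sum>r\<in>UNIV. \<Sum>s\<in>UNIV. (pd i X y $ r * pd j X y $ s) *\<^sub>R curv_matrix g r s (X y))"
proof -
  note d = smooth_on_differentiable[OF _ y]
  let ?c = "\<lambda>r. conn g r (X y)" and ?u = "pd i X y" and ?v = "pd j X y"
  have dc: "(\<lambda>z. conn g r (X z)) differentiable (at y)" for r
    by (rule d[OF smooth_on_compose[OF V ambient.smooth_conn smooth_X X_image]])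
  have dX: "(\<lambda>z. pd j X z $ r) differentiable (at y)" for j r
    by (rule d[OF smooth_on_nth[OF V smooth_on_pd[OF smooth_X]]])
  have D: "pd i (pull_conn g X j) y = (\<Sum>r\<in>UNIV. pd i (pd j X) y $ r *\<^sub>R ?c r) +
      (\<Sum>r\<in>UNIV. \<Sum>s\<in>UNIV. (pd i X y $ r * pd j X y $ s) *\<^sub>R pd r (conn g s) (X y))" for i j
  proof -
    have nth: "pd i (\<lambda>z. pd j X z $ r) y = pd i (pd j X) y $ r" for r
      by (rule pd_linear[OF bounded_linear_vec_nth d[OF smooth_on_pd[OF smooth_X]]])
    have "pd i (pull_conn g X j) y = (\<Sum>s\<in>UNIV. pd i (\<lambda>z. pd j X z $ s *\<^sub>R conn g s (X z)) y)"
      unfolding pull_conn_def[abs_def]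
      by (intro pd_sum differentiable_bilinear[OF bounded_bilinear_scaleR] dX dc)
    also have "\<dots> = (\<Sum>s\<in>UNIV. pd i (pd j X) y $ s *\<^sub>R ?c s +
        (\<Sum>r\<in>UNIV. (pd i X y $ r * pd j X y $ s) *\<^sub>R pd r (conn g s) (X y)))"
    proof (intro sum.cong refl)
      fix s
      have "pd i (\<lambda>z. conn g s (X z)) y = (\<Sum>r\<in>UNIV. pd i X y $ r *\<^sub>R pd r (conn g s) (X y))"
        by (intro pd_compose smooth_on_differentiable[OF ambient.smooth_conn X_in[OF y]] d[OF smooth_X])
      then show "pd i (\<lambda>z. pd j X z $ s *\<^sub>R conn g s (X z)) y = pd i (pd j X) y $ s *\<^sub>R ?c s +
        (\<Sum>r\<in>UNIV. (pd i X y $ r * pd j X y $ s) *\<^sub>R pd r (conn g s) (X y))"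
        by (simp add: pd_bilinear[OF bounded_bilinear_scaleR dX dc] nth scaleR_sum_right mult.commute)
    qed
    also have "\<dots> = (\<Sum>r\<in>UNIV. pd i (pd j X) y $ r *\<^sub>R ?c r) +
      (\<Sum>s\<in>UNIV. \<Sum>r\<in>UNIV. (pd i X y $ r * pd j X y $ s) *\<^sub>R pd r (conn g s) (X y))"
      by (simp add: sum.distrib)
    finally show ?thesis by (subst sum.swap)
  qed
  have D': "pd j (pull_conn g X i) y = (\<Sum>r\<in>UNIV. pd i (pd j X) y $ r *\<^sub>R ?c r) +
      (\<Sum>r\<in>UNIV. \<Sum>s\<in>UNIV. (?u $ r * ?v $ s) *\<^sub>R pd s (conn g r) (X y))"
    unfolding D[of j i] pd_commute[OF V smooth_X y, of j i]
    by (subst sum.swap) (simp add: mult.commute)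
  have M: "pull_conn g X i y ** pull_conn g X j y =
      (\<Sum>r\<in>UNIV. \<Sum>s\<in>UNIV. (pd i X y $ r * pd j X y $ s) *\<^sub>R (?c r ** ?c s))" for i j
    by (simp add: pull_conn_def mm.sum_left mm.sum_right mm.scaleR_left mm.scaleR_right
        scaleR_sum_right mult.commute) (rule sum.swap)
  have M': "pull_conn g X j y ** pull_conn g X i y =
      (\<Sum>r\<in>UNIV. \<Sum>s\<in>UNIV. (?u $ r * ?v $ s) *\<^sub>R (?c s ** ?c r))"
    unfolding M[of j i] by (subst sum.swap) (simp add: mult.commute)
  show ?thesis
    unfolding D[of i j] D' M[of i j] M'
    by (simp add: ambient.curv_matrix_eq[OF X_in[OF y]] scaleR_add_right scaleR_diff_right
        sum.distrib sum_subtractf)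
qed

text \<open>The source of both structure equations: applied to \<open>N\<close> it yields Codazzi,
  applied to the coordinate fields \<open>pd k X\<close> it yields Gauss.\<close>

lemma cov_commutator:
  assumes Z: "smooth_on V Z" and y: "y \<in> V"
  shows "cov g X i (cov g X j Z) y - cov g X j (cov g X i Z) y =
    curv_op g (X y) (pd i X y) (pd j X y) (Z y)"
proof -
  note d = smooth_on_differentiable[OF _ y]
  note mv = bounded_bilinear_matrix_vector_mult
  have D: "cov g X i (cov g X j Z) y = pd i (pd j Z) y + pd i (pull_conn g X j) y *v Z y
      + pull_conn g X j y *v pd i Z y + pull_conn g X i y *v pd j Z y
      + (pull_conn g X i y ** pull_conn g X j y) *v Z y" for i j
  proof -
    have "cov g X j Z = (\<lambda>y. pd j Z y + pull_conn g X j y *v Z y)"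
      by (simp add: fun_eq_iff cov_def)
    then show ?thesis
      using d[OF smooth_on_pd[OF Z]] d[OF smooth_pull_conn] d[OF Z]
      by (simp add: cov_def[of g X i] pd_add differentiable_bilinear[OF mv] pd_bilinear[OF mv]
          mv.add_right matrix_vector_mul_assoc)
  qed
  have "cov g X i (cov g X j Z) y - cov g X j (cov g X i Z) y =
      (pd i (pull_conn g X j) y - pd j (pull_conn g X i) y
      + pull_conn g X i y ** pull_conn g X j y - pull_conn g X j y ** pull_conn g X i y) *v Z y"
    unfolding D pd_commute[OF V Z y, of i j] by (simp add: mv.add_left mv.diff_left)
  then show ?thesis
    by (simp add: pull_curvature[OF y] curv_op_matrix mv.sum_left mv.scaleR_left)
qed

end

section \<open>Spacelike hypersurfaces in a coordinate patch of constant curvature\<close>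

text \<open>\<open>G\<close> and \<open>h\<close> are parameters constrained on \<open>V\<close>
  only, so that the chart-dependent definitions can be substituted for them as they stand.\<close>

locale hypersurface_patch = metric_along W g V X
  for W :: "(real^'m::finite) set" and g and V :: "(real^'n::finite) set" and X +
  fixes N :: "real^'n \<Rightarrow> real^'m" and G h :: "real^'n \<Rightarrow> real^'n^'n" and \<kappa> :: real
  assumes card_m: "CARD('m) = CARD('n) + 1"
    and smooth_N: "smooth_on V N"
    and N_unit: "y \<in> V \<Longrightarrow> ip (g (X y)) (N y) (N y) = - 1"
    and N_normal: "y \<in> V \<Longrightarrow> ip (g (X y)) (N y) (pd i X y) = 0"
    and G_def: "y \<in> V \<Longrightarrow> G y = (\<chi> i j. ip (g (X y)) (pd i X y) (pd j X y))"
    and G_pos: "y \<in> V \<Longrightarrow> positive_definite (G y)"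
    and h_def: "y \<in> V \<Longrightarrow> h y = (\<chi> i j. - ip (g (X y)) (cov g X i (pd j X) y) (N y))"
    and sec: "\<And>y u v. y \<in> V \<Longrightarrow> spacelike (g (X y)) u \<Longrightarrow> timelike (g (X y)) v \<Longrightarrow>
      sectional_curvature g (X y) u v = \<kappa>"
begin

lemma ip_sym: "y \<in> V \<Longrightarrow> ip (g (X y)) u v = ip (g (X y)) v u"
  by (rule ip_commute[OF ambient.G_sym[OF X_in]])

lemma smooth_pdX: "smooth_on V (pd i X)"
  by (rule smooth_on_pd[OF smooth_X])

lemma smooth_ip: "smooth_on V Z \<Longrightarrow> smooth_on V Z' \<Longrightarrow> smooth_on V (\<lambda>z. ip (g (X z)) (Z z) (Z' z))"
  unfolding ip_def
  by (intro smooth_on_bilinear[OF V bounded_bilinear_inner]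
      smooth_on_bilinear[OF V bounded_bilinear_matrix_vector_mult] smooth_gX)

lemma smooth_metric: "smooth_on V G"
proof (rule smooth_on_cong[OF V G_def[symmetric]])
  show "smooth_on V (\<lambda>y. \<chi> i j. ip (g (X y)) (pd i X y) (pd j X y))"
    by (intro smooth_on_vec[OF V] smooth_ip smooth_pdX)
qed

lemma smooth_h: "smooth_on V h"
proof (rule smooth_on_cong[OF V h_def[symmetric]])
  have "smooth_on V (\<lambda>y. \<chi> i j. 0 - ip (g (X y)) (cov g X i (pd j X) y) (N y))"
    by (intro smooth_on_vec[OF V] smooth_on_diff[OF V] smooth_on_const smooth_ip smooth_cov
        smooth_pdX smooth_N)
  then show "smooth_on V (\<lambda>y. \<chi> i j. - ip (g (X y)) (cov g X i (pd j X) y) (N y))" by simp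
qed

sublocale intrinsic: metric_field V G
proof
  show "transpose (G y) = G y" if "y \<in> V" for y
    by (simp add: vec_eq_iff transpose_def G_def[OF that] ip_sym[OF that])
  show "invertible (G y)" if "y \<in> V" for y
    by (rule positive_definite_invertible[OF G_pos[OF that]])
qed (rule V smooth_metric)+

section \<open>The ambient basis formed by the coordinate fields and the normal\<close>

lemma N_pd: "y \<in> V \<Longrightarrow> ip (g (X y)) (pd i X y) (N y) = 0"
  using N_normal ip_sym by simp

lemma ip_tangent_normal:
  assumes y: "y \<in> V"
  shows "ip (g (X y)) ((\<Sum>k\<in>UNIV. a k *\<^sub>R pd k X y) + b *\<^sub>R N y) (N y) = - b"
    and "ip (g (X y)) ((\<Sum>k\<in>UNIV. a k *\<^sub>R pd k X y) + b *\<^sub>R N y) (pd l X y) =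
      (\<Sum>k\<in>UNIV. G y $ l $ k * a k)"
  using ip_sym[OF y, of "pd _ X y" "pd l X y"]
  by (simp_all add: ip.add_left ip.sum_left ip.scaleR_left N_unit[OF y] N_normal[OF y] N_pd[OF y]
      G_def[OF y] mult.commute)

lemma tangent_normal_eq_0:
  assumes y: "y \<in> V" and eq: "(\<Sum>k\<in>UNIV. a k *\<^sub>R pd k X y) + b *\<^sub>R N y = 0"
  shows "a k = 0" "b = 0"
proof -
  show "b = 0" using ip_tangent_normal(1)[OF y, of a b] by (simp add: eq ip.zero_left)
  have "G y *v (\<chi> k. a k) = 0"
    using ip_tangent_normal(2)[OF y, of a b]
    by (simp add: eq ip.zero_left vec_eq_iff matrix_vector_mult_def)
  then have "(\<chi> k. a k) = 0"
    using G_pos[OF y] unfolding positive_definite_def ip_def by (metis inner_zero_right less_irrefl)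
  then show "a k = 0" by (metis vec_lambda_beta zero_index)
qed

lemma tangent_normal_unique:
  assumes y: "y \<in> V" and eq: "(\<Sum>k\<in>UNIV. a k *\<^sub>R pd k X y) + b *\<^sub>R N y =
    (\<Sum>k\<in>UNIV. a' k *\<^sub>R pd k X y) + b' *\<^sub>R N y"
  shows "a k = a' k"
proof -
  have "(\<Sum>k\<in>UNIV. (a k - a' k) *\<^sub>R pd k X y) + (b - b') *\<^sub>R N y = 0"
    using eq by (simp add: scaleR_diff_left sum_subtractf algebra_simps)
  then show ?thesis using tangent_normal_eq_0(1)[OF y, of "\<lambda>k. a k - a' k" "b - b'" k] by simp
qed

text \<open>The coordinate fields and \<open>N\<close> are linearly independent since
  \<open>G\<close> is positive definite and \<open>N\<close> is a unit normal; the dimension count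
  in \<open>card_m\<close> makes them a basis.\<close>

lemma tangent_normal_span:
  assumes y: "y \<in> V"
  obtains a b where "v = (\<Sum>k\<in>UNIV. a k *\<^sub>R pd k X y) + b *\<^sub>R N y"
proof -
  define f :: "(real^'n) \<times> real \<Rightarrow> real^'m" where
    "f p = (\<Sum>k\<in>UNIV. fst p $ k *\<^sub>R pd k X y) + snd p *\<^sub>R N y" for p
  have lin: "linear f"
    by (rule linearI) (simp_all add: f_def scaleR_add_left sum.distrib scaleR_sum_right scaleR_add_right)
  have "p = 0" if "f p = 0" for p
  proof -
    have eq: "(\<Sum>k\<in>UNIV. fst p $ k *\<^sub>R pd k X y) + snd p *\<^sub>R N y = 0"
      using that by (simp add: f_def)
    show ?thesis
      using tangent_normal_eq_0(1)[OF y eq] tangent_normal_eq_0(2)[OF y eq]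
      by (simp add: prod_eq_iff vec_eq_iff)
  qed
  then have "inj f" using linear_injective_0[OF lin] by blast
  then have "dim (range f) = dim (UNIV :: ((real^'n) \<times> real) set)"
    by (intro dim_image_eq[OF lin]) simp
  then have "dim (range f) = DIM(real^'m)" by (simp add: card_m)
  then have "span (range f) = UNIV" using dim_eq_full by blast
  moreover have "span (range f) = range f"
    by (intro span_eq_iff[THEN iffD2] linear_subspace_image lin subspace_UNIV)
  ultimately obtain p where "v = f p" by (metis UNIV_I imageE)
  then show ?thesis using that[of "\<lambda>k. fst p $ k" "snd p"] by (simp add: f_def)
qed

lemma vector_eqI:
  assumes y: "y \<in> V"
    and "\<And>k. ip (g (X y)) v (pd k X y) = ip (g (X y)) w (pd k X y)"
    and "ip (g (X y)) v (N y) = ip (g (X y)) w (N y)"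
  shows "v = w"
proof -
  let ?d = "v - w"
  have "ip (g (X y)) ?d z = 0" for z
  proof -
    obtain a b where "z = (\<Sum>k\<in>UNIV. a k *\<^sub>R pd k X y) + b *\<^sub>R N y"
      by (rule tangent_normal_span[OF y])
    then show ?thesis
      using assms(2,3) by (simp add: ip.add_right ip.sum_right ip.scaleR_right ip.diff_left)
  qed
  \<comment> \<open>The form is indefinite, so pairing \<open>?d\<close> with itself would prove
    nothing; pairing with \<open>g (X y) *v ?d\<close> gives a Euclidean square.\<close>
  then have "ip (g (X y)) (g (X y) *v ?d) ?d = 0" using ip_sym[OF y] by metis
  then have "g (X y) *v ?d = 0" by (simp add: ip_def)
  then have "g (X y) *v ?d = g (X y) *v 0" by (simp only: mv.zero_right)
  from injD[OF inj_matrix_vector_mult[OF ambient.G_inv[OF X_in[OF y]]] this]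
  show ?thesis by simp
qed

section \<open>The shape operator and the equations of Gauss, Weingarten and Codazzi\<close>

definition A :: "real^'n \<Rightarrow> real^'n^'n" where
  "A y = matrix_inv (G y) ** h y"

lemma G_A: "y \<in> V \<Longrightarrow> G y ** A y = h y"
  by (simp add: A_def matrix_mul_assoc matrix_inv_right[OF intrinsic.G_inv])

lemma smooth_A: "smooth_on V A"
  unfolding A_def[abs_def]
  by (intro smooth_on_bilinear[OF V bounded_bilinear_matrix_mult] smooth_h
      smooth_on_matrix_inv[OF V smooth_metric intrinsic.G_inv])

lemma h_entry_sym: "y \<in> V \<Longrightarrow> h y $ i $ j = h y $ j $ i"
  by (simp add: h_def cov_pd_commute[of y i j])

lemma h_sym:
  assumes "y \<in> V"
  shows "transpose (h y) = h y"
  unfolding vec_eq_iff transpose_nth by (intro allI h_entry_sym[OF assms])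

text \<open>Differentiating the induced metric and using \<open>cov_pd_commute\<close> identifies
  the products with the coordinate fields as its Christoffel symbols of the first kind (Koszul's
  computation); the product with \<open>N\<close> is \<open>h\<close> by definition.\<close>

lemma gauss_formula:
  assumes y: "y \<in> V"
  shows "cov g X i (pd j X) y =
    (\<Sum>k\<in>UNIV. conn G i y $ k $ j *\<^sub>R pd k X y) + h y $ i $ j *\<^sub>R N y"
proof (rule vector_eqI[OF y], unfold ip_tangent_normal[OF y])
  show "ip (g (X y)) (cov g X i (pd j X) y) (N y) = - (h y $ i $ j)"
    by (simp add: h_def[OF y])
  fix l
  have D: "pd i G y $ j $ l = ip (g (X y)) (cov g X i (pd j X) y) (pd l X y)
      + ip (g (X y)) (cov g X i (pd l X) y) (pd j X y)" for i j l
  proof -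
    have "pd i G y $ j $ l = pd i (\<lambda>z. G z $ j $ l) y"
      by (rule intrinsic.pd_entry[OF smooth_metric y, symmetric])
    also have "\<dots> = pd i (\<lambda>z. ip (g (X z)) (pd j X z) (pd l X z)) y"
      by (rule pd_cong[OF V y]) (simp add: G_def)
    finally show ?thesis by (simp add: pd_ip[OF smooth_pdX smooth_pdX y] ip_sym[OF y, of "pd j X y"])
  qed
  have "(G y ** conn G i y) $ l $ j = ip (g (X y)) (cov g X i (pd j X) y) (pd l X y)"
    unfolding intrinsic.conn_lower[OF y] D cov_pd_commute[OF y, of j i] cov_pd_commute[OF y, of l i]
      cov_pd_commute[OF y, of l j] by simp
  then show "ip (g (X y)) (cov g X i (pd j X) y) (pd l X y) = (\<Sum>k\<in>UNIV. G y $ l $ k * conn G i y $ k $ j)"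
    by (simp add: matrix_matrix_mult_def)
qed

text \<open>The coefficients come from differentiating <N, N> = -1 and <N, \<partial>_l X> = 0. With
  the sign convention of \<open>h\<close> no minus sign appears.\<close>

lemma weingarten:
  assumes y: "y \<in> V"
  shows "cov g X i N y = (\<Sum>k\<in>UNIV. A y $ k $ i *\<^sub>R pd k X y)"
proof -
  have "cov g X i N y = (\<Sum>k\<in>UNIV. A y $ k $ i *\<^sub>R pd k X y) + 0 *\<^sub>R N y"
  proof (rule vector_eqI[OF y], unfold ip_tangent_normal[OF y])
    have "pd i (\<lambda>z. ip (g (X z)) (N z) (N z)) y = pd i (\<lambda>z. - 1) y"
      by (rule pd_cong[OF V y N_unit])
    then show "ip (g (X y)) (cov g X i N y) (N y) = - 0"
      by (simp add: pd_ip[OF smooth_N smooth_N y] ip_sym[OF y, of "N y" "cov g X i N y"])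
    fix l
    have "pd i (\<lambda>z. ip (g (X z)) (N z) (pd l X z)) y = pd i (\<lambda>z. 0) y"
      by (rule pd_cong[OF V y N_normal])
    then have "ip (g (X y)) (cov g X i N y) (pd l X y) = h y $ i $ l"
      by (simp add: pd_ip[OF smooth_N smooth_pdX y] ip_sym[OF y, of "N y"] h_def[OF y])
    also have "\<dots> = h y $ l $ i" by (rule h_entry_sym[OF y])
    also have "\<dots> = (\<Sum>k\<in>UNIV. G y $ l $ k * A y $ k $ i)"
      unfolding G_A[OF y, symmetric] by (simp add: matrix_matrix_mult_def)
    finally show "ip (g (X y)) (cov g X i N y) (pd l X y) = (\<Sum>k\<in>UNIV. G y $ l $ k * A y $ k $ i)" .
  qed
  then show ?thesis by simp
qed

lemma pdX_spacelike: "y \<in> V \<Longrightarrow> spacelike (g (X y)) (pd i X y)"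
proof -
  assume y: "y \<in> V"
  have "ip (G y) (axis i 1) (axis i 1) > 0"
    using G_pos[OF y] by (simp add: positive_definite_def)
  then show ?thesis by (simp add: ip_axis spacelike_def G_def[OF y])
qed

lemma N_timelike: "y \<in> V \<Longrightarrow> timelike (g (X y)) (N y)"
  by (simp add: timelike_def N_unit)

text \<open>A coordinate field and the normal supply the spacelike and the timelike vector that
  \<open>constant_curvature\<close> starts from.\<close>

lemma ambient_curvature:
  "y \<in> V \<Longrightarrow> curv_op g (X y) u v w =
    \<kappa> *\<^sub>R (ip (g (X y)) v w *\<^sub>R u - ip (g (X y)) u w *\<^sub>R v)"
  by (rule ambient.constant_curvature[OF X_in pdX_spacelike N_timelike sec])

lemma cov_tangent:
  assumes Q: "smooth_on V Q" and y: "y \<in> V"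
  shows "cov g X i (\<lambda>z. \<Sum>k\<in>UNIV. Q z $ k *\<^sub>R pd k X z) y =
    (\<Sum>l\<in>UNIV. (pd i Q y + conn G i y *v Q y) $ l *\<^sub>R pd l X y)
      + (\<Sum>k\<in>UNIV. Q y $ k * h y $ i $ k) *\<^sub>R N y"
proof -
  note Qk = smooth_on_nth[OF V Q]
  have nth: "pd i (\<lambda>z. Q z $ k) y = pd i Q y $ k" for k
    by (rule pd_linear[OF bounded_linear_vec_nth smooth_on_differentiable[OF Q y]])
  have "cov g X i (\<lambda>z. \<Sum>k\<in>UNIV. Q z $ k *\<^sub>R pd k X z) y =
      (\<Sum>k\<in>UNIV. cov g X i (\<lambda>z. Q z $ k *\<^sub>R pd k X z) y)"
    by (intro cov_sum y smooth_on_bilinear[OF V bounded_bilinear_scaleR] Qk smooth_pdX)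
  also have "\<dots> = (\<Sum>k\<in>UNIV. pd i Q y $ k *\<^sub>R pd k X y) +
      (\<Sum>k\<in>UNIV. \<Sum>l\<in>UNIV. (Q y $ k * conn G i y $ l $ k) *\<^sub>R pd l X y) +
      (\<Sum>k\<in>UNIV. (Q y $ k * h y $ i $ k) *\<^sub>R N y)"
    by (simp add: cov_scaleR[OF Qk smooth_pdX y] nth gauss_formula[OF y] scaleR_add_right
        scaleR_sum_right sum.distrib)
  also have "(\<Sum>k\<in>UNIV. \<Sum>l\<in>UNIV. (Q y $ k * conn G i y $ l $ k) *\<^sub>R pd l X y) =
      (\<Sum>l\<in>UNIV. (conn G i y *v Q y) $ l *\<^sub>R pd l X y)"
    by (subst sum.swap) (simp add: matrix_vector_mult_def scaleR_sum_left mult.commute)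
  finally show ?thesis
    by (simp add: scaleR_add_left sum.distrib scaleR_sum_left)
qed

text \<open>This is the tangential part of the commutator of covariant derivatives on
  \<open>N\<close>, which vanishes because in constant curvature R(u, v) N = 0 for tangent u, v. The
  remaining term of \<nabla>A, \<open>A y ** conn G i y\<close>, has the same symmetry by itself and
  is added in \<open>B_sym\<close>.\<close>

lemma codazzi:
  assumes y: "y \<in> V"
  shows "(pd i A y + conn G i y ** A y) $ l $ j = (pd j A y + conn G j y ** A y) $ l $ i"
proof -
  \<comment> \<open>Only tangential coefficients will be compared, so the normal coefficient stays
    existential.\<close>
  have D: "\<exists>b. cov g X i (cov g X j N) y =
      (\<Sum>l\<in>UNIV. (pd i A y + conn G i y ** A y) $ l $ j *\<^sub>R pd l X y) + b *\<^sub>R N y" for i j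
  proof -
    define Q where "Q z = (\<chi> k. A z $ k $ j)" for z
    have Q: "smooth_on V Q" unfolding Q_def[abs_def]
      by (intro smooth_on_vec[OF V] intrinsic.smooth_entry smooth_A)
    have "pd i Q y $ k = pd i A y $ k $ j" for k
      using pd_linear[OF bounded_linear_vec_nth smooth_on_differentiable[OF Q y], of i k]
      by (simp add: Q_def intrinsic.pd_entry[OF smooth_A y])
    moreover have "(conn G i y *v Q y) $ l = (conn G i y ** A y) $ l $ j" for l
      by (simp add: Q_def matrix_vector_mult_def matrix_matrix_mult_def)
    moreover have "cov g X i (cov g X j N) y = cov g X i (\<lambda>z. \<Sum>k\<in>UNIV. Q z $ k *\<^sub>R pd k X z) y"
      by (rule cov_cong[OF y]) (simp add: weingarten Q_def)
    ultimately show ?thesis unfolding cov_tangent[OF Q y] by auto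
  qed
  obtain b where b: "cov g X i (cov g X j N) y =
      (\<Sum>l\<in>UNIV. (pd i A y + conn G i y ** A y) $ l $ j *\<^sub>R pd l X y) + b *\<^sub>R N y" using D by blast
  obtain b' where b': "cov g X j (cov g X i N) y =
      (\<Sum>l\<in>UNIV. (pd j A y + conn G j y ** A y) $ l $ i *\<^sub>R pd l X y) + b' *\<^sub>R N y" using D by blast
  have "cov g X i (cov g X j N) y = cov g X j (cov g X i N) y"
    using cov_commutator[OF smooth_N y, of i j] by (simp add: ambient_curvature[OF y] N_pd[OF y])
  then show ?thesis unfolding b b' by (rule tangent_normal_unique[OF y])
qed

text \<open>The tangential part of the commutator on \<open>pd k X\<close>. The terms in
  \<open>h\<close> and \<open>A\<close> carry a minus sign, opposite to the Riemannian case, because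
  the normal is timelike.\<close>

lemma gauss_equation:
  assumes y: "y \<in> V"
  shows "curv_matrix G i j y $ l $ k =
    \<kappa> * (G y $ j $ k * (if l = i then 1 else 0) - G y $ i $ k * (if l = j then 1 else 0))
    - (h y $ j $ k * A y $ l $ i - h y $ i $ k * A y $ l $ j)"
proof -
  have D: "\<exists>b. cov g X i (cov g X j (pd k X)) y =
      (\<Sum>l\<in>UNIV. (pd i (conn G j) y $ l $ k + (conn G i y ** conn G j y) $ l $ k
        + h y $ j $ k * A y $ l $ i) *\<^sub>R pd l X y) + b *\<^sub>R N y" for i j
  proof -
    define Q where "Q z = (\<chi> l. conn G j z $ l $ k)" for z
    have Q: "smooth_on V Q" unfolding Q_def[abs_def]
      by (intro smooth_on_vec[OF V] intrinsic.smooth_entry intrinsic.smooth_conn)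
    have hs: "smooth_on V (\<lambda>z. h z $ j $ k)" by (rule intrinsic.smooth_entry[OF smooth_h])
    have q: "pd i Q y $ l = pd i (conn G j) y $ l $ k" for l
      using pd_linear[OF bounded_linear_vec_nth smooth_on_differentiable[OF Q y], of i l]
      by (simp add: Q_def intrinsic.pd_entry[OF intrinsic.smooth_conn y])
    have c: "(conn G i y *v Q y) $ l = (conn G i y ** conn G j y) $ l $ k" for l
      by (simp add: Q_def matrix_vector_mult_def matrix_matrix_mult_def)
    have "cov g X i (cov g X j (pd k X)) y =
        cov g X i (\<lambda>z. (\<Sum>l\<in>UNIV. Q z $ l *\<^sub>R pd l X z) + h z $ j $ k *\<^sub>R N z) y"
      by (rule cov_cong[OF y]) (simp add: gauss_formula Q_def)
    also have "\<dots> = cov g X i (\<lambda>z. (\<Sum>l\<in>UNIV. Q z $ l *\<^sub>R pd l X z)) y +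
        (pd i (\<lambda>z. h z $ j $ k) y *\<^sub>R N y + h y $ j $ k *\<^sub>R cov g X i N y)"
      by (subst cov_add[OF _ _ y], intro smooth_on_sum[OF V] smooth_on_bilinear[OF V bounded_bilinear_scaleR]
          smooth_on_nth[OF V Q] smooth_pdX, intro smooth_on_bilinear[OF V bounded_bilinear_scaleR] hs smooth_N)
        (simp add: cov_scaleR[OF hs smooth_N y])
    also have "\<dots> = (\<Sum>l\<in>UNIV. (pd i (conn G j) y $ l $ k + (conn G i y ** conn G j y) $ l $ k
        + h y $ j $ k * A y $ l $ i) *\<^sub>R pd l X y)
        + ((\<Sum>l\<in>UNIV. Q y $ l * h y $ i $ l) + pd i (\<lambda>z. h z $ j $ k) y) *\<^sub>R N y"
      unfolding cov_tangent[OF Q y]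
      by (simp add: q c weingarten[OF y] scaleR_add_left sum.distrib scaleR_sum_right)
    finally show ?thesis by blast
  qed
  obtain b where b: "cov g X i (cov g X j (pd k X)) y =
      (\<Sum>l\<in>UNIV. (pd i (conn G j) y $ l $ k + (conn G i y ** conn G j y) $ l $ k
        + h y $ j $ k * A y $ l $ i) *\<^sub>R pd l X y) + b *\<^sub>R N y" using D by blast
  obtain b' where b': "cov g X j (cov g X i (pd k X)) y =
      (\<Sum>l\<in>UNIV. (pd j (conn G i) y $ l $ k + (conn G j y ** conn G i y) $ l $ k
        + h y $ i $ k * A y $ l $ j) *\<^sub>R pd l X y) + b' *\<^sub>R N y" using D by blast
  have s: "(\<Sum>l\<in>UNIV. (\<kappa> * (G y $ j $ k * (if l = i then 1 else 0)
      - G y $ i $ k * (if l = j then 1 else 0))) *\<^sub>R pd l X y)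
      = \<kappa> *\<^sub>R (G y $ j $ k *\<^sub>R pd i X y - G y $ i $ k *\<^sub>R pd j X y)"
  proof -
    have "(\<Sum>l\<in>UNIV. (c * (if l = m then 1 else 0)) *\<^sub>R pd l X y) = c *\<^sub>R pd m X y" for c m
    proof -
      have "(c * (if l = m then 1 else 0)) *\<^sub>R pd l X y = (if l = m then c *\<^sub>R pd l X y else 0)" for l
        by simp
      then show ?thesis by simp
    qed
    then show ?thesis
      by (simp only: scaleR_scaleR[symmetric] scaleR_sum_right[symmetric] scaleR_diff_left sum_subtractf)
  qed
  have "cov g X i (cov g X j (pd k X)) y = cov g X j (cov g X i (pd k X)) y
      + (\<Sum>l\<in>UNIV. (\<kappa> * (G y $ j $ k * (if l = i then 1 else 0)
      - G y $ i $ k * (if l = j then 1 else 0))) *\<^sub>R pd l X y)"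
    unfolding s using cov_commutator[OF smooth_pdX y, of i j k]
    by (simp add: ambient_curvature[OF y] G_def[OF y] algebra_simps)
  then have "(\<Sum>l\<in>UNIV. (pd i (conn G j) y $ l $ k + (conn G i y ** conn G j y) $ l $ k
        + h y $ j $ k * A y $ l $ i) *\<^sub>R pd l X y) + b *\<^sub>R N y =
      (\<Sum>l\<in>UNIV. (pd j (conn G i) y $ l $ k + (conn G j y ** conn G i y) $ l $ k
        + h y $ i $ k * A y $ l $ j + \<kappa> * (G y $ j $ k * (if l = i then 1 else 0)
      - G y $ i $ k * (if l = j then 1 else 0))) *\<^sub>R pd l X y) + b' *\<^sub>R N y"
    unfolding b b' by (simp only: scaleR_add_left sum.distrib) (simp only: add_ac)
  from tangent_normal_unique[OF y this, of l]
  show ?thesis by (simp add: intrinsic.curv_matrix_eq[OF y] algebra_simps)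
qed

end


section \<open>Covariant differentiation of endomorphism fields\<close>

context metric_field
begin

definition cov_end :: "'k \<Rightarrow> (real^'k \<Rightarrow> real^'k^'k) \<Rightarrow> real^'k \<Rightarrow> real^'k^'k" where
  "cov_end i Q y = pd i Q y + conn G i y ** Q y - Q y ** conn G i y"

lemma smooth_cov_end: "smooth_on V Q \<Longrightarrow> smooth_on V (cov_end i Q)"
  unfolding cov_end_def[abs_def]
  by (intro smooth_on_diff[OF V] smooth_on_add[OF V] smooth_on_pd
      smooth_on_bilinear[OF V bounded_bilinear_matrix_mult] smooth_conn)

lemma pd_trace:
  assumes "smooth_on V Q" "y \<in> V"
  shows "pd i (\<lambda>z. trace (Q z)) y = trace (cov_end i Q y)"
  using pd_linear[OF bounded_linear_trace smooth_on_differentiable[OF assms]]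
    trace_mul_sym[of "conn G i y" "Q y"]
  by (simp add: cov_end_def trace_add trace_sub)

lemma cov_end_mult:
  assumes Q: "smooth_on V Q" and Q': "smooth_on V Q'" and y: "y \<in> V"
  shows "cov_end i (\<lambda>z. Q z ** Q' z) y = cov_end i Q y ** Q' y + Q y ** cov_end i Q' y"
  by (simp add: cov_end_def pd_bilinear[OF bounded_bilinear_matrix_mult]
      smooth_on_differentiable[OF Q y] smooth_on_differentiable[OF Q' y]
      mm.add_left mm.add_right mm.diff_left mm.diff_right matrix_mul_assoc)

text \<open>The Ricci identity for endomorphisms with \<open>j\<close> as a mere label: the
  Christoffel term that a covariant index \<open>j\<close> would contribute is symmetric in
  \<open>i\<close> and \<open>j\<close> and would cancel.\<close>

lemma cov_end_commutator:
  assumes Q: "smooth_on V Q" and y: "y \<in> V"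
  shows "cov_end i (cov_end j Q) y - cov_end j (cov_end i Q) y =
    curv_matrix G i j y ** Q y - Q y ** curv_matrix G i j y"
proof -
  note d = smooth_on_differentiable[OF _ y]
  note mult = bounded_bilinear_matrix_mult
  have D: "cov_end i (cov_end j Q) y = pd i (pd j Q) y
      + (pd i (conn G j) y ** Q y + conn G j y ** pd i Q y)
      - (pd i Q y ** conn G j y + Q y ** pd i (conn G j) y)
      + conn G i y ** (pd j Q y + conn G j y ** Q y - Q y ** conn G j y)
      - (pd j Q y + conn G j y ** Q y - Q y ** conn G j y) ** conn G i y" for i j
  proof -
    have "cov_end j Q = (\<lambda>z. pd j Q z + conn G j z ** Q z - Q z ** conn G j z)"
      by (simp add: fun_eq_iff cov_end_def)
    then show ?thesis
      using d[OF smooth_on_pd[OF Q]] d[OF smooth_conn] d[OF Q]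
      by (simp add: cov_end_def[of i] pd_add pd_diff differentiable_add
          differentiable_bilinear[OF mult] pd_bilinear[OF mult])
  qed
  show ?thesis
    unfolding D pd_commute[OF V Q y, of i j] curv_matrix_eq[OF y]
    by (simp add: mm.add_left mm.add_right mm.diff_left mm.diff_right matrix_mul_assoc)
qed

text \<open>With \<open>K\<close> = G Q one has \<partial>_i K = \<Gamma>_i^T K + K \<Gamma>_i + G
  \<nabla>_i Q. The left side is symmetric and the first two terms on the right are transposes of
  each other.\<close>

lemma cov_end_selfadjoint:
  assumes Q: "smooth_on V Q" and sym: "\<And>z. z \<in> V \<Longrightarrow> transpose (G z ** Q z) = G z ** Q z"
    and y: "y \<in> V"
  shows "transpose (G y ** cov_end i Q y) = G y ** cov_end i Q y"
proof -
  note d = smooth_on_differentiable[OF _ y]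
  note mult = bounded_bilinear_matrix_mult
  define K where "K = G y ** Q y"
  have K: "transpose K = K" unfolding K_def by (rule sym[OF y])
  have "pd i (\<lambda>z. G z ** Q z) y = transpose (conn G i y) ** K + K ** conn G i y + G y ** cov_end i Q y"
    by (simp add: pd_bilinear[OF mult] d[OF smooth_G] d[OF Q] metric_compat[OF y] cov_end_def K_def
        mm.add_left mm.add_right mm.diff_right matrix_mul_assoc)
  moreover have "transpose (pd i (\<lambda>z. G z ** Q z) y) = pd i (\<lambda>z. G z ** Q z) y"
  proof -
    have "transpose (pd i (\<lambda>z. G z ** Q z) y) = pd i (\<lambda>z. transpose (G z ** Q z)) y"
      by (intro pd_linear[OF bounded_linear_transpose, symmetric] differentiable_bilinear[OF mult]
          d[OF smooth_G] d[OF Q])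
    also have "\<dots> = pd i (\<lambda>z. G z ** Q z) y" by (rule pd_cong[OF V y sym])
    finally show ?thesis .
  qed
  ultimately show ?thesis
    by (simp add: transpose_add matrix_transpose_mul[of "transpose _"] matrix_transpose_mul[of K] K
        add.commute)
qed

end

section \<open>The derivatives of the shape operator\<close>

context hypersurface_patch
begin

text \<open>\<open>B i = \<nabla>\<^sub>i A\<close> and \<open>C i j = \<nabla>\<^sub>i \<nabla>\<^sub>j A\<close> for the mixed tensor \<open>A\<close>.\<close>
definition B :: "'n \<Rightarrow> real^'n \<Rightarrow> real^'n^'n" where
  "B i = intrinsic.cov_end i A"

definition C :: "'n \<Rightarrow> 'n \<Rightarrow> real^'n \<Rightarrow> real^'n^'n" where
  "C i j y = intrinsic.cov_end i (B j) y - (\<Sum>s\<in>UNIV. conn G i y $ s $ j *\<^sub>R B s y)"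

lemma smooth_B: "smooth_on V (B i)"
  unfolding B_def by (rule intrinsic.smooth_cov_end[OF smooth_A])

lemma A_selfadjoint: "y \<in> V \<Longrightarrow> transpose (G y ** A y) = G y ** A y"
  by (simp add: G_A h_sym)

lemma B_selfadjoint: "y \<in> V \<Longrightarrow> transpose (G y ** B i y) = G y ** B i y"
  unfolding B_def by (rule intrinsic.cov_end_selfadjoint[OF smooth_A A_selfadjoint])

lemma C_selfadjoint:
  assumes "y \<in> V"
  shows "transpose (G y ** C i j y) = G y ** C i j y"
  by (simp add: C_def mm.diff_right mm.sum_right mm.scaleR_right transpose_diff transpose_sum_scaleR
      B_selfadjoint[OF assms] intrinsic.cov_end_selfadjoint[OF smooth_B B_selfadjoint assms])

text \<open>The product of \<open>A\<close> with the connection matrix is symmetric in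
  \<open>i\<close> and \<open>j\<close> because \<Gamma> is, which completes \<open>codazzi\<close>
  to the symmetry of \<nabla>A in its lower indices.\<close>

lemma B_sym:
  assumes y: "y \<in> V"
  shows "B i y $ l $ j = B j y $ l $ i"
proof -
  have "(A y ** conn G i y) $ l $ j = (A y ** conn G j y) $ l $ i"
    unfolding matrix_matrix_mult_def
    by (simp add: intrinsic.conn_sym[OF y, of i _ j])
  then show ?thesis
    using codazzi[OF y, of i l j] by (simp add: B_def intrinsic.cov_end_def)
qed

text \<open>Exchanging \<open>j\<close> and \<open>k\<close> swaps the two correction terms: right
  multiplication by \<Gamma>_i in \<open>cov_end\<close> and the Christoffel sum in \<open>C\<close>
  turn into each other by \<open>B_sym\<close>.\<close>

lemma C_sym:
  assumes y: "y \<in> V"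
  shows "C i j y $ l $ k = C i k y $ l $ j"
proof -
  have "pd i (\<lambda>z. B j z $ l $ k) y = pd i (\<lambda>z. B k z $ l $ j) y"
    by (rule pd_cong[OF V y B_sym])
  then have 1: "pd i (B j) y $ l $ k = pd i (B k) y $ l $ j"
    by (simp add: intrinsic.pd_entry[OF smooth_B y])
  have 2: "(conn G i y ** B j y) $ l $ k = (conn G i y ** B k y) $ l $ j"
    by (simp add: matrix_matrix_mult_def B_sym[OF y, of j _ k])
  have 3: "(B j y ** conn G i y) $ l $ k = (\<Sum>s\<in>UNIV. conn G i y $ s $ k *\<^sub>R B s y) $ l $ j" for j k
    by (simp add: matrix_matrix_mult_def B_sym[OF y, of j] mult.commute)
  show ?thesis
    unfolding C_def intrinsic.cov_end_def
    by (simp only: vector_minus_component vector_add_component 1 2 3[of j k] 3[of k j])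
qed

lemma C_commutator:
  assumes y: "y \<in> V"
  shows "C i j y - C j i y = curv_matrix G i j y ** A y - A y ** curv_matrix G i j y"
  using intrinsic.cov_end_commutator[OF smooth_A y, of i j]
  by (simp add: C_def B_def intrinsic.conn_sym[OF y, of i _ j])

text \<open>The functions nH, n(n-1)R and the constant in the linear relation between P and H all
  have this form on \<open>V\<close>, so a single Hessian computation covers them.\<close>

lemma
  assumes f: "\<And>z. z \<in> V \<Longrightarrow> f z = p * (trace (A z))\<^sup>2 + q * trace (A z ** A z) + r * trace (A z) + s"
    and y: "y \<in> V"
  shows pd_trace_polynomial:
      "pd j f y = (2 * p * trace (A y) + r) * trace (B j y) + 2 * q * trace (A y ** B j y)"
    and hessian_trace_polynomial: "hessian G f y $ i $ j =
      2 * p * trace (B i y) * trace (B j y) + (2 * p * trace (A y) + r) * trace (C i j y)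
      + 2 * q * (trace (B i y ** B j y) + trace (A y ** C i j y))"
proof -
  note mult = bounded_bilinear_mult
  have AA: "smooth_on V (\<lambda>z. A z ** A z)" and AB: "\<And>j. smooth_on V (\<lambda>z. A z ** B j z)"
    by (intro smooth_on_bilinear[OF V bounded_bilinear_matrix_mult] smooth_A smooth_B)+
  have dtr: "(\<lambda>z. trace (Q z)) differentiable (at z)" if "smooth_on V Q" "z \<in> V"
    for Q :: "real^'n \<Rightarrow> real^'n^'n" and z
    by (rule differentiable_linear[OF bounded_linear_trace smooth_on_differentiable[OF that]])
  have cm: "pd i (\<lambda>z. c * g z) y = c * pd i g y" if "g differentiable (at y)"
    for c :: real and i and g :: "real^'n \<Rightarrow> real" and y
    by (rule pd_linear[OF bounded_linear_mult_right that])
  have trA: "pd j (\<lambda>z. trace (A z)) z = trace (B j z)" if "z \<in> V" for j z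
    by (simp add: B_def intrinsic.pd_trace[OF smooth_A that])
  have trAA: "pd j (\<lambda>z. trace (A z ** A z)) z = 2 * trace (A z ** B j z)" if "z \<in> V" for j z
    using trace_mul_sym[of "B j z" "A z"]
    by (simp add: intrinsic.pd_trace[OF AA that] intrinsic.cov_end_mult[OF smooth_A smooth_A that]
        trace_add B_def)
  have D: "pd j f z = (2 * p * trace (A z) + r) * trace (B j z) + 2 * q * trace (A z ** B j z)"
    if z: "z \<in> V" for j z
  proof -
    note d = dtr[OF smooth_A z] dtr[OF AA z]
    have "pd j f z = pd j (\<lambda>z. p * (trace (A z) * trace (A z)) + q * trace (A z ** A z) + r * trace (A z) + s) z"
      by (rule pd_cong[OF V z]) (simp add: f power2_eq_square)
    also have "\<dots> = p * (trace (B j z) * trace (A z) + trace (A z) * trace (B j z))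
        + q * (2 * trace (A z ** B j z)) + r * trace (B j z)"
      by (simp add: pd_add differentiable_add differentiable_bilinear[OF mult] cm d
          pd_bilinear[OF mult] trA[OF z] trAA[OF z])
    finally show ?thesis by (simp add: algebra_simps)
  qed
  show "pd j f y = (2 * p * trace (A y) + r) * trace (B j y) + 2 * q * trace (A y ** B j y)"
    by (rule D[OF y])
  \<comment> \<open>\<open>K\<close> is the Christoffel correction contained in
    \<open>C i j\<close>; its contribution is exactly the Christoffel term of the Hessian.\<close>
  define K where "K = (\<Sum>s\<in>UNIV. conn G i y $ s $ j *\<^sub>R B s y)"
  have C_sum: "intrinsic.cov_end i (B j) y = C i j y + K"
    by (simp add: C_def K_def)
  note d = dtr[OF smooth_A y] dtr[OF smooth_B y] dtr[OF AB y]
  have "pd i (pd j f) y = pd i (\<lambda>z. (2 * p * trace (A z) + r) * trace (B j z) + 2 * q * trace (A z ** B j z)) y"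
    by (rule pd_cong[OF V y D])
  also have "\<dots> = 2 * p * trace (B i y) * trace (B j y)
      + (2 * p * trace (A y) + r) * trace (intrinsic.cov_end i (B j) y)
      + 2 * q * (trace (B i y ** B j y) + trace (A y ** intrinsic.cov_end i (B j) y))"
  proof -
    have "intrinsic.cov_end i (\<lambda>z. A z ** B j z) y = B i y ** B j y + A y ** intrinsic.cov_end i (B j) y"
      unfolding intrinsic.cov_end_mult[OF smooth_A smooth_B y] B_def[of i] ..
    then show ?thesis
      by (simp add: pd_add differentiable_add differentiable_bilinear[OF mult] cm d
          pd_bilinear[OF mult] trA[OF y] intrinsic.pd_trace[OF smooth_B y]
          intrinsic.pd_trace[OF AB y] trace_add)
  qed
  finally have second: "pd i (pd j f) y = 2 * p * trace (B i y) * trace (B j y)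
      + (2 * p * trace (A y) + r) * trace (intrinsic.cov_end i (B j) y)
      + 2 * q * (trace (B i y ** B j y) + trace (A y ** intrinsic.cov_end i (B j) y))" .
  show "hessian G f y $ i $ j =
      2 * p * trace (B i y) * trace (B j y) + (2 * p * trace (A y) + r) * trace (C i j y)
      + 2 * q * (trace (B i y ** B j y) + trace (A y ** C i j y))"
  proof -
    have "(\<Sum>k\<in>UNIV. christoffel G k i j y * pd k f y) =
        (2 * p * trace (A y) + r) * (\<Sum>k\<in>UNIV. conn G i y $ k $ j * trace (B k y))
        + 2 * q * (\<Sum>k\<in>UNIV. conn G i y $ k $ j * trace (A y ** B k y))"
      unfolding D[OF y] sum_distrib_left sum.distrib[symmetric]
      by (intro sum.cong refl) (simp add: conn_def algebra_simps)
    also have "\<dots> = (2 * p * trace (A y) + r) * trace K + 2 * q * trace (A y ** K)"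
      by (simp only: K_def mm.sum_right mm.scaleR_right trace_sum_scaleR)
    finally have "(\<Sum>k\<in>UNIV. christoffel G k i j y * pd k f y) =
        (2 * p * trace (A y) + r) * trace K + 2 * q * trace (A y ** K)" .
    then show ?thesis
      using second unfolding C_sum
      by (simp add: hessian_def trace_add mm.add_right distrib_left)
  qed
qed

end


section \<open>Symmetric matrices\<close>

lemma inner_matrix_trace: "(M :: real^'n^'n::finite) \<bullet> M' = trace (transpose M ** M')"
proof -
  have "M \<bullet> M' = (\<Sum>i\<in>UNIV. \<Sum>j\<in>UNIV. M $ i $ j * M' $ i $ j)"
    by (simp add: inner_vec_def)
  then show ?thesis
    unfolding trace_def matrix_matrix_mult_def transpose_def
    by simp (rule sum.swap)
qed

text \<open>Cauchy-Schwarz for \<phi> against the traceless part \<open>T\<close> of v v^T, whose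
  norm is sqrt((N-1)/N) |v|^2; for traceless \<phi> the product with \<open>T\<close> is the
  quadratic form.\<close>

lemma traceless_quadratic_form_le:
  fixes \<phi> :: "real^'n^'n::finite"
  assumes tr: "trace \<phi> = 0" and n: "CARD('n) \<ge> 2"
  defines "N \<equiv> real CARD('n)"
  shows "v \<bullet> (\<phi> *v v) \<le> (N - 1) / sqrt (N * (N - 1)) * norm \<phi> * (v \<bullet> v)"
proof -
  have N: "N \<ge> 2" using n by (simp add: N_def)
  define T :: "real^'n^'n" where "T = (\<chi> i j. v $ i * v $ j - (v \<bullet> v) / N * (if i = j then 1 else 0))"
  have "\<phi> \<bullet> T = (\<Sum>i\<in>UNIV. \<Sum>j\<in>UNIV. v $ i * (\<phi> $ i $ j * v $ j)) - (v \<bullet> v) / N * trace \<phi>"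
  proof -
    have "\<phi> $ i $ j * T $ i $ j = v $ i * (\<phi> $ i $ j * v $ j) - (if i = j then (v \<bullet> v) / N * \<phi> $ i $ i else 0)"
      for i j by (simp add: T_def algebra_simps)
    then have "\<phi> \<bullet> T = (\<Sum>i\<in>UNIV. \<Sum>j\<in>UNIV. v $ i * (\<phi> $ i $ j * v $ j)
        - (if i = j then (v \<bullet> v) / N * \<phi> $ i $ i else 0))"
      by (simp add: inner_vec_def)
    then show ?thesis
      by (simp add: sum_subtractf trace_def sum_distrib_left)
  qed
  also have "(\<Sum>i\<in>UNIV. \<Sum>j\<in>UNIV. v $ i * (\<phi> $ i $ j * v $ j)) = v \<bullet> (\<phi> *v v)"
    by (simp add: inner_vec_def matrix_vector_mult_def sum_distrib_left)
  finally have 1: "\<phi> \<bullet> T = v \<bullet> (\<phi> *v v)" by (simp add: tr)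
  let ?q = "v \<bullet> v"
  have entry: "T $ i $ j * T $ i $ j = (v $ i * v $ i) * (v $ j * v $ j)
      + (if i = j then ?q / N * (?q / N) - 2 * (?q / N) * (v $ j * v $ j) else 0)" for i j
    by (simp add: T_def algebra_simps)
  have qq: "(\<Sum>i\<in>UNIV. v $ i * v $ i) = ?q" by (simp add: inner_vec_def)
  have "T \<bullet> T = (\<Sum>i\<in>UNIV. \<Sum>j\<in>UNIV. T $ i $ j * T $ i $ j)"
    by (simp add: inner_vec_def)
  also have "\<dots> = (\<Sum>i\<in>UNIV. (v $ i * v $ i) * ?q + (?q / N * (?q / N) - 2 * (?q / N) * (v $ i * v $ i)))"
    unfolding entry sum.distrib sum_distrib_left[symmetric] qq by simp
  also have "\<dots> = ?q * ?q + (N * (?q / N * (?q / N)) - 2 * (?q / N) * ?q)"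
    unfolding sum.distrib sum_subtractf sum_distrib_left[symmetric] sum_distrib_right[symmetric] qq
    by (simp add: N_def)
  also have "\<dots> = ((N - 1) / sqrt (N * (N - 1)) * ?q)\<^sup>2"
    using N by (simp add: power_mult_distrib power_divide) (simp add: field_simps power2_eq_square)
  finally have "norm T = (N - 1) / sqrt (N * (N - 1)) * ?q"
    using N by (simp add: norm_eq_sqrt_inner)
  then show ?thesis
    using norm_cauchy_schwarz[of \<phi> T] by (simp add: 1 mult_ac)
qed

lemma trace_conjugate_basis:
  "(\<Sum>k\<in>UNIV. (P *v axis k 1) \<bullet> (M *v (P *v axis k 1))) = trace (transpose P ** M ** (P :: real^'n^'n::finite))"
proof -
  have "(P *v axis k 1) \<bullet> (M *v (P *v axis k 1)) = (transpose P ** M ** P) $ k $ k" for k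
  proof -
    have "(P *v axis k 1) \<bullet> (M *v (P *v axis k 1)) = ip M (P *v axis k 1) (P *v axis k 1)"
      by (simp only: ip_def)
    also have "\<dots> = ip (transpose P ** M ** P) (axis k 1) (axis k 1)"
      by (simp only: ip_matrix_left ip_matrix_right matrix_mul_assoc)
    finally show ?thesis by (simp only: ip_axis)
  qed
  then show ?thesis by (simp add: trace_def)
qed

text \<open>Okumura's inequality. With \<open>t\<close> the bound for the quadratic form of \<open>\<phi>\<close> and \<open>s\<close> the
  \<open>n-1\<close>-fold eigenvalue of the extremal case, \<open>(\<phi> - s I)(t I - \<phi>)(\<phi> - s I)\<close> has nonnegative trace.\<close>
lemma okumura_upper:
  fixes \<phi> :: "real^'n^'n::finite"
  assumes sym: "transpose \<phi> = \<phi>" and tr: "trace \<phi> = 0" and n: "CARD('n) \<ge> 2"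
  defines "N \<equiv> real CARD('n)"
  shows "trace (\<phi> ** \<phi> ** \<phi>) \<le> (N - 2) / sqrt (N * (N - 1)) * norm \<phi> ^ 3"
proof -
  have N: "N \<ge> 2" using n by (simp add: N_def)
  define q where "q = sqrt (N * (N - 1))"
  have q: "q > 0" "q\<^sup>2 = N * (N - 1)" using N by (simp_all add: q_def)
  define f where "f = norm \<phi>"
  define t where "t = (N - 1) / q * f"
  define s where "s = - f / q"
  define P where "P = \<phi> - s *\<^sub>R mat 1"
  have ff: "trace (\<phi> ** \<phi>) = f\<^sup>2"
    using inner_matrix_trace[of \<phi> \<phi>] by (simp add: f_def sym power2_norm_eq_inner)
  have P: "transpose P = P"
    by (simp add: P_def transpose_diff transpose_scalar sym)
  have idl: "mat 1 ** M = M" and idr: "M ** mat 1 = M" for M :: "real^'n^'n" by simp_all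
  have PP: "trace (P ** P) = f\<^sup>2 + s\<^sup>2 * N"
    unfolding P_def
    by (simp only: mm.diff_left mm.diff_right mm.scaleR_left mm.scaleR_right idl idr trace_sub
        trace_scaleR tr ff trace_I) (simp add: N_def power2_eq_square)
  have PfP: "trace (P ** \<phi> ** P) = trace (\<phi> ** \<phi> ** \<phi>) - 2 * s * f\<^sup>2"
    unfolding P_def
    by (simp only: mm.diff_left mm.diff_right mm.scaleR_left mm.scaleR_right idl idr trace_sub
        trace_scaleR tr ff) simp
  have "v \<bullet> (\<phi> *v v) \<le> t * (v \<bullet> v)" for v
    using traceless_quadratic_form_le[OF tr n, of v] by (simp add: t_def q_def f_def N_def)
  then have "(\<Sum>k\<in>UNIV. (P *v axis k 1) \<bullet> (\<phi> *v (P *v axis k 1)))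
      \<le> (\<Sum>k\<in>UNIV. t * ((P *v axis k 1) \<bullet> (P *v axis k 1)))"
    by (intro sum_mono)
  also have "\<dots> = t * trace (P ** P)"
    using trace_conjugate_basis[of P "mat 1"] by (simp add: sum_distrib_left[symmetric] P idr)
  finally have "trace (P ** \<phi> ** P) \<le> t * trace (P ** P)"
    by (simp add: trace_conjugate_basis P)
  then have "trace (\<phi> ** \<phi> ** \<phi>) \<le> t * (f\<^sup>2 + s\<^sup>2 * N) + 2 * s * f\<^sup>2"
    by (simp add: PP PfP)
  \<comment> \<open>In units of f^3/q the three terms contribute N - 1, 1 and -2; the middle one
    uses q^2 = N (N - 1).\<close>
  also have "\<dots> = (N - 2) / q * f ^ 3"
  proof -
    have "t * (s\<^sup>2 * N) = f ^ 3 / q * ((N * (N - 1)) / q\<^sup>2)"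
      by (simp add: t_def s_def power2_eq_square power3_eq_cube field_simps)
    also have "\<dots> = f ^ 3 / q" using N q(2) by simp
    finally show ?thesis
      by (simp add: distrib_left) (simp add: t_def s_def power2_eq_square power3_eq_cube diff_divide_distrib algebra_simps)
  qed
  finally show ?thesis by (simp add: q_def f_def)
qed

lemma okumura:
  fixes \<phi> :: "real^'n^'n::finite"
  assumes "transpose \<phi> = \<phi>" "trace \<phi> = 0" "CARD('n) \<ge> 2"
  defines "N \<equiv> real CARD('n)"
  shows "\<bar>trace (\<phi> ** \<phi> ** \<phi>)\<bar> \<le> (N - 2) / sqrt (N * (N - 1)) * norm \<phi> ^ 3"
proof -
  have "transpose (- \<phi>) = - \<phi>" "trace (- \<phi>) = 0"
    using assms(1,2) by (simp_all add: transpose_def vec_eq_iff trace_def sum_negf)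
  from okumura_upper[OF this assms(3)] have "- trace (\<phi> ** \<phi> ** \<phi>) \<le> (N - 2) / sqrt (N * (N - 1)) * norm \<phi> ^ 3"
    by (simp add: N_def mm.minus_left mm.minus_right trace_def sum_negf)
  with okumura_upper[OF assms(1-3)] show ?thesis by (simp add: N_def abs_le_iff)
qed

section \<open>Simons' identity at a point\<close>

text \<open>\<open>F\<close> has the form of the Gauss curvature in an orthonormal frame. Expanding
  the commutator gives eight full contractions, \<open>t1\<close> to \<open>t8\<close>; two terms
  \<kappa> tr(a^2) and two terms tr(a^4) cancel.\<close>

lemma curvature_contraction:
  fixes a :: "real^'n^'n::finite" and F :: "'n \<Rightarrow> 'n \<Rightarrow> real^'n^'n"
  assumes a: "\<And>i j. a $ i $ j = a $ j $ i"
    and F: "\<And>i j k l. F i j $ k $ l = \<kappa> * ((if j = l then 1 else 0) * (if i = k then 1 else 0)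
      - (if i = l then 1 else 0) * (if j = k then 1 else 0)) - (a $ j $ l * a $ i $ k - a $ i $ l * a $ j $ k)"
  shows "(\<Sum>i\<in>UNIV. \<Sum>j\<in>UNIV. \<Sum>k\<in>UNIV. a $ j $ k * (F i j ** a - a ** F i j) $ k $ i) =
    \<kappa> * (real CARD('n) * trace (a ** a) - (trace a)\<^sup>2) + (trace (a ** a))\<^sup>2 - trace a * trace (a ** a ** a)"
proof -
  define d where "d i j = (if i = j then 1 else 0 :: real)" for i j :: 'n
  have d_sum: "(\<Sum>j\<in>UNIV. d i j * f j) = f i" "(\<Sum>j\<in>UNIV. d j i * f j) = f i" for i and f :: "'n \<Rightarrow> real"
    by (simp_all add: d_def if_distrib[of "\<lambda>z. z * _"] cong: if_cong)
  have d_sym: "d i j = d j i" for i j by (simp add: d_def)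
  define s where "s = a ** a"
  have s: "s $ i $ j = (\<Sum>k\<in>UNIV. a $ i $ k * a $ k $ j)" for i j
    by (simp add: s_def matrix_matrix_mult_def)
  have s_sym: "s $ i $ j = s $ j $ i" for i j
    unfolding s by (intro sum.cong refl) (simp add: a[of i] a[of _ j])
  have s2: "(\<Sum>k\<in>UNIV. a $ i $ k * a $ j $ k) = s $ i $ j" for i j
    unfolding s by (intro sum.cong refl) (simp add: a[of j])
  have S: "(\<Sum>i\<in>UNIV. \<Sum>j\<in>UNIV. a $ i $ j * a $ i $ j) = trace s"
    unfolding trace_def s2 ..
  have Fd: "F i j $ k $ l = \<kappa> * (d j l * d i k - d i l * d j k) - (a $ j $ l * a $ i $ k - a $ i $ l * a $ j $ k)"
    for i j k l by (simp add: F d_def)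
  have Fa: "(F i j ** a) $ k $ i = \<kappa> * (d i k * a $ j $ i - d j k * a $ i $ i)
      - (a $ i $ k * s $ j $ i - a $ j $ k * s $ i $ i)" for i j k
  proof -
    have "(F i j ** a) $ k $ i = (\<Sum>l\<in>UNIV. \<kappa> * d i k * (d j l * a $ l $ i) - \<kappa> * d j k * (d i l * a $ l $ i)
        - (a $ i $ k * (a $ j $ l * a $ l $ i) - a $ j $ k * (a $ i $ l * a $ l $ i)))"
      unfolding matrix_matrix_mult_def by (simp add: Fd algebra_simps)
    then show ?thesis
      unfolding sum_subtractf sum_distrib_left[symmetric] d_sum s[symmetric] by (simp add: algebra_simps)
  qed
  have aF: "(a ** F i j) $ k $ i = \<kappa> * (a $ k $ i * d j i - a $ k $ j) - (s $ k $ i * a $ j $ i - s $ k $ j * a $ i $ i)"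
    for i j k
  proof -
    have "(a ** F i j) $ k $ i = (\<Sum>l\<in>UNIV. \<kappa> * d j i * (d i l * a $ k $ l) - \<kappa> * d i i * (d j l * a $ k $ l)
        - (a $ j $ i * (a $ k $ l * a $ i $ l) - a $ i $ i * (a $ k $ l * a $ j $ l)))"
      unfolding matrix_matrix_mult_def by (simp add: Fd algebra_simps)
    then show ?thesis
      unfolding sum_subtractf sum_distrib_left[symmetric] d_sum s2 by (simp add: d_def algebra_simps)
  qed
  \<comment> \<open>This is tr(a^4); it enters through \<open>t3\<close> and \<open>t7\<close> with
    opposite signs.\<close>
  define \<sigma> where "\<sigma> = (\<Sum>i\<in>UNIV. \<Sum>j\<in>UNIV. s $ i $ j * s $ i $ j)"
  let ?\<Sigma> = "\<lambda>f. \<Sum>i\<in>(UNIV :: 'n set). \<Sum>j\<in>UNIV. \<Sum>k\<in>(UNIV :: 'n set). f i j k :: real"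
  have sum3_add: "?\<Sigma> (\<lambda>i j k. f i j k + g i j k) = ?\<Sigma> f + ?\<Sigma> g" for f g :: "'n \<Rightarrow> 'n \<Rightarrow> 'n \<Rightarrow> real"
    by (simp add: sum.distrib)
  have sum3_diff: "?\<Sigma> (\<lambda>i j k. f i j k - g i j k) = ?\<Sigma> f - ?\<Sigma> g" for f g :: "'n \<Rightarrow> 'n \<Rightarrow> 'n \<Rightarrow> real"
    by (simp add: sum_subtractf)
  have sum3_mult: "?\<Sigma> (\<lambda>i j k. c * f i j k) = c * ?\<Sigma> f" for c and f :: "'n \<Rightarrow> 'n \<Rightarrow> 'n \<Rightarrow> real"
    by (simp add: sum_distrib_left)
  have t1: "?\<Sigma> (\<lambda>i j k. d i k * (a $ j $ k * a $ j $ i)) = trace s"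
    unfolding d_sum by (subst sum.swap) (rule S)
  have t2: "?\<Sigma> (\<lambda>i j k. a $ i $ i * (d j k * a $ j $ k)) = (trace a)\<^sup>2"
    unfolding sum_distrib_left[symmetric] d_sum sum_distrib_right[symmetric]
    by (simp add: trace_def power2_eq_square)
  have t3: "?\<Sigma> (\<lambda>i j k. s $ j $ i * (a $ j $ k * a $ i $ k)) = \<sigma>"
    unfolding sum_distrib_left[symmetric] s2 \<sigma>_def by (rule sum.swap)
  have t4: "?\<Sigma> (\<lambda>i j k. s $ i $ i * (a $ j $ k * a $ j $ k)) = (trace s)\<^sup>2"
    unfolding sum_distrib_left[symmetric] S sum_distrib_right[symmetric]
    by (simp add: trace_def power2_eq_square)
  have t5: "?\<Sigma> (\<lambda>i j k. d j i * (a $ j $ k * a $ k $ i)) = trace s"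
    unfolding sum_distrib_left[symmetric] s[symmetric] d_sum by (simp add: trace_def)
  have t6: "?\<Sigma> (\<lambda>i j k. a $ j $ k * a $ k $ j) = real CARD('n) * trace s"
    unfolding s[symmetric] by (simp add: trace_def)
  have t7: "?\<Sigma> (\<lambda>i j k. (a $ j $ k * a $ j $ i) * s $ k $ i) = \<sigma>"
  proof -
    have "?\<Sigma> (\<lambda>i j k. (a $ j $ k * a $ j $ i) * s $ k $ i)
        = (\<Sum>i\<in>UNIV. \<Sum>k\<in>UNIV. \<Sum>j\<in>UNIV. (a $ k $ j * a $ j $ i) * s $ k $ i)"
      by (subst (2) sum.swap) (simp only: a[of _ "_ :: 'n"] refl)
    also have "\<dots> = (\<Sum>i\<in>UNIV. \<Sum>k\<in>UNIV. s $ k $ i * s $ k $ i)"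
      unfolding sum_distrib_right[symmetric] s[symmetric] ..
    finally show ?thesis unfolding \<sigma>_def by (subst sum.swap)
  qed
  have t8: "?\<Sigma> (\<lambda>i j k. a $ i $ i * (s $ k $ j * a $ j $ k)) = trace a * trace (a ** a ** a)"
  proof -
    have "(\<Sum>j\<in>UNIV. \<Sum>k\<in>UNIV. s $ k $ j * a $ j $ k) = trace (s ** a)"
      unfolding trace_def matrix_matrix_mult_def by (subst sum.swap) simp
    then show ?thesis
      unfolding sum_distrib_left[symmetric] sum_distrib_right[symmetric]
      by (simp add: trace_def s_def)
  qed
  have "(\<Sum>i\<in>UNIV. \<Sum>j\<in>UNIV. \<Sum>k\<in>UNIV. a $ j $ k * (F i j ** a - a ** F i j) $ k $ i) =
    ?\<Sigma> (\<lambda>i j k. \<kappa> * (d i k * (a $ j $ k * a $ j $ i)) - \<kappa> * (a $ i $ i * (d j k * a $ j $ k))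
      - s $ j $ i * (a $ j $ k * a $ i $ k) + s $ i $ i * (a $ j $ k * a $ j $ k)
      - \<kappa> * (d j i * (a $ j $ k * a $ k $ i)) + \<kappa> * (a $ j $ k * a $ k $ j)
      + (a $ j $ k * a $ j $ i) * s $ k $ i - a $ i $ i * (s $ k $ j * a $ j $ k))"
    unfolding vector_minus_component Fa aF by (intro sum.cong refl) (simp add: algebra_simps)
  also have "\<dots> = \<kappa> * trace s - \<kappa> * (trace a)\<^sup>2 - \<sigma> + (trace s)\<^sup>2 - \<kappa> * trace s
      + \<kappa> * (real CARD('n) * trace s) + \<sigma> - trace a * trace (a ** a ** a)"
    unfolding sum3_add sum3_diff sum3_mult t1 t2 t3 t4 t5 t6 t7 t8 ..
  finally show ?thesis by (simp add: s_def algebra_simps)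
qed

text \<open>Codazzi brings the outer derivative index next to a contracted one, the commutator
  exchanges the two derivatives at the price of curvature, and Codazzi with symmetry moves both
  contracted indices onto \<open>a\<close>. The rough Laplacian of \<open>a\<close> thus becomes the
  Hessian of its trace plus the terms of \<open>curvature_contraction\<close>.\<close>

lemma simons_identity:
  fixes a :: "real^'n^'n::finite" and F c :: "'n \<Rightarrow> 'n \<Rightarrow> real^'n^'n"
  assumes a: "\<And>i j. a $ i $ j = a $ j $ i"
    and F: "\<And>i j k l. F i j $ k $ l = \<kappa> * ((if j = l then 1 else 0) * (if i = k then 1 else 0)
      - (if i = l then 1 else 0) * (if j = k then 1 else 0)) - (a $ j $ l * a $ i $ k - a $ i $ l * a $ j $ k)"
    and c_codazzi: "\<And>i j k l. c i j $ k $ l = c i l $ k $ j"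
    and c_sym: "\<And>i j k l. c i j $ k $ l = c i j $ l $ k"
    and c_commutator: "\<And>i j. c i j - c j i = F i j ** a - a ** F i j"
  shows "(\<Sum>i\<in>UNIV. trace (a ** c i i)) = (\<Sum>i\<in>UNIV. \<Sum>j\<in>UNIV. a $ i $ j * trace (c i j))
    + \<kappa> * (real CARD('n) * trace (a ** a) - (trace a)\<^sup>2) + (trace (a ** a))\<^sup>2
    - trace a * trace (a ** a ** a)"
proof -
  have swap: "c i i $ k $ j = c j k $ i $ i + (F i j ** a - a ** F i j) $ k $ i" for i j k
  proof -
    have "c i i $ k $ j = c i j $ k $ i" by (rule c_codazzi)
    also have "\<dots> = c j i $ k $ i + (F i j ** a - a ** F i j) $ k $ i"
      using c_commutator[of i j] by (metis add_diff_cancel_left' diff_add_cancel vector_add_component add.commute)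
    also have "c j i $ k $ i = c j k $ i $ i"
      using c_sym[of j i k i] c_codazzi[of j i i k] by simp
    finally show ?thesis .
  qed
  have "(\<Sum>i\<in>UNIV. trace (a ** c i i)) = (\<Sum>i\<in>UNIV. \<Sum>j\<in>UNIV. \<Sum>k\<in>UNIV. a $ j $ k * c i i $ k $ j)"
    by (simp add: trace_def matrix_matrix_mult_def)
  also have "\<dots> = (\<Sum>i\<in>UNIV. \<Sum>j\<in>UNIV. \<Sum>k\<in>UNIV. a $ j $ k * c j k $ i $ i)
      + (\<Sum>i\<in>UNIV. \<Sum>j\<in>UNIV. \<Sum>k\<in>UNIV. a $ j $ k * (F i j ** a - a ** F i j) $ k $ i)"
    unfolding swap distrib_left sum.distrib ..
  also have "(\<Sum>i\<in>UNIV. \<Sum>j\<in>UNIV. \<Sum>k\<in>UNIV. a $ j $ k * c j k $ i $ i) =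
      (\<Sum>j\<in>UNIV. \<Sum>k\<in>UNIV. a $ j $ k * trace (c j k))"
  proof -
    have "(\<Sum>i\<in>UNIV. \<Sum>j\<in>UNIV. \<Sum>k\<in>UNIV. a $ j $ k * c j k $ i $ i) =
        (\<Sum>j\<in>UNIV. \<Sum>i\<in>UNIV. \<Sum>k\<in>UNIV. a $ j $ k * c j k $ i $ i)"
      by (rule sum.swap)
    also have "\<dots> = (\<Sum>j\<in>UNIV. \<Sum>k\<in>UNIV. \<Sum>i\<in>UNIV. a $ j $ k * c j k $ i $ i)"
      by (rule sum.cong[OF refl], rule sum.swap)
    finally show ?thesis by (simp add: trace_def sum_distrib_left)
  qed
  finally show ?thesis unfolding curvature_contraction[OF a F] by simp
qed


text \<open>The left side is box(nH) and the first sum on the right is -1/2 Laplacian(n(n-1)R), both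
  at a point. Their difference is the slack of \<open>gradient\<close> plus the curvature terms of
  Simons' identity, to be bounded below by the last summand.\<close>

lemma pinching_inequality:
  fixes a :: "real^'n^'n::finite" and b :: "'n \<Rightarrow> real^'n^'n" and F c :: "'n \<Rightarrow> 'n \<Rightarrow> real^'n^'n"
  defines "N \<equiv> real CARD('n)"
  assumes n: "CARD('n) \<ge> 2"
    and a: "\<And>i j. a $ i $ j = a $ j $ i"
    and F: "\<And>i j k l. F i j $ k $ l = \<kappa> * ((if j = l then 1 else 0) * (if i = k then 1 else 0)
      - (if i = l then 1 else 0) * (if j = k then 1 else 0)) - (a $ j $ l * a $ i $ k - a $ i $ l * a $ j $ k)"
    and c_codazzi: "\<And>i j k l. c i j $ k $ l = c i l $ k $ j"
    and c_sym: "\<And>i j k l. c i j $ k $ l = c i j $ l $ k"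
    and c_commutator: "\<And>i j. c i j - c j i = F i j ** a - a ** F i j"
    and c0: "c0 \<le> \<kappa>"
    and gradient: "(\<Sum>i\<in>UNIV. (trace (b i))\<^sup>2) \<le> (\<Sum>i\<in>UNIV. trace (b i ** b i))"
    and H: "trace a = N * H"
    and f: "f \<ge> 0" "f\<^sup>2 = trace (a ** a) - N * H\<^sup>2"
  shows "(\<Sum>i\<in>UNIV. \<Sum>j\<in>UNIV. (N * H * (if i = j then 1 else 0) - a $ i $ j) * trace (c i j)) \<ge>
    (\<Sum>i\<in>UNIV. (trace (b i))\<^sup>2 + N * H * trace (c i i) - trace (b i ** b i) - trace (a ** c i i))
    + f\<^sup>2 * L_poly N c0 \<bar>H\<bar> f"
proof -
  have N: "N \<ge> 2" using n by (simp add: N_def)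
  define \<phi> where "\<phi> = a - H *\<^sub>R mat 1"
  have a_sym: "transpose a = a" using a by (simp add: vec_eq_iff transpose_nth)
  have idl: "mat 1 ** M = M" and idr: "M ** mat 1 = M" for M :: "real^'n^'n" by simp_all
  have \<phi>_sym: "transpose \<phi> = \<phi>" by (simp add: \<phi>_def transpose_diff transpose_scalar a_sym)
  have \<phi>_tr: "trace \<phi> = 0" by (simp add: \<phi>_def trace_sub trace_scaleR trace_I H N_def)
  have \<phi>2: "trace (\<phi> ** \<phi>) = f\<^sup>2"
    unfolding \<phi>_def
    by (simp only: mm.diff_left mm.diff_right mm.scaleR_left mm.scaleR_right idl idr trace_sub
        trace_scaleR trace_I H f(2)) (simp add: N_def power2_eq_square)
  have \<phi>3: "trace (\<phi> ** \<phi> ** \<phi>) = trace (a ** a ** a) - 3 * H * (f\<^sup>2 + N * H\<^sup>2) + 2 * N * H ^ 3"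
  proof -
    have "trace (a ** a) = f\<^sup>2 + N * H\<^sup>2" using f(2) by simp
    then show ?thesis
      unfolding \<phi>_def
      by (simp only: mm.diff_left mm.diff_right mm.scaleR_left mm.scaleR_right idl idr trace_sub
          trace_scaleR trace_I H) (simp add: N_def[symmetric] power2_eq_square power3_eq_cube algebra_simps)
  qed
  have norm_\<phi>: "norm \<phi> = f"
  proof -
    have "(norm \<phi>)\<^sup>2 = f\<^sup>2"
      using inner_matrix_trace[of \<phi> \<phi>] by (simp add: \<phi>_sym \<phi>2 power2_norm_eq_inner)
    then show ?thesis using f(1) by (simp add: power2_eq_iff_nonneg)
  qed
  define q where "q = sqrt (N * (N - 1))"
  have "\<bar>H * trace (\<phi> ** \<phi> ** \<phi>)\<bar> \<le> \<bar>H\<bar> * ((N - 2) / q * f ^ 3)"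
    unfolding abs_mult using okumura[OF \<phi>_sym \<phi>_tr n]
    by (intro mult_left_mono) (simp_all add: norm_\<phi> q_def N_def)
  then have "N * (H * trace (\<phi> ** \<phi> ** \<phi>)) \<le> N * (\<bar>H\<bar> * ((N - 2) / q * f ^ 3))"
    using N by (intro mult_left_mono) auto
  moreover have "N * c0 * f\<^sup>2 \<le> N * \<kappa> * f\<^sup>2"
    using N c0 by (intro mult_right_mono mult_left_mono) auto
  moreover have "f\<^sup>2 * L_poly N c0 \<bar>H\<bar> f =
      f ^ 4 - N * (\<bar>H\<bar> * ((N - 2) / q * f ^ 3)) + N * c0 * f\<^sup>2 - N * H\<^sup>2 * f\<^sup>2"
    by (simp add: L_poly_def q_def power2_eq_square power3_eq_cube power4_eq_xxxx algebra_simps)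
  \<comment> \<open>Rewriting the curvature terms by the traceless part leaves the trace of its cube
    as the only quantity that is not a polynomial in \<open>f\<close> and \<open>H\<close>;
    Okumura's bound applies to it.\<close>
  moreover have "\<kappa> * (N * trace (a ** a) - (trace a)\<^sup>2) + (trace (a ** a))\<^sup>2 - trace a * trace (a ** a ** a)
      = f ^ 4 - N * (H * trace (\<phi> ** \<phi> ** \<phi>)) + N * \<kappa> * f\<^sup>2 - N * H\<^sup>2 * f\<^sup>2"
  proof -
    have "trace (a ** a) = f\<^sup>2 + N * H\<^sup>2" using f(2) by simp
    moreover have "trace (a ** a ** a) = trace (\<phi> ** \<phi> ** \<phi>) + 3 * H * (f\<^sup>2 + N * H\<^sup>2) - 2 * N * H ^ 3"
      using \<phi>3 by simp
    ultimately show ?thesis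
      by (simp add: H power2_eq_square power3_eq_cube power4_eq_xxxx algebra_simps)
  qed
  moreover have "(\<Sum>i\<in>UNIV. \<Sum>j\<in>UNIV. (N * H * (if i = j then 1 else 0) - a $ i $ j) * trace (c i j)) =
      N * H * (\<Sum>i\<in>UNIV. trace (c i i)) - (\<Sum>i\<in>UNIV. \<Sum>j\<in>UNIV. a $ i $ j * trace (c i j))"
  proof -
    have "(N * H * (if i = j then 1 else 0) - a $ i $ j) * trace (c i j) =
        (if i = j then N * H * trace (c i i) else 0) - a $ i $ j * trace (c i j)" for i j
      by (simp add: algebra_simps)
    then show ?thesis by (simp add: sum_subtractf sum_distrib_left)
  qed
  moreover have "(\<Sum>i\<in>UNIV. (trace (b i))\<^sup>2 + N * H * trace (c i i) - trace (b i ** b i) - trace (a ** c i i))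
      = (\<Sum>i\<in>UNIV. (trace (b i))\<^sup>2) + N * H * (\<Sum>i\<in>UNIV. trace (c i i))
        - (\<Sum>i\<in>UNIV. trace (b i ** b i)) - (\<Sum>i\<in>UNIV. trace (a ** c i i))"
    by (simp add: sum.distrib sum_subtractf sum_distrib_left)
  ultimately show ?thesis
    using gradient simons_identity[of a F \<kappa> c, OF a F c_codazzi c_sym c_commutator]
    unfolding N_def[symmetric] by linarith
qed

lemma trace_mult_bound:
  fixes a b :: "real^'n^'n::finite"
  assumes "transpose a = a" "transpose b = b"
  shows "(trace (a ** b))\<^sup>2 \<le> trace (a ** a) * trace (b ** b)"
  using Cauchy_Schwarz_ineq[of a b] assms by (simp add: inner_matrix_trace)

text \<open>The linear relation between \<open>P\<close> and \<open>H\<close> reads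
  \<open>(trace A)\<^sup>2 - trace (A\<^sup>2) + (N - 1) \<alpha> trace A = N (N - 1) \<beta>\<close>; its first and second derivatives are the
  hypotheses \<open>first\<close> and \<open>second\<close>. The second one is only needed at points where \<open>A\<close> vanishes.\<close>
lemma gradient_inequality:
  fixes a :: "real^'n^'n::finite" and b :: "'n \<Rightarrow> real^'n^'n" and c :: "'n \<Rightarrow> real^'n^'n"
  defines "N \<equiv> real CARD('n)"
  assumes n: "CARD('n) \<ge> 2"
    and a: "transpose a = a" and b: "\<And>i. transpose (b i) = b i"
    and relation: "(trace a)\<^sup>2 - trace (a ** a) + (N - 1) * \<alpha> * trace a = N * (N - 1) * \<beta>"
    and nonneg: "(N - 1) * \<alpha>\<^sup>2 + 4 * N * \<beta> \<ge> 0"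
    and first: "\<And>i. (2 * trace a + (N - 1) * \<alpha>) * trace (b i) = 2 * trace (a ** b i)"
    and second: "\<And>i. 2 * (trace (b i))\<^sup>2 + (2 * trace a + (N - 1) * \<alpha>) * trace (c i)
      - 2 * (trace (b i ** b i) + trace (a ** c i)) = 0"
  shows "(\<Sum>i\<in>UNIV. (trace (b i))\<^sup>2) \<le> (\<Sum>i\<in>UNIV. trace (b i ** b i))"
proof -
  have N: "N \<ge> 2" using n by (simp add: N_def)
  let ?m = "2 * trace a + (N - 1) * \<alpha>" and ?S = "trace (a ** a)"
  have bb: "trace (b i ** b i) \<ge> 0" for i
    using inner_ge_zero[of "b i"] by (simp add: inner_matrix_trace b)
  have S: "?S = (norm a)\<^sup>2" by (simp add: power2_norm_eq_inner inner_matrix_trace a)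
  \<comment> \<open>Completing the square in \<open>relation\<close>; the remainder is a nonnegative
    multiple of the expression in \<open>nonneg\<close>, which is why exactly that condition on
    \<alpha> and \<beta> is imposed.\<close>
  have "?m\<^sup>2 = 4 * ?S + (N - 1) * ((N - 1) * \<alpha>\<^sup>2 + 4 * N * \<beta>)"
    using relation by (simp add: power2_eq_square algebra_simps)
  then have m: "?m\<^sup>2 \<ge> 4 * ?S" using nonneg N by simp
  have pointwise: "?m\<^sup>2 * (trace (b i))\<^sup>2 \<le> 4 * (?S * trace (b i ** b i))" for i
  proof -
    have "?m\<^sup>2 * (trace (b i))\<^sup>2 = 4 * (trace (a ** b i))\<^sup>2"
      using first[of i] by (metis power_mult_distrib power2_eq_square mult_2 numeral_Bit0 four_x_squared)
    then show ?thesis using trace_mult_bound[OF a b, of i] by simp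
  qed
  show ?thesis
  proof (cases "?S = 0")
    case False
    then have "?S > 0" unfolding S by simp
    show ?thesis
    proof (rule sum_mono)
      fix i
      have "4 * ?S * (trace (b i))\<^sup>2 \<le> ?m\<^sup>2 * (trace (b i))\<^sup>2"
        by (rule mult_right_mono[OF m]) simp
      with pointwise[of i] have "?S * (trace (b i))\<^sup>2 \<le> ?S * trace (b i ** b i)" by simp
      with \<open>?S > 0\<close> show "(trace (b i))\<^sup>2 \<le> trace (b i ** b i)" by simp
    qed
  next
    case True
    then have "a = 0" unfolding S by simp
    then have a0: "trace a = 0" "trace (a ** M) = 0" for M
      by (simp_all add: trace_def mm.zero_left)
    show ?thesis
    proof (rule sum_mono)
      fix i
      show "(trace (b i))\<^sup>2 \<le> trace (b i ** b i)"
      \<comment> \<open>At a zero of \<open>a\<close> the first derivative of the relation says (N -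
        1) \<alpha> tr(b i) = 0. For \<alpha> = 0 this is empty, but then the second derivative
        gives equality of the two sides.\<close>
      proof (cases "\<alpha> = 0")
        case True
        then show ?thesis using second[of i] by (simp add: a0)
      next
        case False
        then have "trace (b i) = 0" using first[of i] N by (simp add: a0)
        then show ?thesis using bb by simp
      qed
    qed
  qed
qed

section \<open>Orthonormal frames\<close>

text \<open>The frame grows by one vector at a time. The map \<open>f\<close> taking products with
  the vectors already chosen never has a nonzero component at the new index \<open>i\<close>, so it
  is not surjective, hence not injective, and a normalised kernel vector extends the frame.\<close>

lemma orthonormal_frame_exists:
  fixes G :: "real^'n^'n::finite"
  assumes pos: "positive_definite G" and sym: "transpose G = G"
  shows "\<exists>e. orthonormal_frame G e"
proof -
  have "\<exists>e :: 'n \<Rightarrow> real^'n. \<forall>i\<in>I. \<forall>j\<in>I. ip G (e i) (e j) = (if i = j then 1 else 0)" for I :: "'n set"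
  proof (induction I rule: finite_induct[OF finite])
    case (2 i I)
    then obtain e :: "'n \<Rightarrow> real^'n" where e: "\<And>i j. i \<in> I \<Longrightarrow> j \<in> I \<Longrightarrow> ip G (e i) (e j) = (if i = j then 1 else 0)"
      by blast
    define f where "f u = (\<chi> j. if j \<in> I then ip G (e j) u else 0)" for u
    have lin: "linear f"
      by (rule linearI) (auto simp: f_def vec_eq_iff ip.add_right ip.scaleR_right)
    have "f u \<noteq> axis i 1" for u
    proof
      assume "f u = axis i 1"
      then have "f u $ i = axis i 1 $ i" by (rule arg_cong)
      with \<open>i \<notin> I\<close> show False by (simp add: f_def axis_def)
    qed
    then have "\<not> surj f" by (metis surjD)
    then have "\<not> inj f" using linear_injective_imp_surjective[OF lin] by blast
    then obtain v where v: "f v = 0" "v \<noteq> 0" using linear_injective_0[OF lin] by blast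
    have orth: "ip G (e j) v = 0" if "j \<in> I" for j
    proof -
      have "f v $ j = 0" by (simp add: v(1))
      then show ?thesis using that by (simp add: f_def)
    qed
    have vv: "ip G v v > 0" using pos v(2) by (simp add: positive_definite_def)
    define w where "w = (1 / sqrt (ip G v v)) *\<^sub>R v"
    have w: "ip G w w = 1" "\<And>j. j \<in> I \<Longrightarrow> ip G (e j) w = 0" "\<And>j. j \<in> I \<Longrightarrow> ip G w (e j) = 0"
      using vv orth ip_commute[OF sym] by (simp_all add: w_def ip.scaleR_left ip.scaleR_right)
    show ?case
      by (rule exI[of _ "e(i := w)"]) (use w e \<open>i \<notin> I\<close> in auto)
  qed simp
  from this[of UNIV] show ?thesis by (simp add: orthonormal_frame_def)
qed

lemma on_frame_orthonormal:
  "positive_definite G \<Longrightarrow> transpose G = G \<Longrightarrow> orthonormal_frame G (on_frame G)"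
  unfolding on_frame_def by (rule someI_ex[OF orthonormal_frame_exists])

locale frame =
  fixes G :: "real^'n^'n::finite" and e :: "'n \<Rightarrow> real^'n"
  assumes sym: "transpose G = G" and orthonormal: "orthonormal_frame G e"
begin

definition E :: "real^'n^'n" where "E = (\<chi> k i. e i $ k)"

definition E' :: "real^'n^'n" where "E' = transpose E ** G"

text \<open>\<open>E'\<close> is the inverse of \<open>E\<close>, so \<open>hat Q\<close> is the matrix of \<open>Q\<close> in the frame. In \<open>dir1\<close>
  and \<open>dir2\<close> the covariant indices of the family \<open>M\<close> are evaluated on the frame as well.\<close>
definition hat :: "real^'n^'n \<Rightarrow> real^'n^'n" where "hat Q = E' ** Q ** E"

definition dir1 :: "('n \<Rightarrow> real^'n^'n) \<Rightarrow> 'n \<Rightarrow> real^'n^'n" where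
  "dir1 M i = (\<Sum>k\<in>UNIV. e i $ k *\<^sub>R hat (M k))"

definition dir2 :: "('n \<Rightarrow> 'n \<Rightarrow> real^'n^'n) \<Rightarrow> 'n \<Rightarrow> 'n \<Rightarrow> real^'n^'n" where
  "dir2 M i j = (\<Sum>k\<in>UNIV. \<Sum>l\<in>UNIV. (e i $ k * e j $ l) *\<^sub>R hat (M k l))"

lemma E_axis: "E *v axis j 1 = e j"
  by (simp add: E_def matrix_vector_mult_basis column_def)

lemma hat_entry: "hat Q $ i $ j = ip G (e i) (Q *v e j)"
proof -
  have "hat Q $ i $ j = ip (transpose E ** (G ** Q) ** E) (axis i 1) (axis j 1)"
    by (simp add: ip_axis hat_def E'_def matrix_mul_assoc)
  also have "\<dots> = ip (G ** Q) (E *v axis i 1) (E *v axis j 1)"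
    by (simp only: ip_matrix_left ip_matrix_right matrix_mul_assoc)
  finally show ?thesis by (simp only: E_axis ip_matrix_right)
qed

lemma E'_E: "E' ** E = mat 1"
proof -
  have "E' ** E = hat (mat 1)" by (simp add: hat_def)
  moreover have "hat (mat 1) $ i $ j = (if i = j then 1 else 0)" for i j
    unfolding hat_entry matrix_vector_mul_lid using orthonormal by (simp add: orthonormal_frame_def)
  ultimately have "(E' ** E) $ i $ j = (mat 1 :: real^'n^'n) $ i $ j" for i j
    by (simp add: mat_def)
  then show ?thesis by (simp add: vec_eq_iff)
qed

lemma E_E': "E ** E' = mat 1"
  using E'_E matrix_left_right_inverse by blast

lemma hat_mult: "hat (P ** Q) = hat P ** hat Q"
proof -
  have "hat P ** hat Q = E' ** P ** (E ** E') ** Q ** E"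
    by (simp add: hat_def matrix_mul_assoc)
  then show ?thesis by (simp add: E_E' hat_def matrix_mul_assoc)
qed

lemma trace_hat: "trace (hat Q) = trace Q"
proof -
  have "trace (hat Q) = trace (E ** (E' ** Q))"
    unfolding hat_def by (rule trace_mul_sym)
  then show ?thesis by (simp add: matrix_mul_assoc E_E')
qed

lemma hat_diff: "hat (P - Q) = hat P - hat Q"
  by (simp add: hat_def mm.diff_left mm.diff_right)

lemma hat_sym:
  assumes "transpose (G ** Q) = G ** Q"
  shows "transpose (hat Q) = hat Q"
proof -
  have "hat Q = transpose E ** (G ** Q) ** E" by (simp add: hat_def E'_def matrix_mul_assoc)
  moreover have "transpose (transpose E ** K ** E) = transpose E ** K ** E"
    if "transpose K = K" for K
    by (simp add: matrix_transpose_mul that matrix_mul_assoc)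
  ultimately show ?thesis using assms by simp
qed

lemma dir1_sym: "(\<And>k. transpose (G ** M k) = G ** M k) \<Longrightarrow> transpose (dir1 M i) = dir1 M i"
  by (simp add: dir1_def transpose_sum_scaleR hat_sym)

lemma dir2_sym:
  assumes "\<And>k l. transpose (G ** M k l) = G ** M k l"
  shows "transpose (dir2 M i j) = dir2 M i j"
proof -
  have "transpose (\<Sum>k\<in>I. T k) = (\<Sum>k\<in>I. transpose (T k))" for I :: "'n set" and T :: "'n \<Rightarrow> real^'n^'n"
    using transpose_sum_scaleR[of "\<lambda>_. 1" T I] by simp
  then show ?thesis by (simp add: dir2_def transpose_sum_scaleR hat_sym[OF assms])
qed

text \<open>The second family index and the column index are both covariant and are evaluated on the
  same frame vectors, so their exchange survives; the row index is transformed separately by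
  \<open>E'\<close>.\<close>

lemma dir2_codazzi:
  assumes "\<And>k l r s. M k l $ r $ s = M k s $ r $ l"
  shows "dir2 M i j $ r $ s = dir2 M i s $ r $ j"
proof -
  have entry: "dir2 M i j $ r $ s =
      (\<Sum>k\<in>UNIV. \<Sum>l\<in>UNIV. \<Sum>v\<in>UNIV. \<Sum>u\<in>UNIV. e i $ k * e j $ l * e s $ v * E' $ r $ u * M k l $ u $ v)"
    for j s
    by (simp add: dir2_def hat_def matrix_matrix_mult_def E_def sum_distrib_left sum_distrib_right mult_ac)
  show ?thesis
    unfolding entry
    by (rule sum.cong[OF refl], subst sum.swap) (simp add: assms[of _ _ _ "_ :: 'n"] mult_ac)
qed

lemma dir2_commutator:
  assumes "\<And>k l. M k l - M l k = F k l ** Q - Q ** F k l"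
  shows "dir2 M i j - dir2 M j i = dir2 F i j ** hat Q - hat Q ** dir2 F i j"
proof -
  have "dir2 M j i = (\<Sum>k\<in>UNIV. \<Sum>l\<in>UNIV. (e i $ k * e j $ l) *\<^sub>R hat (M l k))"
    unfolding dir2_def by (subst sum.swap) (simp add: mult.commute)
  then have "dir2 M i j - dir2 M j i =
      (\<Sum>k\<in>UNIV. \<Sum>l\<in>UNIV. (e i $ k * e j $ l) *\<^sub>R hat (M k l - M l k))"
    by (simp add: dir2_def sum_subtractf hat_diff scaleR_diff_right)
  then show ?thesis
    by (simp add: assms dir2_def hat_diff hat_mult mm.sum_left mm.sum_right mm.scaleR_left
        mm.scaleR_right sum_subtractf scaleR_diff_right)
qed

lemma trace_dir1: "trace (dir1 M i) = (\<Sum>k\<in>UNIV. e i $ k * trace (M k))"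
  by (simp add: dir1_def trace_sum_scaleR trace_hat)

lemma trace_dir2: "trace (dir2 M i j) = (\<Sum>k\<in>UNIV. \<Sum>l\<in>UNIV. e i $ k * e j $ l * trace (M k l))"
proof -
  have "trace (\<Sum>k\<in>I. T k) = (\<Sum>k\<in>I. trace (T k))" for I :: "'n set" and T :: "'n \<Rightarrow> real^'n^'n"
    using trace_sum_scaleR[of "\<lambda>_. 1" T I] by simp
  then show ?thesis by (simp add: dir2_def trace_sum_scaleR trace_hat)
qed

lemma trace_dir1_dir1:
  "trace (dir1 M i ** dir1 M j) = (\<Sum>k\<in>UNIV. \<Sum>l\<in>UNIV. e i $ k * e j $ l * trace (M k ** M l))"
proof -
  have "dir1 M i ** dir1 M j = dir2 (\<lambda>k l. M k ** M l) i j"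
    by (simp add: dir1_def dir2_def mm.sum_left mm.sum_right mm.scaleR_left mm.scaleR_right
        hat_mult scaleR_sum_right) (subst sum.swap, simp add: mult.commute)
  then show ?thesis by (simp add: trace_dir2)
qed

lemma trace_hat_dir1:
  "trace (hat Q ** dir1 M i) = (\<Sum>k\<in>UNIV. e i $ k * trace (Q ** M k))"
proof -
  have "hat Q ** dir1 M i = dir1 (\<lambda>k. Q ** M k) i"
    by (simp add: dir1_def mm.sum_right mm.scaleR_right hat_mult)
  then show ?thesis by (simp add: trace_dir1)
qed

lemma trace_hat_dir2:
  "trace (hat Q ** dir2 M i j) = (\<Sum>k\<in>UNIV. \<Sum>l\<in>UNIV. e i $ k * e j $ l * trace (Q ** M k l))"
proof -
  have "hat Q ** dir2 M i j = dir2 (\<lambda>k l. Q ** M k l) i j"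
    by (simp add: dir2_def mm.sum_right mm.scaleR_right hat_mult)
  then show ?thesis by (simp add: trace_dir2)
qed

end


section \<open>The inequality in a coordinate patch\<close>

context hypersurface_patch
begin

lemma frame_at: "y \<in> V \<Longrightarrow> frame (G y) (on_frame (G y))"
  by (simp add: frame_def intrinsic.G_sym on_frame_orthonormal[OF G_pos])

lemma curv_op_gauss:
  assumes y: "y \<in> V"
  shows "curv_op G y u v w = \<kappa> *\<^sub>R (ip (G y) v w *\<^sub>R u - ip (G y) u w *\<^sub>R v)
    - (ip (h y) v w *\<^sub>R (A y *v u) - ip (h y) u w *\<^sub>R (A y *v v))"
proof -
  let ?\<Sigma> = "\<lambda>f. \<Sum>i\<in>UNIV. \<Sum>j\<in>UNIV. \<Sum>k\<in>(UNIV :: 'n set). f i j k :: real"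
  have s1: "?\<Sigma> (\<lambda>i j k. f i * (p $ j * K $ j $ k * q $ k)) = sum f UNIV * ip K p q"
    for f :: "'n \<Rightarrow> real" and p q :: "real^'n" and K :: "real^'n^'n"
    by (simp add: ip_sum_components sum_distrib_left[symmetric] sum_distrib_right[symmetric])
  have s2: "?\<Sigma> (\<lambda>i j k. f j * (p $ i * K $ i $ k * q $ k)) = sum f UNIV * ip K p q"
    for f :: "'n \<Rightarrow> real" and p q :: "real^'n" and K :: "real^'n^'n"
    by (subst sum.swap) (rule s1)
  have "curv_op G y u v w $ l = (\<kappa> *\<^sub>R (ip (G y) v w *\<^sub>R u - ip (G y) u w *\<^sub>R v)
    - (ip (h y) v w *\<^sub>R (A y *v u) - ip (h y) u w *\<^sub>R (A y *v v))) $ l" for l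
  proof -
    have "curv_op G y u v w $ l = ?\<Sigma> (\<lambda>i j k. curv_matrix G i j y $ l $ k * u $ i * v $ j * w $ k)"
      by (simp add: curv_op_def curv_matrix_def)
    also have "\<dots> = ?\<Sigma> (\<lambda>i j k.
        \<kappa> * (((if l = i then 1 else 0) * u $ i) * (v $ j * G y $ j $ k * w $ k))
        - \<kappa> * (((if l = j then 1 else 0) * v $ j) * (u $ i * G y $ i $ k * w $ k))
        - ((A y $ l $ i * u $ i) * (v $ j * h y $ j $ k * w $ k)
        - (A y $ l $ j * v $ j) * (u $ i * h y $ i $ k * w $ k)))"
      unfolding gauss_equation[OF y] by (intro sum.cong refl) (simp add: algebra_simps)
    also have "\<dots> = \<kappa> * (u $ l * ip (G y) v w) - \<kappa> * (v $ l * ip (G y) u w)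
        - ((A y *v u) $ l * ip (h y) v w - (A y *v v) $ l * ip (h y) u w)"
    proof -
      have "(\<Sum>i\<in>UNIV. (if l = i then 1 else 0) * p $ i) = p $ l" for p :: "real^'n"
        by (simp add: if_distrib[of "\<lambda>z. z * _"] cong: if_cong)
      then show ?thesis
        by (simp only: sum_subtractf sum_distrib_left[symmetric, of \<kappa>] s1 s2 matrix_vector_mult_def
            vec_lambda_beta)
    qed
    finally show ?thesis by (simp add: algebra_simps)
  qed
  then show ?thesis by (simp add: vec_eq_iff)
qed

text \<open>It turns the sums over the chosen frame into traces of powers of \<open>A\<close>, which
  are independent of the choice and smooth in the point.\<close>

lemma frame_comp_h:
  assumes y: "y \<in> V"
  shows "frame_comp (G y) (h y) i j = frame.hat (G y) (on_frame (G y)) (A y) $ i $ j"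
proof -
  interpret fr: frame "G y" "on_frame (G y)" by (rule frame_at[OF y])
  show ?thesis by (simp add: fr.hat_entry ip_matrix_right G_A[OF y] frame_comp_def)
qed

lemma
  assumes y: "y \<in> V"
  shows mean_curvature_eq: "mean_curvature G h y = trace (A y) / real CARD('n)"
    and sff_squared_length_eq: "sff_squared_length G h y = trace (A y ** A y)"
    and scalar_curvature_eq: "scalar_curvature G y =
      \<kappa> * (real CARD('n) * (real CARD('n) - 1)) - (trace (A y))\<^sup>2 + trace (A y ** A y)"
proof -
  interpret fr: frame "G y" "on_frame (G y)" by (rule frame_at[OF y])
  let ?e = "on_frame (G y)"
  define a where "a = fr.hat (A y)"
  have a: "a $ i $ j = a $ j $ i" for i j
    using fr.hat_sym[OF A_selfadjoint[OF y]] transpose_nth[of a j i] by (simp add: a_def)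
  have tr: "trace a = trace (A y)" "trace (a ** a) = trace (A y ** A y)"
    by (simp_all add: a_def fr.hat_mult[symmetric] fr.trace_hat)
  have sq: "trace (a ** a) = (\<Sum>i\<in>UNIV. \<Sum>j\<in>UNIV. a $ i $ j * a $ i $ j)"
    unfolding trace_def matrix_matrix_mult_def by (simp add: a[of _ "_ :: 'n"])
  show "mean_curvature G h y = trace (A y) / real CARD('n)"
    by (simp add: mean_curvature_def frame_comp_h[OF y] a_def[symmetric] tr(1)[symmetric] trace_def[of a])
  show "sff_squared_length G h y = trace (A y ** A y)"
    by (simp add: sff_squared_length_def frame_comp_h[OF y] a_def[symmetric] tr(2)[symmetric] sq
        power2_eq_square)
  have hh: "ip (h y) (?e i) (?e j) = a $ i $ j" for i j
    using frame_comp_h[OF y, of i j] by (simp add: frame_comp_def a_def)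
  have GG: "ip (G y) (?e i) (?e j) = (if i = j then 1 else 0)" for i j
    using fr.orthonormal by (simp add: orthonormal_frame_def)
  have Ae: "ip (G y) (A y *v ?e i) (?e j) = a $ i $ j" for i j
    using ip_commute[OF fr.sym] by (metis a_def fr.hat_entry a)
  have "ip (G y) (curv_op G y (?e i) (?e j) (?e j)) (?e i) =
      \<kappa> - (if i = j then \<kappa> else 0) - (a $ i $ i * a $ j $ j - a $ i $ j * a $ i $ j)" for i j
    by (simp add: curv_op_gauss[OF y] ip.diff_left ip.scaleR_left GG hh Ae a[of j i])
  then have "scalar_curvature G y = (\<Sum>i\<in>UNIV. \<Sum>j\<in>UNIV. \<kappa> - (if i = j then \<kappa> else 0)
      - (a $ i $ i * a $ j $ j - a $ i $ j * a $ i $ j))"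
    by (simp add: scalar_curvature_def)
  also have "\<dots> = \<kappa> * (real CARD('n) * (real CARD('n) - 1)) - (trace a * trace a - trace (a ** a))"
  proof -
    have "(\<Sum>i\<in>UNIV. \<Sum>j\<in>UNIV. a $ i $ i * a $ j $ j) = trace a * trace a"
      by (simp add: trace_def sum_product)
    then show ?thesis
      by (simp only: sum_subtractf sq[symmetric]) (simp add: algebra_simps)
  qed
  finally show "scalar_curvature G y =
      \<kappa> * (real CARD('n) * (real CARD('n) - 1)) - (trace (A y))\<^sup>2 + trace (A y ** A y)"
    by (simp add: tr power2_eq_square)
qed

lemma frame_comp_hessian:
  assumes f: "\<And>z. z \<in> V \<Longrightarrow> f z = p * (trace (A z))\<^sup>2 + q * trace (A z ** A z) + r * trace (A z) + s"
    and y: "y \<in> V"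
  defines "e \<equiv> on_frame (G y)"
  defines "a \<equiv> frame.hat (G y) e (A y)"
    and "b \<equiv> frame.dir1 (G y) e (\<lambda>k. B k y)"
    and "c \<equiv> frame.dir2 (G y) e (\<lambda>k l. C k l y)"
  shows "frame_comp (G y) (hessian G f y) i j =
    2 * p * trace (b i) * trace (b j) + (2 * p * trace a + r) * trace (c i j)
    + 2 * q * (trace (b i ** b j) + trace (a ** c i j))"
proof -
  interpret fr: frame "G y" e unfolding e_def by (rule frame_at[OF y])
  let ?\<Sigma> = "\<lambda>F. \<Sum>k\<in>UNIV. \<Sum>l\<in>UNIV. e i $ k * e j $ l * F k l :: real"
  have bb: "?\<Sigma> (\<lambda>k l. trace (B k y) * trace (B l y)) = trace (b i) * trace (b j)"
    by (simp add: b_def fr.trace_dir1 sum_product mult_ac)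
  have hs: "hessian G f y $ k $ l = 2 * p * trace (B k y) * trace (B l y)
      + (2 * p * trace (A y) + r) * trace (C k l y) + 2 * q * (trace (B k y ** B l y) + trace (A y ** C k l y))"
    for k l by (rule hessian_trace_polynomial[OF f y])
  have "frame_comp (G y) (hessian G f y) i j = ?\<Sigma> (\<lambda>k l. hessian G f y $ k $ l)"
    by (simp add: frame_comp_def ip_sum_components e_def mult_ac)
  also have "\<dots> = (\<Sum>k\<in>UNIV. \<Sum>l\<in>UNIV.
      2 * p * (e i $ k * e j $ l * (trace (B k y) * trace (B l y)))
      + (2 * p * trace (A y) + r) * (e i $ k * e j $ l * trace (C k l y))
      + 2 * q * (e i $ k * e j $ l * trace (B k y ** B l y) + e i $ k * e j $ l * trace (A y ** C k l y)))"
    unfolding hs by (intro sum.cong refl) (simp add: algebra_simps)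
  also have "\<dots> = 2 * p * ?\<Sigma> (\<lambda>k l. trace (B k y) * trace (B l y))
      + (2 * p * trace (A y) + r) * ?\<Sigma> (\<lambda>k l. trace (C k l y))
      + 2 * q * (?\<Sigma> (\<lambda>k l. trace (B k y ** B l y)) + ?\<Sigma> (\<lambda>k l. trace (A y ** C k l y)))"
    by (simp only: sum.distrib sum_distrib_left[symmetric])
  finally show ?thesis
    unfolding bb by (simp add: a_def b_def c_def fr.trace_hat fr.trace_dir2 fr.trace_dir1_dir1
        fr.trace_hat_dir2)
qed

text \<open>The Hessian formula is used with (p, q, r) = (1, -1, (n-1) \<alpha>) for the constant in
  \<open>relation\<close>, (0, 0, 1) for nH and (-1, 1, 0) for n(n-1)R. The first use feeds
  \<open>gradient_inequality\<close>, the other two evaluate the operators in the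
  conclusion.\<close>

lemma box_mean_curvature_ge:
  fixes \<alpha> \<beta> c0 :: real
  defines "n \<equiv> real CARD('n)"
  assumes n: "CARD('n) \<ge> 2" and c0: "c0 \<le> \<kappa>"
    and relation: "\<And>z. z \<in> V \<Longrightarrow>
      (trace (A z))\<^sup>2 - trace (A z ** A z) + (n - 1) * \<alpha> * trace (A z) = n * (n - 1) * \<beta>"
    and nonneg: "(n - 1) * \<alpha>\<^sup>2 + 4 * n * \<beta> \<ge> 0"
    and y: "y \<in> V"
  shows "(traceless_norm G h y)\<^sup>2 = sff_squared_length G h y - n * (mean_curvature G h y)\<^sup>2"
    and "box_op G h (\<lambda>z. n * mean_curvature G h z) y \<ge>
      - (1/2) * laplacian G (\<lambda>z. n * (n - 1) * normalized_scalar_curvature G z) y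
      + (traceless_norm G h y)\<^sup>2 * L_poly n c0 \<bar>mean_curvature G h y\<bar> (traceless_norm G h y)"
proof -
  have npos: "n \<ge> 2" using n by (simp add: n_def)
  define e where "e = on_frame (G y)"
  interpret fr: frame "G y" e unfolding e_def by (rule frame_at[OF y])
  define a where "a = fr.hat (A y)"
  define b where "b = fr.dir1 (\<lambda>k. B k y)"
  define c where "c = fr.dir2 (\<lambda>k l. C k l y)"
  define F where "F = fr.dir2 (\<lambda>k l. curv_matrix G k l y)"
  define H where "H = mean_curvature G h y"
  define f where "f = traceless_norm G h y"
  have a_sym: "transpose a = a"
    unfolding a_def by (rule fr.hat_sym[OF A_selfadjoint[OF y]])
  have a: "a $ i $ j = a $ j $ i" for i j
    using transpose_nth[of a j i] by (simp add: a_sym)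
  have b_sym: "transpose (b i) = b i" for i
    unfolding b_def by (rule fr.dir1_sym[OF B_selfadjoint[OF y]])
  have "transpose (c i j) = c i j" for i j
    unfolding c_def by (rule fr.dir2_sym[OF C_selfadjoint[OF y]])
  then have c_sym: "c i j $ k $ l = c i j $ l $ k" for i j k l
    using transpose_nth[of "c i j" l k] by simp
  have c_codazzi: "c i j $ k $ l = c i l $ k $ j" for i j k l
    unfolding c_def by (rule fr.dir2_codazzi[OF C_sym[OF y]])
  have c_commutator: "c i j - c j i = F i j ** a - a ** F i j" for i j
    unfolding c_def F_def a_def by (rule fr.dir2_commutator[OF C_commutator[OF y]])
  have tr: "trace a = trace (A y)" "trace (a ** a) = trace (A y ** A y)"
    by (simp_all add: a_def fr.hat_mult[symmetric] fr.trace_hat)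
  have h_comp: "frame_comp (G y) (h y) i j = a $ i $ j" for i j
    by (simp add: frame_comp_h[OF y] a_def e_def)
  have GG: "ip (G y) (e i) (e j) = (if i = j then 1 else 0)" for i j
    using fr.orthonormal by (simp add: orthonormal_frame_def)
  have F: "F i j $ k $ l = \<kappa> * ((if j = l then 1 else 0) * (if i = k then 1 else 0)
      - (if i = l then 1 else 0) * (if j = k then 1 else 0)) - (a $ j $ l * a $ i $ k - a $ i $ l * a $ j $ k)"
    for i j k l
  proof -
    have hh: "ip (h y) (e i) (e j) = a $ i $ j" for i j
      using h_comp[of i j] by (simp add: frame_comp_def e_def)
    have "F i j $ k $ l = (\<Sum>p\<in>UNIV. \<Sum>q\<in>UNIV. e i $ p * e j $ q * ip (G y) (e k) (curv_matrix G p q y *v e l))"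
      by (simp add: F_def fr.dir2_def fr.hat_entry)
    also have "\<dots> = ip (G y) (e k) (curv_op G y (e i) (e j) (e l))"
      by (simp add: curv_op_matrix ip.sum_right ip.scaleR_right)
    finally show ?thesis
      using fr.hat_entry[of "A y" k] a[of k]
      by (simp add: curv_op_gauss[OF y] ip.diff_right ip.scaleR_right GG hh a_def[symmetric]
          eq_commute[of k])
  qed
  have tau: "trace (A z) = n * mean_curvature G h z" if "z \<in> V" for z
    using npos by (simp add: mean_curvature_eq[OF that] n_def)
  have H: "trace a = n * H" by (simp add: tr tau[OF y] H_def)
  have f2: "f\<^sup>2 = trace (a ** a) - n * H\<^sup>2"
  proof -
    have "f\<^sup>2 = (\<Sum>i\<in>UNIV. \<Sum>j\<in>UNIV. (a $ i $ j - H * (if i = j then 1 else 0))\<^sup>2)"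
      by (simp add: f_def traceless_norm_def h_comp H_def[symmetric] sum_nonneg)
    also have "\<dots> = (\<Sum>i\<in>UNIV. \<Sum>j\<in>UNIV. a $ i $ j * a $ j $ i
        + (if i = j then H\<^sup>2 - 2 * H * a $ i $ i else 0))"
      by (intro sum.cong refl) (simp add: power2_eq_square algebra_simps a[of _ "_ :: 'n"])
    also have "\<dots> = trace (a ** a) + (n * H\<^sup>2 - 2 * H * trace a)"
      by (simp add: sum.distrib sum_subtractf trace_def matrix_matrix_mult_def n_def sum_distrib_left)
    finally show ?thesis by (simp add: H power2_eq_square)
  qed
  have f0: "f \<ge> 0" by (simp add: f_def traceless_norm_def sum_nonneg)
  show "(traceless_norm G h y)\<^sup>2 = sff_squared_length G h y - n * (mean_curvature G h y)\<^sup>2"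
    using f2 by (simp add: f_def H_def tr sff_squared_length_eq[OF y])
  note hess = frame_comp_hessian[OF _ y, folded e_def, folded a_def b_def c_def]
  \<comment> \<open>Read as a formula for a constant function, the relation makes the vanishing of
    that function's derivatives a statement about traces.\<close>
  have const_relation: "n * (n - 1) * \<beta> = 1 * (trace (A z))\<^sup>2 + (- 1) * trace (A z ** A z)
      + (n - 1) * \<alpha> * trace (A z) + 0" if "z \<in> V" for z
    using relation[OF that] by simp
  have gradient: "(\<Sum>i\<in>UNIV. (trace (b i))\<^sup>2) \<le> (\<Sum>i\<in>UNIV. trace (b i ** b i))"
  proof (rule gradient_inequality[OF n a_sym b_sym, where \<alpha> = \<alpha> and \<beta> = \<beta> and c = "\<lambda>i. c i i"],
      unfold n_def[symmetric])
    show "(trace a)\<^sup>2 - trace (a ** a) + (n - 1) * \<alpha> * trace a = n * (n - 1) * \<beta>"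
      using relation[OF y] by (simp add: tr)
    fix i
    have "pd k (\<lambda>z. n * (n - 1) * \<beta>) y = (2 * trace (A y) + (n - 1) * \<alpha>) * trace (B k y)
        - 2 * trace (A y ** B k y)" for k
      using pd_trace_polynomial[OF const_relation y, of k] by simp
    then have "(2 * trace (A y) + (n - 1) * \<alpha>) * trace (B k y) = 2 * trace (A y ** B k y)" for k
      by simp
    then have "(\<Sum>k\<in>UNIV. e i $ k * ((2 * trace (A y) + (n - 1) * \<alpha>) * trace (B k y)))
        = (\<Sum>k\<in>UNIV. e i $ k * (2 * trace (A y ** B k y)))" by simp
    then show "(2 * trace a + (n - 1) * \<alpha>) * trace (b i) = 2 * trace (a ** b i)"
      by (simp only: tr(1) b_def a_def fr.trace_dir1 fr.trace_hat_dir1 fr.trace_hat sum_distrib_left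
          mult.left_commute)
    have "frame_comp (G y) (hessian G (\<lambda>z. n * (n - 1) * \<beta>) y) i i = 0"
      by (simp add: frame_comp_def ip_sum_components hessian_def)
    then show "2 * (trace (b i))\<^sup>2 + (2 * trace a + (n - 1) * \<alpha>) * trace (c i i)
      - 2 * (trace (b i ** b i) + trace (a ** c i i)) = 0"
      using hess[where f = "\<lambda>z. n * (n - 1) * \<beta>", OF const_relation, of i i]
      by (simp add: power2_eq_square)
  qed (rule nonneg)
  have box: "box_op G h (\<lambda>z. n * mean_curvature G h z) y =
      (\<Sum>i\<in>UNIV. \<Sum>j\<in>UNIV. (n * H * (if i = j then 1 else 0) - a $ i $ j) * trace (c i j))"
  proof -
    have "n * mean_curvature G h z = 0 * (trace (A z))\<^sup>2 + 0 * trace (A z ** A z) + 1 * trace (A z) + 0"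
      if "z \<in> V" for z using tau[OF that] by simp
    from hess[OF this] show ?thesis
      by (simp add: box_op_def h_comp H_def[symmetric] n_def[symmetric])
  qed
  have lap: "laplacian G (\<lambda>z. n * (n - 1) * normalized_scalar_curvature G z) y =
      (\<Sum>i\<in>UNIV. - 2 * (trace (b i))\<^sup>2 - 2 * (n * H) * trace (c i i)
        + 2 * (trace (b i ** b i) + trace (a ** c i i)))"
  proof -
    have "n * (n - 1) * normalized_scalar_curvature G z =
        (- 1) * (trace (A z))\<^sup>2 + 1 * trace (A z ** A z) + 0 * trace (A z) + \<kappa> * (n * (n - 1))"
      if "z \<in> V" for z
      using npos by (simp add: normalized_scalar_curvature_def scalar_curvature_eq[OF that] n_def[symmetric])
    from hess[OF this] show ?thesis
      by (simp add: laplacian_def H power2_eq_square mult.assoc)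
  qed
  have "- (1/2) * laplacian G (\<lambda>z. n * (n - 1) * normalized_scalar_curvature G z) y =
      (\<Sum>i\<in>UNIV. (trace (b i))\<^sup>2 + n * H * trace (c i i) - trace (b i ** b i) - trace (a ** c i i))"
    unfolding lap sum_distrib_left by (intro sum.cong refl) (simp add: algebra_simps)
  moreover have "(\<Sum>i\<in>UNIV. \<Sum>j\<in>UNIV. (n * H * (if i = j then 1 else 0) - a $ i $ j) * trace (c i j)) \<ge>
    (\<Sum>i\<in>UNIV. (trace (b i))\<^sup>2 + n * H * trace (c i i) - trace (b i ** b i) - trace (a ** c i i))
    + f\<^sup>2 * L_poly n c0 \<bar>H\<bar> f"
    unfolding n_def
    by (rule pinching_inequality[OF n a F c_codazzi c_sym c_commutator c0 gradient H[unfolded n_def]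
        f0 f2[unfolded n_def]])
  ultimately show "box_op G h (\<lambda>z. n * mean_curvature G h z) y \<ge>
      - (1/2) * laplacian G (\<lambda>z. n * (n - 1) * normalized_scalar_curvature G z) y
      + (traceless_norm G h y)\<^sup>2 * L_poly n c0 \<bar>mean_curvature G h y\<bar> (traceless_norm G h y)"
    unfolding box by (simp add: f_def H_def)
qed

text \<open>A tangent coordinate plane is a spacelike plane on which the lower bound of the
  sectional curvature can be tested, which compares that bound with \<kappa>.\<close>

lemma tangent_plane_curvature:
  assumes y: "y \<in> V" and ij: "i \<noteq> j"
  shows "nondegenerate_plane (g (X y)) (pd i X y) (pd j X y)"
    and "sectional_curvature g (X y) (pd i X y) (pd j X y) = \<kappa>"
proof -
  let ?u = "pd i X y" and ?v = "pd j X y"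
  have entries: "ip (g (X y)) (pd k X y) (pd l X y) = G y $ k $ l" for k l
    by (simp add: G_def[OF y])
  \<comment> \<open>A multiple of the Gram-Schmidt vector of the pair; its square is G_jj times the
    discriminant, so positivity of \<open>G y\<close> makes the discriminant positive.\<close>
  define w :: "real^'n" where "w = (G y $ j $ j) *\<^sub>R axis i 1 - (G y $ i $ j) *\<^sub>R axis j 1"
  have jj: "G y $ j $ j > 0"
    using pdX_spacelike[OF y, of j] by (simp add: spacelike_def entries)
  have "w $ i = G y $ j $ j" using ij by (simp add: w_def axis_def)
  then have "w \<noteq> 0" using jj by auto
  then have "ip (G y) w w > 0" using G_pos[OF y] by (simp add: positive_definite_def)
  moreover have "ip (G y) w w = G y $ j $ j * plane_disc (g (X y)) ?u ?v"
    using intrinsic.G_entry_sym[OF y, of j i]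
    by (simp add: w_def ip.diff_left ip.diff_right ip.scaleR_left ip.scaleR_right ip_axis
        plane_disc_def entries power2_eq_square algebra_simps)
  ultimately have disc: "plane_disc (g (X y)) ?u ?v > 0"
    using jj by (simp add: zero_less_mult_iff)
  then show "nondegenerate_plane (g (X y)) ?u ?v" by (simp add: nondegenerate_plane_def)
  have "ip (g (X y)) (curv_op g (X y) ?u ?v ?v) ?u = \<kappa> * plane_disc (g (X y)) ?u ?v"
    using ip_sym[OF y, of ?v ?u]
    by (simp add: ambient_curvature[OF y] ip.diff_left ip.scaleR_left plane_disc_def power2_eq_square
        algebra_simps)
  then show "sectional_curvature g (X y) ?u ?v = \<kappa>"
    using disc by (simp add: sectional_curvature_def)
qed

end

section \<open>From charts to coordinate patches\<close>

lemma chart_inv_chart: "inj_on (snd c) (fst c) \<Longrightarrow> p \<in> fst c \<Longrightarrow> chart_inv c (snd c p) = p"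
  by (simp add: chart_inv_def)

lemma smooth_manifold_chart:
  assumes "smooth_manifold T A" "c \<in> A"
  shows "openin T (fst c)" "open (snd c ` fst c)" "inj_on (snd c) (fst c)"
    "homeomorphic_map (subtopology T (fst c)) (top_of_set (snd c ` fst c)) (snd c)"
proof -
  show c: "openin T (fst c)" "open (snd c ` fst c)"
    "homeomorphic_map (subtopology T (fst c)) (top_of_set (snd c ` fst c)) (snd c)"
    using assms by (simp_all add: smooth_manifold_def)
  from c(1) have "topspace (subtopology T (fst c)) = fst c"
    by (simp add: openin_subset Int_absorb1)
  with c(3) show "inj_on (snd c) (fst c)" by (simp add: homeomorphic_map_def)
qed

lemma open_loc_dom:
  assumes M: "smooth_manifold TM AM" "c \<in> AM" and L: "smooth_manifold TL AL" "d \<in> AL"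
    and x: "continuous_map TM TL x"
  shows "open (loc_dom x c d)"
proof -
  note c = smooth_manifold_chart[OF M] and d = smooth_manifold_chart[OF L]
  have "{p \<in> fst c. x p \<in> fst d} = {p \<in> topspace TM. x p \<in> fst d} \<inter> fst c"
    using openin_subset[OF c(1)] by auto
  moreover have "openin TM {p \<in> topspace TM. x p \<in> fst d}"
    by (rule openin_continuous_map_preimage[OF x d(1)])
  ultimately have "openin (subtopology TM (fst c)) {p \<in> fst c. x p \<in> fst d}"
    by (auto simp: openin_subtopology)
  moreover have "open_map (subtopology TM (fst c)) (top_of_set (snd c ` fst c)) (snd c)"
    by (rule homeomorphic_imp_open_map[OF c(4)])
  ultimately have "openin (top_of_set (snd c ` fst c)) (loc_dom x c d)"
    by (simp add: loc_dom_def open_map_def)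
  then show ?thesis by (rule openin_open_trans[OF _ c(2)])
qed

lemma ambient_deriv_cov:
  "ambient_deriv g x c d i j y = cov (g d \<circ> chart_inv d) (loc_map x c d) i (pd j (loc_map x c d)) y"
proof -
  have "(\<chi> k. \<Sum>r\<in>UNIV. \<Sum>s\<in>UNIV. christoffel (g d \<circ> chart_inv d) k r s (loc_map x c d y)
      * pd i (loc_map x c d) y $ r * pd j (loc_map x c d) y $ s) =
    pull_conn (g d \<circ> chart_inv d) (loc_map x c d) i y *v pd j (loc_map x c d) y"
  proof (subst vec_eq_iff, intro allI)
    fix k
    show "(\<chi> k. \<Sum>r\<in>UNIV. \<Sum>s\<in>UNIV. christoffel (g d \<circ> chart_inv d) k r s (loc_map x c d y)
      * pd i (loc_map x c d) y $ r * pd j (loc_map x c d) y $ s) $ k =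
      (pull_conn (g d \<circ> chart_inv d) (loc_map x c d) i y *v pd j (loc_map x c d) y) $ k"
      by (subst vec_lambda_beta, subst sum.swap)
        (simp add: pull_conn_def matrix_vector_mult_def conn_def sum_distrib_right sum_distrib_left mult_ac)
  qed
  then show ?thesis by (simp add: ambient_deriv_def cov_def Let_def)
qed

lemma hypersurface_patch_charts:
  fixes AL :: "('q, 'm::finite) chart set" and AM :: "('p, 'n::finite) chart set"
  assumes L: "lorentz_space TL AL g" and M: "spacelike_hypersurface TL AL g TM AM x"
    and N: "unit_timelike_normal AL g AM x N" and c: "c \<in> AM" and d: "d \<in> AL"
    and sec: "\<And>q u v. q \<in> fst d \<Longrightarrow> spacelike (g d q) u \<Longrightarrow> timelike (g d q) v \<Longrightarrow>
      sectional_curvature (g d \<circ> chart_inv d) (snd d q) u v = \<kappa>"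
  shows "hypersurface_patch (snd d ` fst d) (g d \<circ> chart_inv d) (loc_dom x c d) (loc_map x c d)
    (N d \<circ> chart_inv c) (induced_metric g x c d) (second_fundamental_form g x N c d) \<kappa>"
proof -
  have LL: "smooth_manifold TL AL" and metric: "semi_riemannian_metric AL g 1"
    using L by (simp_all add: lorentz_space_def)
  have MM: "smooth_manifold TM AM" and card: "CARD('m) = CARD('n) + 1" and x: "continuous_map TM TL x"
    using M by (simp_all add: spacelike_hypersurface_def)
  note cc = smooth_manifold_chart[OF MM c] and dc = smooth_manifold_chart[OF LL d]
  note inv_d = chart_inv_chart[OF dc(3)] and inv_c = chart_inv_chart[OF cc(3)]
  have dom: "\<exists>p. p \<in> fst c \<and> x p \<in> fst d \<and> y = snd c p \<and> chart_inv c y = p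
      \<and> loc_map x c d y = snd d (x p) \<and> (g d \<circ> chart_inv d) (loc_map x c d y) = g d (x p)"
    if y: "y \<in> loc_dom x c d" for y
  proof -
    obtain p where p: "p \<in> fst c" "x p \<in> fst d" "y = snd c p"
      using y by (auto simp: loc_dom_def)
    then show ?thesis
      using inv_c[OF p(1)] inv_d[OF p(2)] by (intro exI[of _ p]) (simp add: loc_map_def)
  qed
  have gd: "smooth_on (snd d ` fst d) (g d \<circ> chart_inv d)"
    "\<And>q. q \<in> fst d \<Longrightarrow> transpose (g d q) = g d q \<and> invertible (g d q)"
  proof -
    from metric[unfolded semi_riemannian_metric_def]
    have "\<forall>d\<in>AL. smooth_on (snd d ` fst d) (g d \<circ> chart_inv d)"
      "\<forall>d\<in>AL. \<forall>q\<in>fst d. transpose (g d q) = g d q \<and> invertible (g d q) \<and> form_index (g d q) = 1"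
      by blast+
    with d show "smooth_on (snd d ` fst d) (g d \<circ> chart_inv d)"
      "\<And>q. q \<in> fst d \<Longrightarrow> transpose (g d q) = g d q \<and> invertible (g d q)"
      by blast+
  qed
  have X: "smooth_on (loc_dom x c d) (loc_map x c d)"
    "\<And>y. y \<in> loc_dom x c d \<Longrightarrow> positive_definite (induced_metric g x c d y)"
    using M c d unfolding spacelike_hypersurface_def by blast+
  have Nd: "smooth_on (loc_dom x c d) (N d \<circ> chart_inv c)"
    "\<And>p. p \<in> fst c \<Longrightarrow> x p \<in> fst d \<Longrightarrow> ip (g d (x p)) (N d p) (N d p) = - 1"
    "\<And>p i. p \<in> fst c \<Longrightarrow> x p \<in> fst d \<Longrightarrow> ip (g d (x p)) (N d p) (pd i (loc_map x c d) (snd c p)) = 0"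
    using N c d unfolding unit_timelike_normal_def by blast+
  show ?thesis
  proof
    show "open (snd d ` fst d)" by (rule dc(2))
    show "smooth_on (snd d ` fst d) (g d \<circ> chart_inv d)" by (rule gd(1))
    show "transpose ((g d \<circ> chart_inv d) q) = (g d \<circ> chart_inv d) q"
      "invertible ((g d \<circ> chart_inv d) q)" if "q \<in> snd d ` fst d" for q
    proof -
      obtain p where p: "p \<in> fst d" "q = snd d p" using \<open>q \<in> snd d ` fst d\<close> by blast
      then show "transpose ((g d \<circ> chart_inv d) q) = (g d \<circ> chart_inv d) q"
        "invertible ((g d \<circ> chart_inv d) q)"
        using gd(2)[OF p(1)] inv_d[OF p(1)] by simp_all
    qed
    show "open (loc_dom x c d)" by (rule open_loc_dom[OF MM c LL d x])
    show "smooth_on (loc_dom x c d) (loc_map x c d)" by (rule X(1))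
    show "smooth_on (loc_dom x c d) (N d \<circ> chart_inv c)" by (rule Nd(1))
    show "CARD('m) = CARD('n) + 1" by (rule card)
    fix y assume y: "y \<in> loc_dom x c d"
    then obtain p where p: "p \<in> fst c" "x p \<in> fst d" "y = snd c p" "chart_inv c y = p"
      "loc_map x c d y = snd d (x p)" "(g d \<circ> chart_inv d) (loc_map x c d y) = g d (x p)"
      using dom[OF y] by (elim exE conjE) (rule that)
    show "loc_map x c d y \<in> snd d ` fst d" using p by simp
    show "ip ((g d \<circ> chart_inv d) (loc_map x c d y)) ((N d \<circ> chart_inv c) y) ((N d \<circ> chart_inv c) y) = - 1"
      unfolding p(6) using p(4) Nd(2)[OF p(1,2)] by simp
    show "ip ((g d \<circ> chart_inv d) (loc_map x c d y)) ((N d \<circ> chart_inv c) y) (pd i (loc_map x c d) y) = 0" for i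
      unfolding p(6) using p(3,4) Nd(3)[OF p(1,2)] by simp
    show "induced_metric g x c d y = (\<chi> i j. ip ((g d \<circ> chart_inv d) (loc_map x c d y))
        (pd i (loc_map x c d) y) (pd j (loc_map x c d) y))"
      unfolding p(6) by (simp add: induced_metric_def p(4))
    show "positive_definite (induced_metric g x c d y)" by (rule X(2)[OF y])
    show "second_fundamental_form g x N c d y = (\<chi> i j. - ip ((g d \<circ> chart_inv d) (loc_map x c d y))
        (cov (g d \<circ> chart_inv d) (loc_map x c d) i (pd j (loc_map x c d)) y) ((N d \<circ> chart_inv c) y))"
      unfolding p(6) by (simp add: second_fundamental_form_def ambient_deriv_cov p(4))
    show "sectional_curvature (g d \<circ> chart_inv d) (loc_map x c d y) u v = \<kappa>"
      if "spacelike ((g d \<circ> chart_inv d) (loc_map x c d y)) u"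
        "timelike ((g d \<circ> chart_inv d) (loc_map x c d y)) v" for u v
      using sec[OF p(2) that[unfolded p(6)]] unfolding p(5) .
  qed
qed

theorem proposition4p1:
  fixes TL :: "'q topology" and AL :: "('q, 'm::finite) chart set"
    and g :: "('q, 'm) chart \<Rightarrow> 'q \<Rightarrow> real^'m^'m"
    and TM :: "'p topology" and AM :: "('p, 'n::finite) chart set"
    and x :: "'p \<Rightarrow> 'q" and N :: "('q, 'm) chart \<Rightarrow> 'p \<Rightarrow> real^'m"
    and G h :: "('p, 'n) chart \<Rightarrow> ('q, 'm) chart \<Rightarrow> real^'n \<Rightarrow> real^'n^'n"
    and H S R P \<phi> :: "('p, 'n) chart \<Rightarrow> ('q, 'm) chart \<Rightarrow> real^'n \<Rightarrow> real"
    and n c1 c2 c\<^sub>0 a b :: real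
  assumes "n = real CARD('n)" and "CARD('n) \<ge> 3"
    and "lorentz_space TL AL g" and "locally_symmetric AL g"
    and "\<And>d q u v. d \<in> AL \<Longrightarrow> q \<in> fst d \<Longrightarrow> spacelike (g d q) u \<Longrightarrow> timelike (g d q) v \<Longrightarrow>
           sectional_curvature (g d \<circ> chart_inv d) (snd d q) u v = - c1 / n"
    and "\<And>d q u v. d \<in> AL \<Longrightarrow> q \<in> fst d \<Longrightarrow> spacelike (g d q) u \<Longrightarrow> spacelike (g d q) v \<Longrightarrow>
           nondegenerate_plane (g d q) u v \<Longrightarrow>
           sectional_curvature (g d \<circ> chart_inv d) (snd d q) u v \<ge> c2"
    and "c\<^sub>0 = 2 * c2 + c1 / n" and "c\<^sub>0 > 0"
    and "spacelike_hypersurface TL AL g TM AM x"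
    and "unit_timelike_normal AL g AM x N"
    and "\<And>c d. G c d = induced_metric g x c d"
    and "\<And>c d. h c d = second_fundamental_form g x N c d"
    and "\<And>c d. R c d = normalized_scalar_curvature (G c d)"
    and "\<And>c d. H c d = mean_curvature (G c d) (h c d)"
    and "\<And>c d. S c d = sff_squared_length (G c d) (h c d)"
    and "\<And>c d. \<phi> c d = traceless_norm (G c d) (h c d)"
    and "\<And>c d y. n * (n - 1) * P c d y = n\<^sup>2 * (H c d y)\<^sup>2 - S c d y"
    and "\<And>c d y. c \<in> AM \<Longrightarrow> d \<in> AL \<Longrightarrow> y \<in> loc_dom x c d \<Longrightarrow> P c d y + a * H c d y = b"
    and "(n - 1) * a\<^sup>2 + 4 * n * b \<ge> 0"
  shows "\<forall>c\<in>AM. \<forall>d\<in>AL. \<forall>y\<in>loc_dom x c d.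
      (\<phi> c d y)\<^sup>2 = S c d y - n * (H c d y)\<^sup>2 \<and>
      box_op (G c d) (h c d) (\<lambda>z. n * H c d z) y \<ge>
        - (1/2) * laplacian (G c d) (\<lambda>z. n * (n - 1) * R c d z) y
        + (\<phi> c d y)\<^sup>2 * L_poly n c\<^sub>0 \<bar>H c d y\<bar> (\<phi> c d y)"
proof (intro ballI)
  fix c d y
  assume c: "c \<in> AM" and d: "d \<in> AL" and y: "y \<in> loc_dom x c d"
  define \<kappa> where "\<kappa> = - c1 / n"
  interpret hypersurface_patch "snd d ` fst d" "g d \<circ> chart_inv d" "loc_dom x c d" "loc_map x c d"
    "N d \<circ> chart_inv c" "G c d" "h c d" \<kappa>
    unfolding assms(11,12) \<kappa>_def
    by (rule hypersurface_patch_charts[OF assms(3,9,10) c d assms(5)[OF d]])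
  have n: "CARD('n) \<ge> 2" "n \<ge> 3" using assms(1,2) by simp_all
  have "c2 \<le> \<kappa>"
  proof -
    \<comment> \<open>Two distinct coordinate directions, to span a tangent plane.\<close>
    obtain i j :: 'n where ij: "i \<noteq> j"
    proof -
      have "(UNIV :: 'n set) \<noteq> {i}" for i
      proof
        assume "(UNIV :: 'n set) = {i}"
        from arg_cong[OF this, of card] have "CARD('n) = 1" by (simp only: card.insert finite.emptyI empty_iff not_False_eq_True card.empty)
        with n(1) show False by simp
      qed
      then show ?thesis using that by blast
    qed
    obtain q where q: "q \<in> fst d" "loc_map x c d y = snd d q"
      using X_in[OF y] by blast
    have inv: "chart_inv d (snd d q) = q"
      by (rule chart_inv_chart[OF smooth_manifold_chart(3) q(1)]) (use assms(3) d in \<open>auto simp: lorentz_space_def\<close>)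
    have "(g d \<circ> chart_inv d) (loc_map x c d y) = g d q" using inv q(2) by simp
    then show ?thesis
      using assms(6)[OF d q(1)] tangent_plane_curvature[OF y ij] pdX_spacelike[OF y] q(2) by metis
  qed
  \<comment> \<open>By the definition of \<kappa>, \<open>c\<^sub>0\<close> is 2 c2 -
    \<kappa>.\<close>
  then have c0: "c\<^sub>0 \<le> \<kappa>" by (simp add: assms(7) \<kappa>_def)
  \<comment> \<open>The relation P + a H = b multiplied by n (n - 1); since tr A = n H, the linear
    term becomes (n - 1) a tr A.\<close>
  have relation: "(trace (A z))\<^sup>2 - trace (A z ** A z) + (real CARD('n) - 1) * a * trace (A z)
      = real CARD('n) * (real CARD('n) - 1) * b" if z: "z \<in> loc_dom x c d" for z
  proof -
    have "H c d z = trace (A z) / n" "S c d z = trace (A z ** A z)"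
      by (simp_all add: assms(1,14,15) mean_curvature_eq[OF z] sff_squared_length_eq[OF z])
    then have "trace (A z) = n * H c d z" and S: "trace (A z ** A z) = S c d z" using n by simp_all
    moreover have "n * (n - 1) * b = (n\<^sup>2 * (H c d z)\<^sup>2 - S c d z) + n * (n - 1) * (a * H c d z)"
      unfolding assms(17)[symmetric] using assms(18)[OF c d z] by (simp add: distrib_left[symmetric])
    ultimately show ?thesis
      unfolding assms(1)[symmetric] by (simp add: power_mult_distrib)
  qed
  show "(\<phi> c d y)\<^sup>2 = S c d y - n * (H c d y)\<^sup>2 \<and>
      box_op (G c d) (h c d) (\<lambda>z. n * H c d z) y \<ge>
        - (1/2) * laplacian (G c d) (\<lambda>z. n * (n - 1) * R c d z) y
        + (\<phi> c d y)\<^sup>2 * L_poly n c\<^sub>0 \<bar>H c d y\<bar> (\<phi> c d y)"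
    using box_mean_curvature_ge[OF n(1) c0 relation assms(19)[unfolded assms(1)] y]
    unfolding assms(1,13-16) by blast
qed

end
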